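(* Let $d_1,d_2\ge 0$ be integers with $d=d_1+d_2\ge 2$ and let $D=\mathbb{Z}_+^{d_1}\times\mathbb{Z}^{d_2}$. (i) Let $H$ be the operator on $\ell^2(D)$ given by $$(Hf)_z=\sum_{i=1}^{d}\bigl(a^i_{z-\varsigma_i}f_{z-\varsigma_i}+a^i_z f_{z+\varsigma_i}\bigr)+V(z)f_z,\qquad z\in D,\quad f_z:=0 \text{ for } z\in\mathbb{Z}^d\setminus D,$$ where $V$ and $a^1,\dots,a^d$ are real octant periodic functions on $D$. Then $$\bigcup_{\omega\in\Omega_{d_2}}\sigma(H_\omega)\subseteq\sigma_{ess}(H).$$ (ii) Let $I\subset\mathbb{R}$ be a finite open interval. Then for any integer $N\ge 0$ there exist real octant periodic functions $V,a^1,\dots,a^d$ on $D$ such that the operator $H$ on $\ell^2(D)$ given by $$(Hf)_z=\sum_{i=1}^{d}\bigl(a^i_{z-\varsigma_i}f_{z-\varsigma_i}+a^i_z f_{z+\varsigma_i}\bigr)+V(z)f_z,\qquad z\in D,\quad f_z:=0 \text{ for } z\in\mathbb{Z}^d\setminus D,$$ has exactly $N$ eigenvalues, counted with multiplicity, in $I$, and $H$ has no other spectrum in $I$. Moreover, $H$ has spectrum both to the left of $I$ and to the right of $I$, and the corresponding spectral subspaces (the ranges of the spectral projections of $H$ for the part of $\mathbb{R}$ to the left of $I$ and for the part of $\mathbb{R}$ to the right of $I$) are both infinite dimensional.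
   Context: $\mathbb{Z}_+=\{1,2,3,\dots\}$, $\mathbb{Z}_-=\mathbb{Z}\setminus\mathbb{Z}_+=\{\dots,-2,-1,0\}$, and $\varsigma_1,\dots,\varsigma_d$ is the standard basis of $\mathbb{Z}^d$. Points of $D$ are written $z=(x,y)$ with $x\in\mathbb{Z}_+^{d_1}$, $y\in\mathbb{Z}^{d_2}$. The convention $f_z=0$ for $z\notin D$ is the Dirichlet boundary condition on the boundary of $\mathbb{Z}_+^{d_1}$. For $m\ge0$, $\Omega_m$ is the set of all sequences $\omega=(\omega_j)_{j=1}^m$ with $\omega_j\in\{+,-\}$; for $\omega\in\Omega_m$ the octant is $\mathcal{Z}_\omega=\mathbb{Z}_{\omega_1}\times\cdots\times\mathbb{Z}_{\omega_m}\subset\mathbb{Z}^m$, with characteristic function $\chi_\omega$. (If $m=0$, $\Omega_0$ consists of the empty sequence only and $\chi_\omega= 1$.) A function $F$ on $D$ is called octant periodic if $$F(x,y)=\sum_{\omega\in\Omega_{d_2}}F_\omega(x,y)\chi_\omega(y),\qquad (x,y)\in D,$$ where each $F_\omega$ is a function on $\mathbb{Z}^d$ that is periodic: $F_\omega(z+\mathfrak{p}_i\varsigma_i)=F_\omega(z)$ for all $z\in\mathbb{Z}^d$, $i\in\{1,\dots,d\}$, for some positive integers $\mathfrak{p}_i=\mathfrak{p}_i(\omega)$. Given the decompositions of the octant periodic functions $V$ and $a^i$ into periodic functions $V_\omega$ and $a^{\omega,i}$ on $\mathbb{Z}^d$, $\omega\in\Omega_{d_2}$, the operator $H_\omega$ on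 $\ell^2(\mathbb{Z}^d)$ is $$(H_\omega f)_z=\sum_{i=1}^d\bigl(a^{\omega,i}_z f_{z+\varsigma_i}+a^{\omega,i}_{z-\varsigma_i}f_{z-\varsigma_i}\bigr)+V_\omega(z)f_z,\qquad z\in\mathbb{Z}^d.$$ $\sigma$ denotes the spectrum and $\sigma_{ess}$ the essential spectrum. *)

theory Defs
  imports "HOL-Analysis.Analysis" "HOL-Library.Function_Algebras"
begin

section \<open>The Hilbert space of square summable functions\<close>

text \<open>
  Complex functions on a type form a complex vector space; the interpretation makes the library's
  span and dimension over the complex numbers available.
\<close>

interpretation cfun: vector_space "\<lambda>(c::complex) (f::'a \<Rightarrow> complex) z. c * f z"
  by unfold_locales (auto simp: fun_eq_iff algebra_simps)

definition finite_dim :: "('a \<Rightarrow> complex) set \<Rightarrow> bool" where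
  "finite_dim X \<longleftrightarrow> (\<exists>B. finite B \<and> X \<subseteq> cfun.span B)"

text \<open>
  Elements of \<open>\<ell>\<^sup>2(S)\<close> are total functions that vanish outside \<open>S\<close>. For functions on the lattice
  this is exactly the Dirichlet convention \<open>f\<^sub>z = 0\<close> for \<open>z \<notin> S\<close>.
\<close>

definition ell2 :: "'a set \<Rightarrow> ('a \<Rightarrow> complex) set" where
  "ell2 S = {f. (\<forall>z. z \<notin> S \<longrightarrow> f z = 0) \<and> (\<lambda>z. (cmod (f z))\<^sup>2) summable_on S}"

definition ell2_inner :: "'a set \<Rightarrow> ('a \<Rightarrow> complex) \<Rightarrow> ('a \<Rightarrow> complex) \<Rightarrow> complex" where
  "ell2_inner S f g = (\<Sum>\<^sub>\<infinity>z\<in>S. cnj (f z) * g z)"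

definition ell2_norm :: "'a set \<Rightarrow> ('a \<Rightarrow> complex) \<Rightarrow> real" where
  "ell2_norm S f = sqrt (\<Sum>\<^sub>\<infinity>z\<in>S. (cmod (f z))\<^sup>2)"


section \<open>Spectral theory of bounded operators\<close>

text \<open>
  A bounded operator on \<open>\<ell>\<^sup>2(S)\<close> is given by a map \<open>T\<close> on functions, of which only the restriction
  to \<open>ell2 S\<close> matters.
\<close>

type_synonym 'a operator = "('a \<Rightarrow> complex) \<Rightarrow> ('a \<Rightarrow> complex)"

definition minus_scalar :: "'a operator \<Rightarrow> complex \<Rightarrow> 'a operator" where
  "minus_scalar T l f = (\<lambda>z. T f z - l * f z)"

text \<open>The second conjunct says that the inverse of \<open>T - l\<close> is bounded.\<close>

definition resolvent_set :: "'a set \<Rightarrow> 'a operator \<Rightarrow> complex set" where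
  "resolvent_set S T = {l. bij_betw (minus_scalar T l) (ell2 S) (ell2 S) \<and>
     (\<exists>C. \<forall>f\<in>ell2 S. ell2_norm S f \<le> C * ell2_norm S (minus_scalar T l f))}"

definition spectrum :: "'a set \<Rightarrow> 'a operator \<Rightarrow> complex set" where
  "spectrum S T = - resolvent_set S T"

definition eigenspace :: "'a set \<Rightarrow> 'a operator \<Rightarrow> complex \<Rightarrow> ('a \<Rightarrow> complex) set" where
  "eigenspace S T l = {f \<in> ell2 S. minus_scalar T l f = 0}"

definition eigenvalues :: "'a set \<Rightarrow> 'a operator \<Rightarrow> complex set" where
  "eigenvalues S T = {l. \<exists>f\<in>eigenspace S T l. f \<noteq> 0}"

text \<open>
  The two finiteness conditions are needed because the library's \<open>sum\<close> and \<open>dim\<close> are \<open>0\<close> on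
  infinite sets and on infinite dimensional spaces.
\<close>

definition eigenvalue_count :: "'a set \<Rightarrow> 'a operator \<Rightarrow> complex set \<Rightarrow> nat \<Rightarrow> bool" where
  "eigenvalue_count S T I N \<longleftrightarrow>
     finite (eigenvalues S T \<inter> I) \<and>
     (\<forall>l \<in> eigenvalues S T \<inter> I. finite_dim (eigenspace S T l)) \<and>
     (\<Sum>l \<in> eigenvalues S T \<inter> I. cfun.dim (eigenspace S T l)) = N"

text \<open>
  Fredholm operators: finite dimensional kernel, closed range, range of finite codimension.
  The essential spectrum of a self-adjoint operator is the set of all \<open>l\<close> for which \<open>T - l\<close> is not
  Fredholm; equivalently, the spectrum without the isolated eigenvalues of finite multiplicity.
\<close>

definition fredholm :: "'a set \<Rightarrow> 'a operator \<Rightarrow> bool" where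
  "fredholm S T \<longleftrightarrow>
     finite_dim {f \<in> ell2 S. T f = 0} \<and>
     (\<forall>f g. (\<forall>n::nat. f n \<in> ell2 S) \<and> g \<in> ell2 S \<and> (\<lambda>n. ell2_norm S (T (f n) - g)) \<longlonglongrightarrow> 0
        \<longrightarrow> g \<in> T ` ell2 S) \<and>
     (\<exists>B. finite B \<and> B \<subseteq> ell2 S \<and> (\<forall>g\<in>ell2 S. \<exists>f\<in>ell2 S. g - T f \<in> cfun.span B))"

definition ess_spectrum :: "'a set \<Rightarrow> 'a operator \<Rightarrow> complex set" where
  "ess_spectrum S T = {l. \<not> fredholm S (minus_scalar T l)}"

definition orthogonal_projection :: "'a set \<Rightarrow> 'a operator \<Rightarrow> bool" where
  "orthogonal_projection S P \<longleftrightarrow>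
     (\<forall>f\<in>ell2 S. P f \<in> ell2 S \<and> P (P f) = P f) \<and>
     (\<forall>f\<in>ell2 S. \<forall>g\<in>ell2 S. \<forall>c. P (\<lambda>z. c * f z + g z) = (\<lambda>z. c * P f z + P g z)) \<and>
     (\<forall>f\<in>ell2 S. \<forall>g\<in>ell2 S. ell2_inner S (P f) g = ell2_inner S f (P g))"

text \<open>
  \<open>E\<close> is the projection-valued spectral measure of the bounded self-adjoint operator \<open>T\<close>, so that
  \<open>E A\<close> is the spectral projection of \<open>T\<close> for the Borel set \<open>A\<close>. The last clause is
  \<open>\<langle>f, T f\<rangle> = \<integral> t d\<langle>f, E(t) f\<rangle>\<close>, where \<open>\<langle>f, E(A) f\<rangle> = \<parallel>E(A) f\<parallel>\<^sup>2\<close>; by polarisation it amounts to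
  \<open>T = \<integral> t dE(t)\<close>. By the spectral theorem such an \<open>E\<close> exists and is unique on Borel sets and \<open>ell2 S\<close>.
\<close>

definition spectral_measure :: "'a set \<Rightarrow> 'a operator \<Rightarrow> (real set \<Rightarrow> 'a operator) \<Rightarrow> bool" where
  "spectral_measure S T E \<longleftrightarrow>
     (\<forall>A\<in>sets borel. orthogonal_projection S (E A)) \<and>
     (\<forall>f\<in>ell2 S. E UNIV f = f) \<and>
     (\<forall>A::nat \<Rightarrow> real set. range A \<subseteq> sets borel \<and> disjoint_family A \<longrightarrow>
        (\<forall>f\<in>ell2 S. (\<lambda>n. ell2_norm S (E (\<Union>k. A k) f - (\<Sum>k<n. E (A k) f))) \<longlonglongrightarrow> 0)) \<and>
     (\<forall>f\<in>ell2 S.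
        let \<mu> = measure_of UNIV (sets borel) (\<lambda>A. ennreal ((ell2_norm S (E A f))\<^sup>2))
        in integrable \<mu> (\<lambda>t. t) \<and> ell2_inner S f (T f) = of_real (\<integral>t. t \<partial>\<mu>))"


section \<open>The lattice and octant periodic functions\<close>

text \<open>
  Points of \<open>\<int>\<^sup>d\<close> are functions on the naturals that vanish outside \<open>{..<d}\<close>, so coordinates are
  numbered from \<open>0\<close>; in \<open>z = (x, y)\<close> the first \<open>d1\<close> coordinates are \<open>x\<close>, the other \<open>d2\<close> are \<open>y\<close>.
  The translate of \<open>z\<close> by \<open>k\<close> times the \<open>i\<close>-th basis vector is \<open>z(i := z i + k)\<close>.
\<close>

type_synonym point = "nat \<Rightarrow> int"

definition lattice :: "nat \<Rightarrow> point set" where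
  "lattice d = {z. \<forall>i\<ge>d. z i = 0}"

definition domain :: "nat \<Rightarrow> nat \<Rightarrow> point set" where
  "domain d1 d2 = {z \<in> lattice (d1 + d2). \<forall>i<d1. z i \<ge> 1}"

definition ypart :: "nat \<Rightarrow> point \<Rightarrow> point" where
  "ypart d1 z = (\<lambda>j. z (d1 + j))"

datatype sign = Plus | Minus

fun half_line :: "sign \<Rightarrow> int set" where
  "half_line Plus = {1..}"
| "half_line Minus = {..0}"

definition sign_seqs :: "nat \<Rightarrow> sign list set" where
  "sign_seqs m = {\<omega>. length \<omega> = m}"

definition octant :: "sign list \<Rightarrow> point set" where
  "octant \<omega> = {y \<in> lattice (length \<omega>). \<forall>j<length \<omega>. y j \<in> half_line (\<omega> ! j)}"

definition periodic :: "nat \<Rightarrow> (point \<Rightarrow> real) \<Rightarrow> bool" where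
  "periodic d F \<longleftrightarrow> (\<exists>p::nat \<Rightarrow> nat. \<forall>i<d. p i > 0 \<and>
     (\<forall>z\<in>lattice d. F (z(i := z i + int (p i))) = F z))"

definition octant_decomposition ::
  "nat \<Rightarrow> nat \<Rightarrow> (point \<Rightarrow> real) \<Rightarrow> (sign list \<Rightarrow> point \<Rightarrow> real) \<Rightarrow> bool" where
  "octant_decomposition d1 d2 F G \<longleftrightarrow>
     (\<forall>\<omega>\<in>sign_seqs d2. periodic (d1 + d2) (G \<omega>)) \<and>
     (\<forall>z\<in>domain d1 d2. F z = (\<Sum>\<omega>\<in>sign_seqs d2. G \<omega> z * indicator (octant \<omega>) (ypart d1 z)))"

definition octant_periodic :: "nat \<Rightarrow> nat \<Rightarrow> (point \<Rightarrow> real) \<Rightarrow> bool" where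
  "octant_periodic d1 d2 F \<longleftrightarrow> (\<exists>G. octant_decomposition d1 d2 F G)"

text \<open>
  The operator on \<open>\<ell>\<^sup>2(S)\<close> for \<open>S \<subseteq> \<int>\<^sup>d\<close>. Coefficients \<open>a i\<close> at points outside \<open>S\<close> are only ever
  multiplied by values of \<open>f\<close> outside \<open>S\<close>, that is, by \<open>0\<close>.
\<close>

definition jacobi_op ::
  "nat \<Rightarrow> point set \<Rightarrow> (nat \<Rightarrow> point \<Rightarrow> real) \<Rightarrow> (point \<Rightarrow> real) \<Rightarrow> point operator" where
  "jacobi_op d S a V f = (\<lambda>z. if z \<in> S then
     (\<Sum>i<d. of_real (a i (z(i := z i - 1))) * f (z(i := z i - 1))
            + of_real (a i z) * f (z(i := z i + 1)))
     + of_real (V z) * f z else 0)"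

end

theory Submission
  imports Defs "HOL-Computational_Algebra.Fundamental_Theorem_Algebra"
begin

text \<open>
  \<^bold>\<open>Octant operators.\<close> Let \<open>l\<close> be in the spectrum of \<open>H\<^sub>\<omega>\<close>. Bounded symmetric operators that are bounded
  below after subtracting \<open>l\<close> are invertible (\<open>bounded_below_imp_resolvent\<close>), so \<open>H\<^sub>\<omega>\<close> has approximate
  eigenvectors for \<open>l\<close>, which may be taken with finite support. Moved far into the octant of \<open>\<omega>\<close> by a
  multiple of the period, they see \<open>H\<close> exactly as they saw \<open>H\<^sub>\<omega>\<close> (\<open>translate_into_octant\<close>). Repeating this
  beyond the previous supports gives an orthonormal Weyl sequence of \<open>H\<close>, and such a sequence is
  incompatible with a range of finite codimension (\<open>weyl_sequence_imp_ess_spectrum\<close>).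

  \<^bold>\<open>The model with a prescribed gap.\<close> The operator is a sum of operators \<open>t\<^sub>i A\<^sub>i\<close>, where \<open>A\<^sub>i\<close> acts on the \<open>i\<close>-th
  coordinate only. It decouples the coordinate axis into finite chains: the sites \<open>1, \<dots>, n\<close> form one
  short chain, and all others are long chains with one more site, which carries a potential \<open>c\<^sub>i\<close> at the
  additional end. For \<open>i = 0, 1\<close> the short chain has \<open>N\<close> sites, the potentials differ, and \<open>t\<^sub>0 = 1\<close>,
  \<open>t\<^sub>1 = -1\<close>; for \<open>i \<ge> 2\<close> the short chain is one site and the long ones are dimers with eigenvalues \<open>\<plusminus>1\<close>.

  Let \<open>X\<close> be the matrix of the short chain. On products of short chains \<open>A\<^sub>0 - A\<^sub>1\<close> is the commutator
  with \<open>X\<close>, whose kernel has dimension \<open>N\<close> because the eigenvalues of a path are simple. Two chains that are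
  not both short have no common eigenvalue: an eigenvector is determined by its value at the common
  end, and the conditions at the other end differ. So \<open>A\<^sub>0 - A\<^sub>1\<close> has its kernel in the
  corner. In terms of Chebyshev polynomials \<open>U\<^sub>j\<close>, which transport values along a chain, the
  characteristic equations are \<open>U\<^sub>n = 0\<close> on short and \<open>U\<^sub>n\<^sub>+\<^sub>1 = c U\<^sub>n\<close> on long chains
  (\<open>chebU_axis_op_short\<close>, \<open>chebU_axis_op_long\<close>); this form avoids all explicit eigenvectors. Large
  coefficients \<open>t\<^sub>i\<close> for \<open>i \<ge> 2\<close> confine the kernel to the short chains in the other directions too
  (\<open>kernel_of_dominant_sum\<close>). So the kernel of the sum has dimension \<open>N\<close> (\<open>corner_space_dim\<close>).

  The \<open>A\<^sub>i\<close> satisfy polynomial equations, commute and are symmetric. Therefore their sum is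
  diagonalizable with finitely many eigenvalues (\<open>annihilated_imp_eigen_decomposable\<close>,
  \<open>eigen_decomposable_commuting_sum\<close>). So \<open>0\<close> is isolated in the spectrum, the spectral measure is a finite
  sum of projections, and an affine map moves \<open>0\<close> to the centre of \<open>I\<close> and everything else out of \<open>I\<close>.
  The potential is positive on infinitely many pairwise nonadjacent sites and negative on
  infinitely many others, which yields infinitely many dimensions on both sides of \<open>I\<close>.
  For \<open>N = 0\<close> a multiplication operator does.
\<close>

section \<open>Square summable functions\<close>

lemma fun_sum_apply: "(\<Sum>i\<in>A. f i) z = (\<Sum>i\<in>A. f i z)"
  for f :: "'b \<Rightarrow> 'a \<Rightarrow> complex"
  by (induction A rule: infinite_finite_induct) auto

text \<open>
  Membership in \<open>\<ell>\<^sup>2\<close> and norm bounds are reduced to finite sums, where the classical inequalities of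
  Minkowski and Cauchy-Schwarz apply.
\<close>

lemma ell2_bounded_finite_sums:
  assumes off: "\<And>z. z \<notin> S \<Longrightarrow> f z = 0"
    and le: "\<And>F. finite F \<Longrightarrow> F \<subseteq> S \<Longrightarrow> L2_set (\<lambda>z. cmod (f z)) F \<le> B"
  shows "f \<in> ell2 S" "ell2_norm S f \<le> B"
proof -
  have B0: "0 \<le> B"
    using le[of "{}"] by simp
  have sq: "(\<Sum>z\<in>F. (cmod (f z))\<^sup>2) \<le> B\<^sup>2" if "finite F" "F \<subseteq> S" for F
    using le[OF that] B0 unfolding L2_set_def
    by (meson real_sqrt_le_iff real_le_rsqrt order_trans sqrt_le_D)
  have summ: "(\<lambda>z. (cmod (f z))\<^sup>2) summable_on S"
    by (rule nonneg_bdd_above_summable_on) (auto intro!: bdd_aboveI2[where M = "B\<^sup>2"] sq)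
  then show "f \<in> ell2 S"
    using off by (auto simp: ell2_def)
  have "infsum (\<lambda>z. (cmod (f z))\<^sup>2) S \<le> B\<^sup>2"
    by (rule infsum_le_finite_sums[OF summ sq])
  then show "ell2_norm S f \<le> B"
    unfolding ell2_norm_def using B0 by (simp add: real_le_lsqrt infsum_nonneg)
qed

lemma ell2_off: "f \<in> ell2 S \<Longrightarrow> z \<notin> S \<Longrightarrow> f z = 0"
  by (simp add: ell2_def)

lemma L2_set_le_ell2_norm:
  assumes "f \<in> ell2 S"
  shows "L2_set (\<lambda>z. cmod (f z)) F \<le> ell2_norm S f"
proof (cases "finite F")
  case True
  have "(\<Sum>z\<in>F. (cmod (f z))\<^sup>2) = (\<Sum>z\<in>F \<inter> S. (cmod (f z))\<^sup>2)"
    using True assms by (intro sum.mono_neutral_right) (auto simp: ell2_def)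
  also have "\<dots> \<le> infsum (\<lambda>z. (cmod (f z))\<^sup>2) S"
    using assms True by (intro finite_sum_le_infsum) (auto simp: ell2_def)
  finally show ?thesis
    by (simp add: L2_set_def ell2_norm_def)
qed (simp add: ell2_norm_def infsum_nonneg)

lemma ell2_norm_nonneg [simp]: "0 \<le> ell2_norm S f"
  by (simp add: ell2_norm_def infsum_nonneg)

lemma ell2_norm_power2: "(ell2_norm S f)\<^sup>2 = infsum (\<lambda>z. (cmod (f z))\<^sup>2) S"
  by (simp add: ell2_norm_def infsum_nonneg)

lemma cmod_le_ell2_norm: "f \<in> ell2 S \<Longrightarrow> cmod (f z) \<le> ell2_norm S f"
  using L2_set_le_ell2_norm[of f S "{z}"] by simp

lemma ell2_norm_eq_0D: "f \<in> ell2 S \<Longrightarrow> ell2_norm S f = 0 \<Longrightarrow> f = 0"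
  using cmod_le_ell2_norm[of f S] by (auto simp: fun_eq_iff)

lemma ell2_norm_zero [simp]: "ell2_norm S (\<lambda>z. 0) = 0" "ell2_norm S 0 = 0"
  by (simp_all add: ell2_norm_def)

lemma ell2_zero [simp]: "(\<lambda>z. 0) \<in> ell2 S" "0 \<in> ell2 S"
  by (auto simp: ell2_def)

lemma ell2_plus:
  assumes "f \<in> ell2 S" "g \<in> ell2 S"
  shows "(\<lambda>z. f z + g z) \<in> ell2 S"
    "ell2_norm S (\<lambda>z. f z + g z) \<le> ell2_norm S f + ell2_norm S g"
proof -
  have le: "L2_set (\<lambda>z. cmod (f z + g z)) F \<le> ell2_norm S f + ell2_norm S g" for F
  proof -
    have "L2_set (\<lambda>z. cmod (f z + g z)) F \<le> L2_set (\<lambda>z. cmod (f z) + cmod (g z)) F"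
      by (intro L2_set_mono norm_triangle_ineq) auto
    also have "\<dots> \<le> L2_set (\<lambda>z. cmod (f z)) F + L2_set (\<lambda>z. cmod (g z)) F"
      by (rule L2_set_triangle_ineq)
    finally show ?thesis
      using L2_set_le_ell2_norm[OF assms(1), of F] L2_set_le_ell2_norm[OF assms(2), of F] by linarith
  qed
  show "(\<lambda>z. f z + g z) \<in> ell2 S"
    by (rule ell2_bounded_finite_sums(1)[OF _ le]) (use assms in \<open>auto simp: ell2_def\<close>)
  show "ell2_norm S (\<lambda>z. f z + g z) \<le> ell2_norm S f + ell2_norm S g"
    by (rule ell2_bounded_finite_sums(2)[OF _ le]) (use assms in \<open>auto simp: ell2_def\<close>)
qed

lemma ell2_scale:
  assumes "f \<in> ell2 S"
  shows "(\<lambda>z. c * f z) \<in> ell2 S"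
  using assms by (auto simp: ell2_def norm_mult power_mult_distrib intro: summable_on_cmult_right)

lemma ell2_norm_scale: "ell2_norm S (\<lambda>z. c * f z) = cmod c * ell2_norm S f"
  by (simp add: ell2_norm_def norm_mult power_mult_distrib infsum_cmult_right' real_sqrt_mult)

lemma ell2_norm_uminus: "ell2_norm S (\<lambda>z. - f z) = ell2_norm S f"
  by (simp add: ell2_norm_def)

lemma ell2_lincomb: "f \<in> ell2 S \<Longrightarrow> g \<in> ell2 S \<Longrightarrow> (\<lambda>z. c * f z + g z) \<in> ell2 S"
  by (intro ell2_plus ell2_scale)

lemma ell2_minus:
  assumes "f \<in> ell2 S" "g \<in> ell2 S"
  shows "(\<lambda>z. f z - g z) \<in> ell2 S"
    "ell2_norm S (\<lambda>z. f z - g z) \<le> ell2_norm S f + ell2_norm S g"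
  using ell2_plus[OF assms(1) ell2_scale[OF assms(2), of "-1"]]
  by (simp_all add: ell2_norm_uminus)

lemma ell2_sum:
  "(\<And>i. i \<in> A \<Longrightarrow> f i \<in> ell2 S) \<Longrightarrow> (\<lambda>z. \<Sum>i\<in>A. f i z) \<in> ell2 S"
  by (induction A rule: infinite_finite_induct) (auto intro: ell2_plus)

lemma ell2_norm_sum_le:
  "(\<And>i. i \<in> A \<Longrightarrow> f i \<in> ell2 S) \<Longrightarrow>
   ell2_norm S (\<lambda>z. \<Sum>i\<in>A. f i z) \<le> (\<Sum>i\<in>A. ell2_norm S (f i))"
proof (induction A rule: infinite_finite_induct)
  case (insert x A)
  have "ell2_norm S (\<lambda>z. f x z + (\<Sum>i\<in>A. f i z))
      \<le> ell2_norm S (f x) + ell2_norm S (\<lambda>z. \<Sum>i\<in>A. f i z)"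
    using insert.prems by (intro ell2_plus ell2_sum) auto
  with insert show ?case
    by force
qed auto

lemma ell2_dominated:
  assumes "g \<in> ell2 S" "\<And>z. cmod (f z) \<le> cmod (g z)"
  shows "f \<in> ell2 S" "ell2_norm S f \<le> ell2_norm S g"
proof -
  have off: "f z = 0" if "z \<notin> S" for z
    using assms(2)[of z] ell2_off[OF assms(1) that] by simp
  have le: "L2_set (\<lambda>z. cmod (f z)) F \<le> ell2_norm S g" for F
    using L2_set_mono[of F "\<lambda>z. cmod (f z)" "\<lambda>z. cmod (g z)"] assms(2)
      L2_set_le_ell2_norm[OF assms(1), of F] by force
  show "f \<in> ell2 S" "ell2_norm S f \<le> ell2_norm S g"
    by (rule ell2_bounded_finite_sums[OF off le]; assumption)+
qed

lemma ell2_finite_support: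
  assumes "finite F" "F \<subseteq> S" "\<And>z. z \<notin> F \<Longrightarrow> f z = 0"
  shows "f \<in> ell2 S" "(ell2_norm S f)\<^sup>2 = (\<Sum>z\<in>F. (cmod (f z))\<^sup>2)"
proof -
  have "(\<lambda>z. (cmod (f z))\<^sup>2) summable_on S \<longleftrightarrow> (\<lambda>z. (cmod (f z))\<^sup>2) summable_on F"
    by (rule summable_on_cong_neutral) (use assms in auto)
  then show "f \<in> ell2 S"
    using assms by (auto simp: ell2_def summable_on_finite)
  have "infsum (\<lambda>z. (cmod (f z))\<^sup>2) S = infsum (\<lambda>z. (cmod (f z))\<^sup>2) F"
    by (rule infsum_cong_neutral) (use assms in auto)
  then show "(ell2_norm S f)\<^sup>2 = (\<Sum>z\<in>F. (cmod (f z))\<^sup>2)"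
    using assms(1) by (simp add: ell2_norm_power2)
qed

lemma ell2_inner_summable:
  assumes "f \<in> ell2 S" "g \<in> ell2 S"
  shows "(\<lambda>z. norm (cnj (f z) * g z)) summable_on S"
    "infsum (\<lambda>z. norm (cnj (f z) * g z)) S \<le> ell2_norm S f * ell2_norm S g"
proof -
  have le: "(\<Sum>z\<in>F. norm (cnj (f z) * g z)) \<le> ell2_norm S f * ell2_norm S g" for F
  proof -
    have "(\<Sum>z\<in>F. norm (cnj (f z) * g z)) \<le> L2_set (\<lambda>z. cmod (f z)) F * L2_set (\<lambda>z. cmod (g z)) F"
      using L2_set_mult_ineq[of "\<lambda>z. cmod (f z)" "\<lambda>z. cmod (g z)" F] by (simp add: norm_mult)
    also have "\<dots> \<le> ell2_norm S f * ell2_norm S g"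
      by (intro mult_mono L2_set_le_ell2_norm assms) auto
    finally show ?thesis .
  qed
  show summ: "(\<lambda>z. norm (cnj (f z) * g z)) summable_on S"
    by (rule nonneg_bdd_above_summable_on, rule norm_ge_zero)
      (rule bdd_aboveI2[where M = "ell2_norm S f * ell2_norm S g"], rule le)
  show "infsum (\<lambda>z. norm (cnj (f z) * g z)) S \<le> ell2_norm S f * ell2_norm S g"
    by (rule infsum_le_finite_sums[OF summ le])
qed

lemma ell2_Cauchy_Schwarz:
  assumes "f \<in> ell2 S" "g \<in> ell2 S"
  shows "cmod (ell2_inner S f g) \<le> ell2_norm S f * ell2_norm S g"
  unfolding ell2_inner_def
  using norm_infsum_bound[OF ell2_inner_summable(1)[OF assms]] ell2_inner_summable(2)[OF assms]
  by linarith

lemma ell2_inner_lincomb_right: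
  assumes "f \<in> ell2 S" "g \<in> ell2 S" "h \<in> ell2 S"
  shows "ell2_inner S f (\<lambda>z. c * g z + h z) = c * ell2_inner S f g + ell2_inner S f h"
proof -
  have "ell2_inner S f (\<lambda>z. c * g z + h z) = (\<Sum>\<^sub>\<infinity>z\<in>S. c * (cnj (f z) * g z) + cnj (f z) * h z)"
    unfolding ell2_inner_def by (simp add: algebra_simps)
  also have "\<dots> = (\<Sum>\<^sub>\<infinity>z\<in>S. c * (cnj (f z) * g z)) + (\<Sum>\<^sub>\<infinity>z\<in>S. cnj (f z) * h z)"
    by (intro infsum_add summable_on_cmult_right
          abs_summable_summable[OF ell2_inner_summable(1)] assms)
  finally show ?thesis
    by (simp add: ell2_inner_def infsum_cmult_right')
qed

lemma ell2_inner_commute: "ell2_inner S f g = cnj (ell2_inner S g f)"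
  unfolding ell2_inner_def infsum_cnj[symmetric] by (simp add: mult.commute del: infsum_cnj)

lemma ell2_inner_lincomb_left:
  assumes "f \<in> ell2 S" "g \<in> ell2 S" "h \<in> ell2 S"
  shows "ell2_inner S (\<lambda>z. c * g z + h z) f = cnj c * ell2_inner S g f + ell2_inner S h f"
proof -
  have "ell2_inner S (\<lambda>z. c * g z + h z) f = cnj (ell2_inner S f (\<lambda>z. c * g z + h z))"
    by (rule ell2_inner_commute)
  also have "\<dots> = cnj c * cnj (ell2_inner S f g) + cnj (ell2_inner S f h)"
    by (simp add: ell2_inner_lincomb_right[OF assms])
  finally show ?thesis
    by (simp only: ell2_inner_commute[symmetric])
qed

lemma ell2_inner_zero [simp]:
  "ell2_inner S f (\<lambda>z. 0) = 0" "ell2_inner S (\<lambda>z. 0) f = 0" "ell2_inner S f 0 = 0" "ell2_inner S 0 f = 0"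
  by (simp_all add: ell2_inner_def)

lemma ell2_inner_scale_right: "ell2_inner S f (\<lambda>z. c * g z) = c * ell2_inner S f g"
  by (simp add: ell2_inner_def mult.left_commute infsum_cmult_right')

lemma ell2_inner_scale_left: "ell2_inner S (\<lambda>z. c * f z) g = cnj c * ell2_inner S f g"
  by (simp add: ell2_inner_def mult.assoc infsum_cmult_right')

lemma ell2_inner_plus_right:
  "f \<in> ell2 S \<Longrightarrow> g \<in> ell2 S \<Longrightarrow> h \<in> ell2 S \<Longrightarrow>
   ell2_inner S f (\<lambda>z. g z + h z) = ell2_inner S f g + ell2_inner S f h"
  using ell2_inner_lincomb_right[of f S g h 1] by simp

lemma ell2_inner_plus_left:
  "f \<in> ell2 S \<Longrightarrow> g \<in> ell2 S \<Longrightarrow> h \<in> ell2 S \<Longrightarrow>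
   ell2_inner S (\<lambda>z. g z + h z) f = ell2_inner S g f + ell2_inner S h f"
  using ell2_inner_lincomb_left[of f S g h 1] by simp

lemma ell2_inner_minus_right:
  "f \<in> ell2 S \<Longrightarrow> g \<in> ell2 S \<Longrightarrow> h \<in> ell2 S \<Longrightarrow>
   ell2_inner S f (\<lambda>z. g z - h z) = ell2_inner S f g - ell2_inner S f h"
  using ell2_inner_lincomb_right[of f S h g "-1"] by simp

lemma ell2_inner_sum_right:
  "f \<in> ell2 S \<Longrightarrow> (\<And>i. i \<in> A \<Longrightarrow> g i \<in> ell2 S) \<Longrightarrow>
   ell2_inner S f (\<lambda>z. \<Sum>i\<in>A. g i z) = (\<Sum>i\<in>A. ell2_inner S f (g i))"
  by (induction A rule: infinite_finite_induct)
    (auto simp: ell2_inner_plus_right ell2_sum)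

lemma ell2_inner_sum_left:
  "f \<in> ell2 S \<Longrightarrow> (\<And>i. i \<in> A \<Longrightarrow> g i \<in> ell2 S) \<Longrightarrow>
   ell2_inner S (\<lambda>z. \<Sum>i\<in>A. g i z) f = (\<Sum>i\<in>A. ell2_inner S (g i) f)"
  by (induction A rule: infinite_finite_induct)
    (auto simp: ell2_inner_plus_left ell2_sum)

lemma ell2_inner_self:
  assumes "f \<in> ell2 S"
  shows "ell2_inner S f f = of_real ((ell2_norm S f)\<^sup>2)"
proof -
  have "ell2_inner S f f = (\<Sum>\<^sub>\<infinity>z\<in>S. of_real ((cmod (f z))\<^sup>2))"
    unfolding ell2_inner_def by (simp only: complex_norm_square mult.commute)
  also have "\<dots> = of_real (\<Sum>\<^sub>\<infinity>z\<in>S. (cmod (f z))\<^sup>2)"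
    using assms
    by (intro infsumI has_sum_of_real_iff[THEN iffD2] has_sum_infsum) (simp add: ell2_def)
  finally show ?thesis
    by (simp add: ell2_norm_power2)
qed

lemma ell2_inner_finite_support:
  assumes "finite F" "F \<subseteq> S" "\<And>z. z \<notin> F \<Longrightarrow> f z = 0"
  shows "ell2_inner S f g = (\<Sum>z\<in>F. cnj (f z) * g z)"
proof -
  have "infsum (\<lambda>z. cnj (f z) * g z) S = infsum (\<lambda>z. cnj (f z) * g z) F"
    by (rule infsum_cong_neutral) (use assms in auto)
  then show ?thesis
    using assms(1) by (simp add: ell2_inner_def)
qed

lemma ell2_complete:
  assumes mem: "\<And>n. f n \<in> ell2 S"
    and cauchy: "\<And>e. e > 0 \<Longrightarrow> \<exists>N. \<forall>m\<ge>N. \<forall>n\<ge>N. ell2_norm S (\<lambda>z. f m z - f n z) \<le> e"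
  shows "\<exists>g\<in>ell2 S. (\<lambda>n. ell2_norm S (\<lambda>z. f n z - g z)) \<longlonglongrightarrow> 0"
proof -
  have diff: "(\<lambda>z. f m z - f n z) \<in> ell2 S" for m n
    by (intro ell2_minus mem)
  have "Cauchy (\<lambda>n. f n z)" for z
  proof (rule metric_CauchyI)
    fix e :: real assume "e > 0"
    then obtain N where N: "ell2_norm S (\<lambda>z. f m z - f n z) \<le> e / 2" if "m \<ge> N" "n \<ge> N" for m n
      using cauchy[of "e / 2"] by auto
    have "dist (f m z) (f n z) < e" if "m \<ge> N" "n \<ge> N" for m n
      using cmod_le_ell2_norm[OF diff[of m n], of z] N[OF that] \<open>e > 0\<close>
      by (simp add: dist_norm)
    then show "\<exists>N. \<forall>m\<ge>N. \<forall>n\<ge>N. dist (f m z) (f n z) < e"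
      by blast
  qed
  then have "\<exists>l. (\<lambda>n. f n z) \<longlonglongrightarrow> l" for z
    using Cauchy_convergent convergent_def by blast
  then obtain g where g: "(\<lambda>n. f n z) \<longlonglongrightarrow> g z" for z
    by metis
  have g0: "g z = 0" if "z \<notin> S" for z
    using g[of z] ell2_off[OF mem that] by (simp add: LIMSEQ_const_iff)
  have close: "(\<lambda>z. f n z - g z) \<in> ell2 S \<and> ell2_norm S (\<lambda>z. f n z - g z) \<le> e"
    if N: "\<forall>m\<ge>N. \<forall>n\<ge>N. ell2_norm S (\<lambda>z. f m z - f n z) \<le> e" and n: "n \<ge> N" for n N e
  proof -
    have le: "L2_set (\<lambda>z. cmod (f n z - g z)) F \<le> e" for F
    proof (rule LIMSEQ_le_const2)
      show "(\<lambda>m. L2_set (\<lambda>z. cmod (f n z - f m z)) F) \<longlonglongrightarrow> L2_set (\<lambda>z. cmod (f n z - g z)) F"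
        unfolding L2_set_def by (intro tendsto_intros g)
      have "L2_set (\<lambda>z. cmod (f n z - f m z)) F \<le> e" if "m \<ge> N" for m
        using L2_set_le_ell2_norm[OF diff[of n m], of F] N n that by fastforce
      then show "\<exists>N. \<forall>m\<ge>N. L2_set (\<lambda>z. cmod (f n z - f m z)) F \<le> e"
        by blast
    qed
    show ?thesis
      using ell2_bounded_finite_sums[of S "\<lambda>z. f n z - g z" e, OF _ le] g0 ell2_off[OF mem]
      by simp
  qed
  obtain N where "\<forall>m\<ge>N. \<forall>n\<ge>N. ell2_norm S (\<lambda>z. f m z - f n z) \<le> 1"
    using cauchy[of 1] by auto
  then have "(\<lambda>z. f N z - g z) \<in> ell2 S"
    using close by blast
  from ell2_minus(1)[OF mem[of N] this] have "g \<in> ell2 S"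
    by simp
  moreover have "(\<lambda>n. ell2_norm S (\<lambda>z. f n z - g z)) \<longlonglongrightarrow> 0"
  proof (rule metric_LIMSEQ_I)
    fix r :: real assume "r > 0"
    then obtain N where "\<forall>m\<ge>N. \<forall>n\<ge>N. ell2_norm S (\<lambda>z. f m z - f n z) \<le> r / 2"
      using cauchy[of "r / 2"] by auto
    then have "ell2_norm S (\<lambda>z. f n z - g z) \<le> r / 2" if "n \<ge> N" for n
      using close that by blast
    then show "\<exists>no. \<forall>n\<ge>no. dist (ell2_norm S (\<lambda>z. f n z - g z)) 0 < r"
      using \<open>r > 0\<close> by (intro exI[of _ N]) fastforce
  qed
  ultimately show ?thesis
    by blast
qed

text \<open>
  Banach's fixed point theorem in \<open>\<ell>\<^sup>2(S)\<close>, by iteration and completeness; it will solve operator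
  equations.
\<close>

lemma ell2_contraction_fixpoint:
  assumes maps: "\<And>x. x \<in> ell2 S \<Longrightarrow> \<Phi> x \<in> ell2 S"
    and contr: "\<And>x y. x \<in> ell2 S \<Longrightarrow> y \<in> ell2 S \<Longrightarrow>
      ell2_norm S (\<lambda>z. \<Phi> x z - \<Phi> y z) \<le> q * ell2_norm S (\<lambda>z. x z - y z)"
    and q: "0 \<le> q" "q < 1"
  shows "\<exists>x\<in>ell2 S. \<Phi> x = x"
proof -
  define x where "x n = (\<Phi> ^^ n) 0" for n
  have xS: "x n \<in> ell2 S" for n
    by (induction n) (auto simp: x_def maps)
  have x_Suc: "x (Suc n) = \<Phi> (x n)" for n
    by (simp add: x_def)
  define D where "D = ell2_norm S (\<lambda>z. x 1 z - x 0 z) / (1 - q)"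
  have D: "ell2_norm S (\<lambda>z. x k z - x 0 z) \<le> D" for k
  proof (induction k)
    case 0
    then show ?case
      using q by (simp add: D_def)
  next
    case (Suc k)
    have "ell2_norm S (\<lambda>z. (x (Suc k) z - x 1 z) + (x 1 z - x 0 z))
        \<le> ell2_norm S (\<lambda>z. x (Suc k) z - x 1 z) + ell2_norm S (\<lambda>z. x 1 z - x 0 z)"
      by (intro ell2_plus ell2_minus xS)
    moreover have "ell2_norm S (\<lambda>z. x (Suc k) z - x 1 z) \<le> q * D"
      using contr[OF xS xS, of k 0] mult_left_mono[OF Suc q(1)] by (simp add: x_Suc)
    moreover have "ell2_norm S (\<lambda>z. x 1 z - x 0 z) = (1 - q) * D"
      using q by (simp add: D_def)
    ultimately show ?case
      by (simp add: algebra_simps)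
  qed
  have step: "ell2_norm S (\<lambda>z. x (n + k) z - x n z) \<le> q ^ n * D" for n k
  proof (induction n)
    case (Suc n)
    then show ?case
      using contr[OF xS xS, of "n + k" n] mult_left_mono[OF Suc q(1)]
      by (simp add: x_Suc mult.assoc)
  qed (simp add: D)
  have D0: "0 \<le> D"
    using D[of 0] by (meson ell2_norm_nonneg order_trans)
  have "\<exists>N. \<forall>m\<ge>N. \<forall>n\<ge>N. ell2_norm S (\<lambda>z. x m z - x n z) \<le> e" if "e > 0" for e
  proof -
    have "(\<lambda>n. q ^ n * D) \<longlonglongrightarrow> 0"
      using q by (auto intro!: tendsto_mult_left_zero LIMSEQ_power_zero)
    from order_tendstoD(2)[OF this, of "e / 2"] that obtain N where N: "q ^ N * D < e / 2"
      by (auto simp: eventually_sequentially)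
    have "ell2_norm S (\<lambda>z. x m z - x n z) \<le> e" if "m \<ge> N" "n \<ge> N" for m n
    proof -
      have near: "ell2_norm S (\<lambda>z. x m z - x N z) \<le> e / 2" if "m \<ge> N" for m
        using step[of N "m - N"] N that by simp
      have "ell2_norm S (\<lambda>z. (x m z - x N z) - (x n z - x N z))
          \<le> ell2_norm S (\<lambda>z. x m z - x N z) + ell2_norm S (\<lambda>z. x n z - x N z)"
        by (intro ell2_minus xS)
      then show ?thesis
        using near[OF that(1)] near[OF that(2)] by simp
    qed
    then show ?thesis
      by blast
  qed
  then obtain y where y: "y \<in> ell2 S" and lim: "(\<lambda>n. ell2_norm S (\<lambda>z. x n z - y z)) \<longlonglongrightarrow> 0"
    using ell2_complete[of x S] xS by blast
  have "ell2_norm S (\<lambda>z. \<Phi> y z - y z) \<le> 0"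
  proof (rule LIMSEQ_le_const)
    show "(\<lambda>n. q * ell2_norm S (\<lambda>z. x n z - y z) + ell2_norm S (\<lambda>z. x (Suc n) z - y z)) \<longlonglongrightarrow> 0"
      using tendsto_add[OF tendsto_mult_right_zero[OF lim, of q] LIMSEQ_Suc[OF lim]] by simp
    have "ell2_norm S (\<lambda>z. \<Phi> y z - y z)
        \<le> q * ell2_norm S (\<lambda>z. x n z - y z) + ell2_norm S (\<lambda>z. x (Suc n) z - y z)" for n
    proof -
      have "ell2_norm S (\<lambda>z. (x (Suc n) z - y z) - (\<Phi> (x n) z - \<Phi> y z))
          \<le> ell2_norm S (\<lambda>z. x (Suc n) z - y z) + ell2_norm S (\<lambda>z. \<Phi> (x n) z - \<Phi> y z)"
        by (intro ell2_minus xS maps y)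
      then show ?thesis
        using contr[OF xS y, of n] by (simp add: x_Suc)
    qed
    then show "\<exists>N. \<forall>n\<ge>N. ell2_norm S (\<lambda>z. \<Phi> y z - y z)
        \<le> q * ell2_norm S (\<lambda>z. x n z - y z) + ell2_norm S (\<lambda>z. x (Suc n) z - y z)"
      by blast
  qed
  then have "(\<lambda>z. \<Phi> y z - y z) = 0"
    using ell2_norm_eq_0D[OF ell2_minus(1)[OF maps[OF y] y]]
    by (meson ell2_norm_nonneg order_antisym)
  then have "\<Phi> y = y"
    by (auto simp: fun_eq_iff)
  then show ?thesis
    using y by blast
qed

lemma ell2_truncation:
  assumes "f \<in> ell2 S" "e > 0"
  shows "\<exists>F. finite F \<and> F \<subseteq> S \<and> ell2_norm S (\<lambda>z. if z \<in> F then 0 else f z) \<le> e"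
proof -
  have summ: "(\<lambda>z. (cmod (f z))\<^sup>2) summable_on S"
    using assms(1) by (simp add: ell2_def)
  obtain F where F: "finite F" "F \<subseteq> S"
    and close: "dist (\<Sum>z\<in>F. (cmod (f z))\<^sup>2) (infsum (\<lambda>z. (cmod (f z))\<^sup>2) S) \<le> e\<^sup>2"
    using infsum_finite_approximation[OF summ, of "e\<^sup>2"] assms(2) by auto
  have "(ell2_norm S (\<lambda>z. if z \<in> F then 0 else f z))\<^sup>2 = infsum (\<lambda>z. (cmod (f z))\<^sup>2) (S - F)"
    unfolding ell2_norm_power2 by (rule infsum_cong_neutral) auto
  also have "\<dots> = infsum (\<lambda>z. (cmod (f z))\<^sup>2) S - (\<Sum>z\<in>F. (cmod (f z))\<^sup>2)"
    using infsum_Diff[OF summ _ F(2)] F(1) by simp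
  also have "\<dots> \<le> e\<^sup>2"
    using close by (simp add: dist_real_def)
  finally have "ell2_norm S (\<lambda>z. if z \<in> F then 0 else f z) \<le> e"
    by (rule power2_le_imp_le) (use assms(2) in simp)
  then show ?thesis
    using F by blast
qed

text \<open>
  Weak form of the norm convergence of a geometrically dominated series.
\<close>

lemma ell2_series:
  assumes h: "\<And>n. h n \<in> ell2 S" and le: "\<And>n. ell2_norm S (h n) \<le> (1 / 2) ^ n"
  shows "\<exists>G\<in>ell2 S. \<forall>f\<in>ell2 S. (\<lambda>N. \<Sum>n<N. ell2_inner S f (h n)) \<longlonglongrightarrow> ell2_inner S f G"
proof -
  define p where "p N = (\<lambda>z. \<Sum>n<N. h n z)" for N
  have p: "p N \<in> ell2 S" for N
    unfolding p_def by (intro ell2_sum h)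
  have near: "ell2_norm S (\<lambda>z. p (N + k) z - p N z) \<le> 2 * (1 / 2) ^ N - 2 * (1 / 2) ^ (N + k)" for N k
  proof (induction k)
    case (Suc k)
    have "ell2_norm S (\<lambda>z. (p (N + k) z - p N z) + h (N + k) z)
        \<le> ell2_norm S (\<lambda>z. p (N + k) z - p N z) + ell2_norm S (h (N + k))"
      by (intro ell2_plus ell2_minus p h)
    then show ?case
      using Suc le[of "N + k"] by (simp add: p_def algebra_simps)
  qed simp
  have near': "ell2_norm S (\<lambda>z. p m z - p N z) \<le> 2 * (1 / 2) ^ N" if "m \<ge> N" for m N
  proof -
    have "ell2_norm S (\<lambda>z. p m z - p N z) \<le> 2 * (1 / 2) ^ N - 2 * (1 / 2) ^ m"
      using near[of N "m - N"] that by simp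
    also have "\<dots> \<le> 2 * (1 / 2) ^ N"
      by simp
    finally show ?thesis .
  qed
  have "\<exists>N. \<forall>m\<ge>N. \<forall>n\<ge>N. ell2_norm S (\<lambda>z. p m z - p n z) \<le> e" if "e > 0" for e
  proof -
    have "\<exists>N. (1 / 2 :: real) ^ N < e / 4"
      using that by (intro real_arch_pow_inv) auto
    then obtain N where N: "(1 / 2 :: real) ^ N < e / 4"
      by blast
    have "ell2_norm S (\<lambda>z. p m z - p n z) \<le> e" if "m \<ge> N" "n \<ge> N" for m n
    proof -
      have "ell2_norm S (\<lambda>z. (p m z - p N z) - (p n z - p N z))
          \<le> ell2_norm S (\<lambda>z. p m z - p N z) + ell2_norm S (\<lambda>z. p n z - p N z)"
        by (intro ell2_minus p)
      then show ?thesis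
        using near'[OF that(1)] near'[OF that(2)] N by simp
    qed
    then show ?thesis
      by blast
  qed
  then obtain G where G: "G \<in> ell2 S" and lim: "(\<lambda>n. ell2_norm S (\<lambda>z. p n z - G z)) \<longlonglongrightarrow> 0"
    using ell2_complete[of p S] p by blast
  have "(\<lambda>N. \<Sum>n<N. ell2_inner S f (h n)) \<longlonglongrightarrow> ell2_inner S f G" if f: "f \<in> ell2 S" for f
  proof (rule LIM_zero_cancel, rule Lim_null_comparison)
    have "norm ((\<Sum>n<N. ell2_inner S f (h n)) - ell2_inner S f G)
        \<le> ell2_norm S f * ell2_norm S (\<lambda>z. p N z - G z)" for N
    proof -
      have "(\<Sum>n<N. ell2_inner S f (h n)) - ell2_inner S f G = ell2_inner S f (\<lambda>z. p N z - G z)"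
        using f p[of N] G h by (simp add: ell2_inner_minus_right) (simp add: p_def ell2_inner_sum_right)
      then show ?thesis
        using ell2_Cauchy_Schwarz[OF f ell2_minus(1)[OF p G]] by simp
    qed
    then show "\<forall>\<^sub>F N in sequentially. norm ((\<Sum>n<N. ell2_inner S f (h n)) - ell2_inner S f G)
        \<le> ell2_norm S f * ell2_norm S (\<lambda>z. p N z - G z)"
      by simp
    show "(\<lambda>N. ell2_norm S f * ell2_norm S (\<lambda>z. p N z - G z)) \<longlonglongrightarrow> 0"
      using lim by (rule tendsto_mult_right_zero)
  qed
  then show ?thesis
    using G by blast
qed

text \<open>
  Stated for a family of vectors, of which some may coincide, because the coefficients are attached to
  the indices.
\<close>

lemma span_linear_relation:
  assumes B: "finite B" and b: "\<And>j. j \<le> card B \<Longrightarrow> b j \<in> cfun.span B"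
  shows "\<exists>t. (\<exists>j\<le>card B. t j \<noteq> 0) \<and> (\<forall>z. (\<Sum>j\<le>card B. t j * b j z) = 0)"
proof (cases "inj_on b {..card B}")
  case True
  have "cfun.dependent (b ` {..card B})"
  proof (rule ccontr)
    assume "\<not> cfun.dependent (b ` {..card B})"
    then have "card (b ` {..card B}) \<le> card B"
      using cfun.independent_span_bound[OF B] b by (metis atMost_iff image_subsetI)
    then show False
      using card_image[OF True] by simp
  qed
  then obtain u where u: "\<exists>v\<in>b ` {..card B}. u v \<noteq> 0"
    and sum0: "(\<Sum>v\<in>b ` {..card B}. (\<lambda>z. u v * v z)) = 0"
    using cfun.dependent_finite[of "b ` {..card B}"] by auto
  have "(\<Sum>j\<le>card B. u (b j) * b j z) = 0" for z
    using fun_cong[OF sum0, of z] by (simp add: sum.reindex[OF True] fun_sum_apply)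
  with u show ?thesis
    by (intro exI[of _ "u \<circ> b"]) auto
next
  case False
  then obtain i j where ij: "i \<le> card B" "j \<le> card B" "i \<noteq> j" "b i = b j"
    by (auto simp: inj_on_def)
  define t :: "nat \<Rightarrow> complex" where "t k = (if k = i then 1 else 0) - (if k = j then 1 else 0)" for k
  have "(\<Sum>k\<le>card B. t k * b k z) = 0" for z
    using ij by (simp add: t_def left_diff_distrib sum_subtractf if_distrib[where f = "\<lambda>x. x * _"]
        cong: if_cong)
  then show ?thesis
    using ij by (intro exI[of _ t]) (auto simp: t_def)
qed

section \<open>Bounded symmetric operators and the Weyl criterion\<close>

text \<open>
  Linearity is required on all functions, not only on \<open>\<ell>\<^sup>2\<close>: operators given by finite sums at every
  site have it, and polynomials in such operators can then be computed without membership conditions.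
\<close>

definition clinear_op :: "'a operator \<Rightarrow> bool" where
  "clinear_op T \<longleftrightarrow> (\<forall>f g c. T (\<lambda>z. c * f z + g z) = (\<lambda>z. c * T f z + T g z))"

lemma clinear_op_simps:
  assumes "clinear_op T"
  shows "T (\<lambda>z. c * f z + g z) = (\<lambda>z. c * T f z + T g z)"
    "T (\<lambda>z. f z + g z) = (\<lambda>z. T f z + T g z)"
    "T (\<lambda>z. 0) = (\<lambda>z. 0)"
    "T (\<lambda>z. c * f z) = (\<lambda>z. c * T f z)"
    "T (\<lambda>z. f z - g z) = (\<lambda>z. T f z - T g z)"
proof -
  have lin: "T (\<lambda>z. c * f z + g z) = (\<lambda>z. c * T f z + T g z)" for c f g
    using assms by (simp add: clinear_op_def)
  show zero: "T (\<lambda>z. 0) = (\<lambda>z. 0)"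
    using lin[of "-1" "\<lambda>z. 0" "\<lambda>z. 0"] by simp
  show "T (\<lambda>z. c * f z + g z) = (\<lambda>z. c * T f z + T g z)" by (rule lin)
  show "T (\<lambda>z. f z + g z) = (\<lambda>z. T f z + T g z)" using lin[of 1 f g] by simp
  show "T (\<lambda>z. c * f z) = (\<lambda>z. c * T f z)" using lin[of c f "\<lambda>z. 0"] by (simp add: zero)
  show "T (\<lambda>z. f z - g z) = (\<lambda>z. T f z - T g z)" using lin[of "-1" g f] by simp
qed

lemma clinear_op_sum:
  assumes "clinear_op T"
  shows "T (\<lambda>z. \<Sum>i\<in>A. t i * f i z) = (\<lambda>z. \<Sum>i\<in>A. t i * T (f i) z)"
  by (induction A rule: infinite_finite_induct) (simp_all add: clinear_op_simps[OF assms])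

lemma clinear_op_minus_scalar: "clinear_op T \<Longrightarrow> clinear_op (minus_scalar T l)"
  by (auto simp: clinear_op_def minus_scalar_def algebra_simps)

locale bounded_symmetric =
  fixes S :: "'a set" and T :: "'a operator" and M :: real
  assumes linear: "clinear_op T"
    and maps: "f \<in> ell2 S \<Longrightarrow> T f \<in> ell2 S"
    and bounded: "f \<in> ell2 S \<Longrightarrow> ell2_norm S (T f) \<le> M * ell2_norm S f"
    and symmetric: "f \<in> ell2 S \<Longrightarrow> g \<in> ell2 S \<Longrightarrow> ell2_inner S (T f) g = ell2_inner S f (T g)"
begin

abbreviation shifted :: "complex \<Rightarrow> 'a operator" where
  "shifted l \<equiv> minus_scalar T l"

lemma shifted_maps: "f \<in> ell2 S \<Longrightarrow> shifted l f \<in> ell2 S"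
  unfolding minus_scalar_def by (intro ell2_minus ell2_scale maps)

lemma shifted_linear: "clinear_op (shifted l)"
  by (rule clinear_op_minus_scalar[OF linear])

lemma shifted_bounded:
  assumes "f \<in> ell2 S"
  shows "ell2_norm S (shifted l f) \<le> (M + cmod l) * ell2_norm S f"
proof -
  have "ell2_norm S (shifted l f) \<le> ell2_norm S (T f) + ell2_norm S (\<lambda>z. l * f z)"
    unfolding minus_scalar_def by (intro ell2_minus ell2_scale maps assms)
  then show ?thesis
    using bounded[OF assms] by (simp add: ell2_norm_scale distrib_right)
qed

lemma shifted_adjoint:
  assumes "f \<in> ell2 S" "g \<in> ell2 S"
  shows "ell2_inner S (shifted l f) g = ell2_inner S f (shifted (cnj l) g)"
proof -
  have "ell2_inner S (\<lambda>z. (- l) * f z + T f z) g = ell2_inner S f (\<lambda>z. (- cnj l) * g z + T g z)"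
    using assms by (simp only: ell2_inner_lincomb_left ell2_inner_lincomb_right maps symmetric) simp
  then show ?thesis
    by (simp add: minus_scalar_def)
qed

text \<open>\<open>T - l\<close> is normal, so it and its adjoint have equally long values.\<close>

lemma shifted_cnj_norm:
  assumes "f \<in> ell2 S"
  shows "ell2_norm S (shifted (cnj l) f) = ell2_norm S (shifted l f)"
proof -
  have "shifted l (shifted (cnj l) f) = shifted (cnj l) (shifted l f)"
    unfolding minus_scalar_def by (simp add: clinear_op_simps[OF linear] algebra_simps)
  then have "ell2_inner S (shifted (cnj l) f) (shifted (cnj l) f)
      = ell2_inner S (shifted l f) (shifted l f)"
    using shifted_adjoint[of f "shifted l f" l] shifted_adjoint[of f "shifted (cnj l) f" "cnj l"]
    by (simp add: assms shifted_maps)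
  then have "(ell2_norm S (shifted (cnj l) f))\<^sup>2 = (ell2_norm S (shifted l f))\<^sup>2"
    using shifted_maps[OF assms]
    by (simp add: ell2_inner_self del: of_real_power)
  then show ?thesis
    by simp
qed

text \<open>
  Bounded below implies invertible: writing \<open>B = T - l\<close>, the map \<open>1 - s B\<^sup>*B\<close> is a strict contraction
  for small \<open>s > 0\<close>, so \<open>B\<^sup>*(B x - g) = 0\<close> has a solution, and \<open>B\<^sup>*\<close> is injective because it is as
  bounded below as \<open>B\<close>.
\<close>

lemma bounded_below_imp_resolvent:
  assumes c: "c > 0" and below: "\<And>f. f \<in> ell2 S \<Longrightarrow> c * ell2_norm S f \<le> ell2_norm S (shifted l f)"
  shows "l \<in> resolvent_set S T"
proof -
  define K where "K = \<bar>M\<bar> + cmod l + 1"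
  have K: "K \<ge> 1"
    by (simp add: K_def)
  have bdd: "ell2_norm S (shifted l f) \<le> K * ell2_norm S f" if "f \<in> ell2 S" for f
  proof -
    have "(M + cmod l) * ell2_norm S f \<le> K * ell2_norm S f"
      by (rule mult_right_mono) (auto simp: K_def)
    then show ?thesis
      using shifted_bounded[OF that, of l] by linarith
  qed
  define s where "s = 1 / K\<^sup>2"
  have s: "s > 0" "s * K\<^sup>2 = 1"
    using K by (auto simp: s_def)
  define q where "q = sqrt (1 - s * c\<^sup>2)"
  have contr: "ell2_norm S (\<lambda>z. h z - s * shifted (cnj l) (shifted l h) z) \<le> q * ell2_norm S h"
    if h: "h \<in> ell2 S" for h
  proof -
    define B where "B = shifted l h"
    define C where "C = shifted (cnj l) B"
    have mem: "B \<in> ell2 S" "C \<in> ell2 S"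
      by (simp_all add: B_def C_def h shifted_maps)
    have hC: "ell2_inner S h C = of_real ((ell2_norm S B)\<^sup>2)"
      using shifted_adjoint[OF h mem(1), of l] mem by (simp add: B_def C_def ell2_inner_self)
    have Ch: "ell2_inner S C h = of_real ((ell2_norm S B)\<^sup>2)"
      using ell2_inner_commute[of S C h] hC by simp
    have "ell2_inner S (\<lambda>z. (- s) * C z + h z) (\<lambda>z. (- s) * C z + h z)
        = of_real ((ell2_norm S h)\<^sup>2 - 2 * s * (ell2_norm S B)\<^sup>2 + s\<^sup>2 * (ell2_norm S C)\<^sup>2)"
      using mem h
      by (simp only: ell2_inner_lincomb_left ell2_inner_lincomb_right ell2_lincomb hC Ch ell2_inner_self)
        (simp add: power2_eq_square algebra_simps)
    then have "(ell2_norm S (\<lambda>z. (- s) * C z + h z))\<^sup>2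
        = (ell2_norm S h)\<^sup>2 - 2 * s * (ell2_norm S B)\<^sup>2 + s\<^sup>2 * (ell2_norm S C)\<^sup>2"
      using mem h by (simp only: ell2_inner_self ell2_lincomb of_real_eq_iff)
    also have "s\<^sup>2 * (ell2_norm S C)\<^sup>2 \<le> s * (ell2_norm S B)\<^sup>2"
    proof -
      have "ell2_norm S C \<le> K * ell2_norm S B"
        unfolding C_def shifted_cnj_norm[OF mem(1)] by (rule bdd[OF mem(1)])
      then have "(ell2_norm S C)\<^sup>2 \<le> (K * ell2_norm S B)\<^sup>2"
        by (intro power_mono) auto
      then have "s\<^sup>2 * (ell2_norm S C)\<^sup>2 \<le> s\<^sup>2 * (K * ell2_norm S B)\<^sup>2"
        by (intro mult_left_mono) auto
      also have "\<dots> = s * (s * K\<^sup>2) * (ell2_norm S B)\<^sup>2"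
        by (simp add: power2_eq_square)
      finally show ?thesis
        by (simp add: s)
    qed
    also have "(ell2_norm S h)\<^sup>2 - 2 * s * (ell2_norm S B)\<^sup>2 + s * (ell2_norm S B)\<^sup>2
        = (ell2_norm S h)\<^sup>2 - s * (ell2_norm S B)\<^sup>2"
      by simp
    also have "\<dots> \<le> (ell2_norm S h)\<^sup>2 - s * (c * ell2_norm S h)\<^sup>2"
      using below[OF h] c s(1) by (intro diff_left_mono mult_left_mono power_mono) (auto simp: B_def)
    also have "\<dots> = (1 - s * c\<^sup>2) * (ell2_norm S h)\<^sup>2"
      by (simp add: power_mult_distrib algebra_simps)
    finally have le: "(ell2_norm S (\<lambda>z. (- s) * C z + h z))\<^sup>2 \<le> (1 - s * c\<^sup>2) * (ell2_norm S h)\<^sup>2"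
      by simp
    have "ell2_norm S (\<lambda>z. (- s) * C z + h z) \<le> q * ell2_norm S h"
      using real_sqrt_le_mono[OF le] by (simp add: q_def real_sqrt_mult)
    then show ?thesis
      by (simp add: B_def C_def)
  qed
  have surj: "\<exists>f\<in>ell2 S. shifted l f = g" if g: "g \<in> ell2 S" for g
  proof (cases "\<forall>f\<in>ell2 S. ell2_norm S f = 0")
    case True
    then have "g = 0" "shifted l 0 = 0"
      using g ell2_norm_eq_0D shifted_maps[of 0] by auto
    then show ?thesis
      by auto
  next
    case False
    then obtain f0 where f0: "f0 \<in> ell2 S" "ell2_norm S f0 > 0"
      by (metis ell2_norm_nonneg less_eq_real_def)
    have "c * ell2_norm S f0 \<le> K * ell2_norm S f0"
      using below[OF f0(1)] bdd[OF f0(1)] by linarith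
    then have "c \<le> K"
      using f0(2) by simp
    then have "s * c\<^sup>2 \<le> s * K\<^sup>2"
      using c s(1) by (intro mult_left_mono power_mono) auto
    then have q: "0 \<le> q" "q < 1"
      using c s by (auto simp: q_def)
    define \<Phi> where "\<Phi> x = (\<lambda>z. (x z - s * shifted (cnj l) (shifted l x) z) + s * shifted (cnj l) g z)" for x
    have "\<exists>x\<in>ell2 S. \<Phi> x = x"
    proof (rule ell2_contraction_fixpoint[OF _ _ q])
      show "\<Phi> x \<in> ell2 S" if "x \<in> ell2 S" for x
        unfolding \<Phi>_def using that g by (intro ell2_plus ell2_minus ell2_scale shifted_maps)
      show "ell2_norm S (\<lambda>z. \<Phi> x z - \<Phi> y z) \<le> q * ell2_norm S (\<lambda>z. x z - y z)"
        if "x \<in> ell2 S" "y \<in> ell2 S" for x y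
        using contr[OF ell2_minus(1)[OF that]]
        by (simp add: \<Phi>_def clinear_op_simps[OF shifted_linear] algebra_simps)
    qed
    then obtain x where x: "x \<in> ell2 S" "\<Phi> x = x"
      by blast
    have "shifted (cnj l) (\<lambda>z. shifted l x z - g z) = 0"
    proof
      fix z
      have "s * (shifted (cnj l) (shifted l x) z - shifted (cnj l) g z) = x z - \<Phi> x z"
        by (simp add: \<Phi>_def algebra_simps)
      also have "\<dots> = 0"
        by (simp add: x(2))
      finally have "s * (shifted (cnj l) (shifted l x) z - shifted (cnj l) g z) = 0" .
      then show "shifted (cnj l) (\<lambda>z. shifted l x z - g z) z = 0 z"
        using s(1) by (simp add: clinear_op_simps[OF shifted_linear])
    qed
    moreover have mem: "(\<lambda>z. shifted l x z - g z) \<in> ell2 S"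
      by (intro ell2_minus shifted_maps x g)
    ultimately have "c * ell2_norm S (\<lambda>z. shifted l x z - g z) \<le> 0"
      using below[OF mem] shifted_cnj_norm[OF mem, of l] by simp
    then have "ell2_norm S (\<lambda>z. shifted l x z - g z) = 0"
      using c by (simp add: mult_le_0_iff) (metis ell2_norm_nonneg order_antisym)
    then have "shifted l x = g"
      using ell2_norm_eq_0D[OF mem] by (auto simp: fun_eq_iff)
    then show ?thesis
      using x by blast
  qed
  have inj: "inj_on (shifted l) (ell2 S)"
  proof (rule inj_onI)
    fix x y assume xy: "x \<in> ell2 S" "y \<in> ell2 S" "shifted l x = shifted l y"
    then have "c * ell2_norm S (\<lambda>z. x z - y z) \<le> 0"
      using below[OF ell2_minus(1)[OF xy(1,2)]] by (simp add: clinear_op_simps[OF shifted_linear])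
    then have "ell2_norm S (\<lambda>z. x z - y z) = 0"
      using c by (simp add: mult_le_0_iff) (metis ell2_norm_nonneg order_antisym)
    then show "x = y"
      using ell2_norm_eq_0D[OF ell2_minus(1)[OF xy(1,2)]] by (auto simp: fun_eq_iff)
  qed
  have "bij_betw (shifted l) (ell2 S) (ell2 S)"
    unfolding bij_betw_def using inj surj shifted_maps by blast
  moreover have "\<forall>f\<in>ell2 S. ell2_norm S f \<le> (1 / c) * ell2_norm S (shifted l f)"
    using below c by (auto simp: field_simps)
  ultimately show ?thesis
    unfolding resolvent_set_def by blast
qed

text \<open>
  Otherwise \<open>T - l\<close> would be bounded below on finitely supported functions, hence by density and
  continuity everywhere, and \<open>l\<close> would lie in the resolvent set.
\<close>

lemma approximate_eigenvector:
  assumes l: "l \<in> spectrum S T" and e: "e > 0"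
  shows "\<exists>f F. finite F \<and> F \<subseteq> S \<and> (\<forall>z. z \<notin> F \<longrightarrow> f z = 0) \<and> ell2_norm S f = 1 \<and>
    ell2_norm S (shifted l f) \<le> e"
proof (rule ccontr)
  assume none: "\<not> ?thesis"
  have fin: "e * ell2_norm S f \<le> ell2_norm S (shifted l f)"
    if F: "finite F" "F \<subseteq> S" and f: "\<And>z. z \<notin> F \<Longrightarrow> f z = 0" for f F
  proof (cases "ell2_norm S f = 0")
    case False
    define u where "u = (\<lambda>z. of_real (1 / ell2_norm S f) * f z)"
    have "ell2_norm S u = 1"
      unfolding u_def ell2_norm_scale using False by (simp add: norm_divide)
    then have "e < ell2_norm S (shifted l u)"
      using none F f by (metis mult_zero_right not_le u_def)
    also have "ell2_norm S (shifted l u) = 1 / ell2_norm S f * ell2_norm S (shifted l f)"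
      unfolding u_def clinear_op_simps(4)[OF shifted_linear] ell2_norm_scale by (simp add: norm_divide)
    finally show ?thesis
      using False by (simp add: field_simps less_eq_real_def split: if_splits)
        (metis ell2_norm_nonneg less_eq_real_def mult.commute pos_less_divide_eq)
  qed simp
  define K where "K = \<bar>M\<bar> + cmod l + e"
  have bdd: "ell2_norm S (shifted l f) \<le> (K - e) * ell2_norm S f" if "f \<in> ell2 S" for f
  proof -
    have "(M + cmod l) * ell2_norm S f \<le> (K - e) * ell2_norm S f"
      by (rule mult_right_mono) (auto simp: K_def)
    then show ?thesis
      using shifted_bounded[OF that, of l] by linarith
  qed
  have "e * ell2_norm S f \<le> ell2_norm S (shifted l f)" if f: "f \<in> ell2 S" for f
  proof (rule field_le_epsilon)
    fix r :: real assume r: "r > 0"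
    have K: "K > 0"
      using e by (simp add: K_def add_nonneg_pos)
    obtain F where F: "finite F" "F \<subseteq> S" and small: "ell2_norm S (\<lambda>z. if z \<in> F then 0 else f z) \<le> r / K"
      using ell2_truncation[OF f, of "r / K"] r K by auto
    define g where "g = (\<lambda>z. if z \<in> F then f z else 0)"
    define h where "h = (\<lambda>z. if z \<in> F then 0 else f z)"
    have g: "g \<in> ell2 S" and h: "h \<in> ell2 S"
      by (rule ell2_dominated(1)[OF f], simp add: g_def h_def)+
    have fgh: "f = (\<lambda>z. g z + h z)" and "g = (\<lambda>z. f z - h z)"
      by (auto simp: fun_eq_iff g_def h_def)
    then have gfh: "shifted l g = (\<lambda>z. shifted l f z - shifted l h z)"
      using clinear_op_simps(5)[OF shifted_linear, of l f h] by simp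
    have "e * ell2_norm S g \<le> ell2_norm S (shifted l g)"
      by (rule fin[OF F]) (simp add: g_def)
    also have "\<dots> \<le> ell2_norm S (shifted l f) + ell2_norm S (shifted l h)"
      unfolding gfh by (intro ell2_minus shifted_maps f h)
    finally have "e * ell2_norm S g \<le> ell2_norm S (shifted l f) + ell2_norm S (shifted l h)" .
    moreover have "e * ell2_norm S f \<le> e * (ell2_norm S g + ell2_norm S h)"
      using e ell2_plus(2)[OF g h] by (intro mult_left_mono) (auto simp: fgh)
    moreover have "K * ell2_norm S h \<le> r"
      using small K by (simp add: h_def field_simps)
    ultimately show "e * ell2_norm S f \<le> ell2_norm S (shifted l f) + r"
      using bdd[OF h] by (simp add: algebra_simps)
  qed
  then have "l \<in> resolvent_set S T"
    by (rule bounded_below_imp_resolvent[OF e])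
  then show False
    using l by (simp add: spectrum_def)
qed

text \<open>
  An orthonormal sequence \<open>g\<close> of approximate eigenvectors excludes a finite codimension of the range.
  Given \<open>k\<close> vectors spanning a complement, distribute the indices over \<open>k + 1\<close> residue classes and
  form \<open>G\<^sub>j = \<Sum> 2\<^sup>-\<^sup>n g\<^sub>n\<close> over the \<open>j\<close>-th class. Some nontrivial combination \<open>\<Sum> t\<^sub>j G\<^sub>j\<close> lies in the range,
  so that its coefficient \<open>t\<^sub>j 2\<^sup>-\<^sup>n\<close> along \<open>g\<^sub>n\<close> is \<open>O(4\<^sup>-\<^sup>n)\<close>; hence all \<open>t\<^sub>j\<close> vanish.
\<close>

lemma weyl_sequence_imp_ess_spectrum:
  assumes g: "\<And>n. g n \<in> ell2 S" and norm: "\<And>n. ell2_norm S (g n) = 1"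
    and orth: "\<And>m n. m \<noteq> n \<Longrightarrow> ell2_inner S (g m) (g n) = 0"
    and small: "\<And>n. ell2_norm S (shifted l (g n)) \<le> (1 / 4) ^ n"
  shows "l \<in> ess_spectrum S T"
proof (rule ccontr)
  assume "l \<notin> ess_spectrum S T"
  then obtain B where B: "finite B" "B \<subseteq> ell2 S"
    and codim: "\<And>h. h \<in> ell2 S \<Longrightarrow> \<exists>f\<in>ell2 S. h - shifted l f \<in> cfun.span B"
    unfolding ess_spectrum_def fredholm_def by auto
  define k where "k = Suc (card B)"
  define h where "h j n = (\<lambda>z. (if n mod k = j then (1 / 2) ^ n else 0) * g n z)" for j n
  have h: "h j n \<in> ell2 S" "ell2_norm S (h j n) \<le> (1 / 2) ^ n" for j n
    by (simp_all add: h_def ell2_scale ell2_norm_scale g norm norm_power)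
  have "\<exists>G\<in>ell2 S. \<forall>f\<in>ell2 S. (\<lambda>N. \<Sum>n<N. ell2_inner S f (h j n)) \<longlonglongrightarrow> ell2_inner S f G" for j
    by (rule ell2_series[OF h])
  then obtain G where G: "\<And>j. G j \<in> ell2 S"
    and lim: "\<And>j f. f \<in> ell2 S \<Longrightarrow> (\<lambda>N. \<Sum>n<N. ell2_inner S f (h j n)) \<longlonglongrightarrow> ell2_inner S f (G j)"
    by metis
  have coeff: "ell2_inner S (g m) (G j) = (if m mod k = j then (1 / 2) ^ m else 0)" for m j
  proof (rule LIMSEQ_unique[OF lim[OF g]])
    have inner: "ell2_inner S (g m) (h j n)
        = (if n = m then (if m mod k = j then (1 / 2) ^ m else 0) else 0)" for n
      using orth[of m n] ell2_inner_self[OF g, of m]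
      by (simp add: h_def ell2_inner_scale_right norm)
    have "(\<Sum>n<N. ell2_inner S (g m) (h j n)) = (if m mod k = j then (1 / 2) ^ m else 0)" if "N > m" for N
      using that unfolding inner by (subst sum.delta) auto
    then show "(\<lambda>N. \<Sum>n<N. ell2_inner S (g m) (h j n)) \<longlonglongrightarrow> (if m mod k = j then (1 / 2) ^ m else 0)"
      by (intro tendsto_eventually eventually_sequentiallyI[of "Suc m"]) auto
  qed
  obtain f where f: "\<And>j. f j \<in> ell2 S" and diff: "\<And>j. G j - shifted l (f j) \<in> cfun.span B"
    using codim[OF G] by metis
  obtain t j0 where j0: "j0 \<le> card B" "t j0 \<noteq> 0"
    and rel: "\<And>z. (\<Sum>j\<le>card B. t j * (G j - shifted l (f j)) z) = 0"
    using span_linear_relation[OF B(1), of "\<lambda>j. G j - shifted l (f j)"] diff by blast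
  define P where "P = (\<lambda>z. \<Sum>j\<le>card B. t j * f j z)"
  have P: "P \<in> ell2 S"
    unfolding P_def by (intro ell2_sum ell2_scale f)
  have eq: "(\<lambda>z. \<Sum>j\<le>card B. t j * G j z) = shifted l P"
    using rel by (auto simp: P_def clinear_op_sum[OF shifted_linear] fun_eq_iff right_diff_distrib sum_subtractf)
  have bound: "cmod (t j0) \<le> (1 / 2) ^ m * ell2_norm S P" if m: "m mod k = j0" for m
  proof -
    have "ell2_inner S (g m) (\<lambda>z. \<Sum>j\<le>card B. t j * G j z) = (\<Sum>j\<le>card B. t j * ell2_inner S (g m) (G j))"
      using g G by (simp add: ell2_inner_sum_right ell2_scale ell2_inner_scale_right)
    also have "\<dots> = (\<Sum>j\<le>card B. if j = j0 then t j0 * (1 / 2) ^ m else 0)"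
      using m by (intro sum.cong) (auto simp: coeff)
    also have "\<dots> = t j0 * (1 / 2) ^ m"
      using j0 by simp
    finally have "t j0 * (1 / 2) ^ m = ell2_inner S (shifted (cnj l) (g m)) P"
      unfolding eq using shifted_adjoint[OF g P, of "cnj l"] by simp
    then have "cmod (t j0) * (1 / 2) ^ m \<le> ell2_norm S (shifted l (g m)) * ell2_norm S P"
      using ell2_Cauchy_Schwarz[OF shifted_maps[OF g] P, of "cnj l" m] shifted_cnj_norm[OF g]
      by (metis norm_mult norm_power norm_divide norm_one norm_numeral)
    also have "\<dots> \<le> (1 / 4) ^ m * ell2_norm S P"
      by (intro mult_right_mono small) auto
    also have "(1 / 4 :: real) ^ m = (1 / 2) ^ m * (1 / 2) ^ m"
      by (simp add: power_mult_distrib[symmetric])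
    finally show ?thesis
      by (simp add: field_simps)
  qed
  have "(\<lambda>i. (1 / 2) ^ (i * k + j0) * ell2_norm S P) \<longlonglongrightarrow> 0"
  proof (rule tendsto_mult_left_zero)
    have "filterlim (\<lambda>i. i * k + j0) sequentially sequentially"
      by (rule filterlim_subseq) (simp add: strict_mono_def k_def del: mult_Suc_right)
    then show "(\<lambda>i. (1 / 2 :: real) ^ (i * k + j0)) \<longlonglongrightarrow> 0"
      by (rule filterlim_compose[rotated]) (rule LIMSEQ_power_zero, simp)
  qed
  moreover have "(i * k + j0) mod k = j0" for i
    using j0 by (simp add: k_def del: mult_Suc_right)
  ultimately have "cmod (t j0) \<le> 0"
    using bound by (intro LIMSEQ_le_const) auto
  then show False
    using j0 by simp
qed

end

section \<open>Jacobi operators\<close>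

lemma ell2_weighted_shift:
  assumes f: "f \<in> ell2 S" and inj: "inj_on \<sigma> S"
    and w: "\<And>z. z \<in> S \<Longrightarrow> \<sigma> z \<in> S \<Longrightarrow> \<bar>w z\<bar> \<le> C" and C: "0 \<le> C"
  defines "g \<equiv> \<lambda>z. if z \<in> S then of_real (w z) * f (\<sigma> z) else 0"
  shows "g \<in> ell2 S" "ell2_norm S g \<le> C * ell2_norm S f"
proof -
  have le: "L2_set (\<lambda>z. cmod (g z)) F \<le> C * ell2_norm S f" if F: "finite F" "F \<subseteq> S" for F
  proof -
    have "cmod (g z) \<le> C * cmod (f (\<sigma> z))" if "z \<in> F" for z
      using w[of z] that F ell2_off[OF f, of "\<sigma> z"]
      by (cases "\<sigma> z \<in> S") (auto simp: g_def norm_mult intro!: mult_right_mono)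
    then have "L2_set (\<lambda>z. cmod (g z)) F \<le> L2_set (\<lambda>z. C * cmod (f (\<sigma> z))) F"
      by (rule L2_set_mono) auto
    also have "\<dots> = C * L2_set (\<lambda>z. cmod (f (\<sigma> z))) F"
      using C by (simp add: L2_set_right_distrib)
    also have "L2_set (\<lambda>z. cmod (f (\<sigma> z))) F = L2_set (\<lambda>z. cmod (f z)) (\<sigma> ` F)"
      by (simp add: L2_set_def sum.reindex[OF inj_on_subset[OF inj F(2)]])
    also have "C * \<dots> \<le> C * ell2_norm S f"
      using C by (intro mult_left_mono L2_set_le_ell2_norm f)
    finally show ?thesis .
  qed
  show "g \<in> ell2 S" "ell2_norm S g \<le> C * ell2_norm S f"
    by (rule ell2_bounded_finite_sums[OF _ le]; simp add: g_def)+
qed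

definition coeffs_bounded ::
  "nat \<Rightarrow> point set \<Rightarrow> (nat \<Rightarrow> point \<Rightarrow> real) \<Rightarrow> (point \<Rightarrow> real) \<Rightarrow> real \<Rightarrow> bool" where
  "coeffs_bounded d S a V C \<longleftrightarrow> (\<forall>i<d. \<forall>z\<in>S. \<bar>a i z\<bar> \<le> C) \<and> (\<forall>z\<in>S. \<bar>V z\<bar> \<le> C)"

lemma jacobi_op_linear: "clinear_op (jacobi_op d S a V)"
  by (auto simp: clinear_op_def jacobi_op_def fun_eq_iff algebra_simps sum.distrib sum_distrib_left)

definition hop_up :: "point set \<Rightarrow> (point \<Rightarrow> real) \<Rightarrow> nat \<Rightarrow> point operator" where
  "hop_up S w i f = (\<lambda>z. if z \<in> S then of_real (w z) * f (z(i := z i + 1)) else 0)"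

definition hop_down :: "point set \<Rightarrow> (point \<Rightarrow> real) \<Rightarrow> nat \<Rightarrow> point operator" where
  "hop_down S w i f = (\<lambda>z. if z \<in> S then of_real (w (z(i := z i - 1))) * f (z(i := z i - 1)) else 0)"

definition potential_op :: "'a set \<Rightarrow> ('a \<Rightarrow> real) \<Rightarrow> 'a operator" where
  "potential_op S V f = (\<lambda>z. if z \<in> S then of_real (V z) * f z else 0)"

lemma jacobi_op_eq:
  "jacobi_op d S a V f =
    (\<lambda>z. (\<Sum>i<d. hop_down S (a i) i f z + hop_up S (a i) i f z) + potential_op S V f z)"
  by (auto simp: jacobi_op_def hop_up_def hop_down_def potential_op_def fun_eq_iff)

lemma bij_translate: "bij (\<lambda>z::point. z(i := z i + k))"
  by (rule bij_betw_byWitness[where f' = "\<lambda>z. z(i := z i - k)"]) auto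

text \<open>
  Translating the summation index by one turns a hop upwards into the hop downwards over the same bond.
\<close>

lemma inner_hop:
  assumes "f \<in> ell2 S" "g \<in> ell2 S"
  shows "ell2_inner S (hop_up S w i f) g = ell2_inner S f (hop_down S w i g)"
proof -
  have "ell2_inner S (hop_up S w i f) g = (\<Sum>\<^sub>\<infinity>z. of_real (w z) * cnj (f (z(i := z i + 1))) * g z)"
    unfolding ell2_inner_def hop_up_def
    by (rule infsum_cong_neutral) (use assms in \<open>auto simp: ell2_off\<close>)
  also have "\<dots> = (\<Sum>\<^sub>\<infinity>z. of_real (w (z(i := z i - 1))) * cnj (f z) * g (z(i := z i - 1)))"
    using infsum_reindex_bij_betw[OF bij_translate[of i 1],
        of "\<lambda>z. of_real (w (z(i := z i - 1))) * cnj (f z) * g (z(i := z i - 1))"]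
    by simp
  also have "\<dots> = ell2_inner S f (hop_down S w i g)"
    unfolding ell2_inner_def hop_down_def
    by (rule infsum_cong_neutral) (use assms in \<open>auto simp: ell2_off\<close>)
  finally show ?thesis .
qed

lemma inner_potential_op: "ell2_inner S (potential_op S V f) g = ell2_inner S f (potential_op S V g)"
  unfolding ell2_inner_def potential_op_def by (rule infsum_cong) auto

lemma jacobi_op_bounded_symmetric:
  assumes C: "0 \<le> C" and coeffs: "coeffs_bounded d S a V C"
  shows "bounded_symmetric S (jacobi_op d S a V) ((2 * real d + 1) * C)"
proof
  show "clinear_op (jacobi_op d S a V)"
    by (rule jacobi_op_linear)
  have inj: "inj_on (\<lambda>z. z(i := z i + k)) S" for i and k :: int
    using bij_is_inj[OF bij_translate] by (rule inj_on_subset) simp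
  have inj_down: "inj_on (\<lambda>z. z(i := z i - 1)) S" for i
    unfolding diff_conv_add_uminus by (rule inj)
  have up: "hop_up S (a i) i f \<in> ell2 S" "ell2_norm S (hop_up S (a i) i f) \<le> C * ell2_norm S f"
    if "i < d" "f \<in> ell2 S" for i f
    using ell2_weighted_shift[OF that(2) inj[of i "1"], of "a i" C] that coeffs C
    by (auto simp: hop_up_def coeffs_bounded_def)
  have down: "hop_down S (a i) i f \<in> ell2 S" "ell2_norm S (hop_down S (a i) i f) \<le> C * ell2_norm S f"
    if "i < d" "f \<in> ell2 S" for i f
    using ell2_weighted_shift[OF that(2) inj_down[of i], of "\<lambda>z. a i (z(i := z i - 1))" C] that coeffs C
    by (auto simp: hop_down_def coeffs_bounded_def)
  have pot: "potential_op S V f \<in> ell2 S" "ell2_norm S (potential_op S V f) \<le> C * ell2_norm S f"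
    if "f \<in> ell2 S" for f
    unfolding potential_op_def
    using that coeffs ell2_weighted_shift[of f S "\<lambda>z. z" V C] C
    by (auto simp: coeffs_bounded_def)
  have sum: "(\<lambda>z. \<Sum>i<d. hop_down S (a i) i f z + hop_up S (a i) i f z) \<in> ell2 S"
    if "f \<in> ell2 S" for f
    using that by (intro ell2_sum ell2_plus up down) auto
  fix f assume f: "f \<in> ell2 S"
  show "jacobi_op d S a V f \<in> ell2 S"
    unfolding jacobi_op_eq by (intro ell2_plus sum pot f)
  have "ell2_norm S (jacobi_op d S a V f)
      \<le> ell2_norm S (\<lambda>z. \<Sum>i<d. hop_down S (a i) i f z + hop_up S (a i) i f z)
        + ell2_norm S (potential_op S V f)"
    unfolding jacobi_op_eq by (intro ell2_plus sum pot f)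
  also have "\<dots> \<le> (\<Sum>i<d. ell2_norm S (\<lambda>z. hop_down S (a i) i f z + hop_up S (a i) i f z))
        + C * ell2_norm S f"
    using f by (intro add_mono ell2_norm_sum_le ell2_plus up down pot) auto
  also have "\<dots> \<le> (\<Sum>i<d. C * ell2_norm S f + C * ell2_norm S f) + C * ell2_norm S f"
  proof (intro add_mono sum_mono order_refl)
    fix i assume "i \<in> {..<d}"
    then have i: "i < d"
      by simp
    show "ell2_norm S (\<lambda>z. hop_down S (a i) i f z + hop_up S (a i) i f z)
        \<le> C * ell2_norm S f + C * ell2_norm S f"
      using ell2_plus(2)[OF down(1)[OF i f] up(1)[OF i f]] up(2)[OF i f] down(2)[OF i f] by linarith
  qed
  also have "\<dots> = (2 * real d + 1) * C * ell2_norm S f"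
    by (simp add: algebra_simps)
  finally show "ell2_norm S (jacobi_op d S a V f) \<le> (2 * real d + 1) * C * ell2_norm S f" .
  fix g assume g: "g \<in> ell2 S"
  have "ell2_inner S (jacobi_op d S a V f) g
      = (\<Sum>i<d. ell2_inner S (hop_down S (a i) i f) g + ell2_inner S (hop_up S (a i) i f) g)
        + ell2_inner S (potential_op S V f) g"
  proof -
    have "ell2_inner S (\<lambda>z. \<Sum>i<d. hop_down S (a i) i f z + hop_up S (a i) i f z) g
        = (\<Sum>i<d. ell2_inner S (\<lambda>z. hop_down S (a i) i f z + hop_up S (a i) i f z) g)"
      by (rule ell2_inner_sum_left[OF g]) (auto intro!: ell2_plus up down f)
    also have "\<dots> = (\<Sum>i<d. ell2_inner S (hop_down S (a i) i f) g + ell2_inner S (hop_up S (a i) i f) g)"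
      by (rule sum.cong[OF refl], rule ell2_inner_plus_left[OF g]) (auto intro!: up down f)
    finally show ?thesis
      unfolding jacobi_op_eq ell2_inner_plus_left[OF g sum[OF f] pot(1)[OF f]] by simp
  qed
  also have "\<dots> = (\<Sum>i<d. ell2_inner S f (hop_down S (a i) i g) + ell2_inner S f (hop_up S (a i) i g))
        + ell2_inner S f (potential_op S V g)"
  proof -
    have "ell2_inner S (hop_down S (a i) i f) g = ell2_inner S f (hop_up S (a i) i g)" for i
      using inner_hop[OF g f, of "a i" i] by (metis ell2_inner_commute)
    then show ?thesis
      by (simp add: inner_hop[OF f g] inner_potential_op add.commute)
  qed
  also have "\<dots> = ell2_inner S f (jacobi_op d S a V g)"
  proof -
    have "ell2_inner S f (\<lambda>z. \<Sum>i<d. hop_down S (a i) i g z + hop_up S (a i) i g z)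
        = (\<Sum>i<d. ell2_inner S f (\<lambda>z. hop_down S (a i) i g z + hop_up S (a i) i g z))"
      by (rule ell2_inner_sum_right[OF f]) (auto intro!: ell2_plus up down g)
    also have "\<dots> = (\<Sum>i<d. ell2_inner S f (hop_down S (a i) i g) + ell2_inner S f (hop_up S (a i) i g))"
      by (rule sum.cong[OF refl], rule ell2_inner_plus_right[OF f]) (auto intro!: up down g)
    finally show ?thesis
      unfolding jacobi_op_eq ell2_inner_plus_right[OF f sum[OF g] pot(1)[OF g]] by simp
  qed
  finally show "ell2_inner S (jacobi_op d S a V f) g = ell2_inner S f (jacobi_op d S a V g)" .
qed

section \<open>Spectrum of the octant operators\<close>

lemma periodic_translate:
  assumes P: "\<And>i z. i < d \<Longrightarrow> z \<in> lattice d \<Longrightarrow> F (z(i := z i + int P)) = F z"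
    and z: "z \<in> lattice d" and c: "\<And>i. i \<ge> d \<Longrightarrow> c i = 0"
  shows "F (\<lambda>i. z i + c i * int P) = (F z :: 'b)"
proof -
  have nat: "F (z(i := z i + int n * int P)) = F z" if "i < d" "z \<in> lattice d" for i n z
  proof (induction n)
    case (Suc n)
    define w where "w = z(i := z i + int n * int P)"
    have "w \<in> lattice d"
      using that by (auto simp: w_def lattice_def)
    from P[OF that(1) this] have "F (w(i := w i + int P)) = F z"
      using Suc unfolding w_def by (rule trans)
    moreover have "z(i := z i + int (Suc n) * int P) = w(i := w i + int P)"
      by (auto simp: w_def fun_eq_iff algebra_simps)
    ultimately show ?case
      by (simp only:)
  qed simp
  have int: "F (z(i := z i + k * int P)) = F z" if "i < d" "z \<in> lattice d" for i k z
  proof (cases "k \<ge> 0")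
    case True
    then show ?thesis
      using nat[OF that, of "nat k"] by simp
  next
    case False
    have "z(i := z i + k * int P) \<in> lattice d"
      using that by (auto simp: lattice_def)
    from nat[OF that(1) this, of "nat (- k)"] False show ?thesis
      by simp
  qed
  have "F (\<lambda>i. if i < m then z i + c i * int P else z i) = F z" if "m \<le> d" for m
    using that
  proof (induction m)
    case (Suc m)
    define w where "w = (\<lambda>i. if i < m then z i + c i * int P else z i)"
    have "w \<in> lattice d"
      using z Suc.prems by (auto simp: w_def lattice_def)
    from int[OF _ this, of m "c m"] Suc
    have "F (w(m := w m + c m * int P)) = F z"
      by (simp add: w_def)
    moreover have "w(m := w m + c m * int P) = (\<lambda>i. if i < Suc m then z i + c i * int P else z i)"
      by (auto simp: w_def fun_eq_iff less_Suc_eq)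
    ultimately show ?case
      by simp
  qed simp
  moreover have "(\<lambda>i. if i < d then z i + c i * int P else z i) = (\<lambda>i. z i + c i * int P)"
    using c by (auto simp: fun_eq_iff)
  ultimately show ?thesis
    by (metis order_refl)
qed

text \<open>
  The product of all periods of all functions is a period in every direction.
\<close>

lemma common_period:
  assumes "finite A" "\<And>F. F \<in> A \<Longrightarrow> periodic d F"
  shows "\<exists>P>0. \<forall>F\<in>A. \<forall>i<d. \<forall>z\<in>lattice d. F (z(i := z i + int P)) = F z"
proof -
  have "\<exists>p. \<forall>i<d. p i > 0 \<and> (\<forall>z\<in>lattice d. F (z(i := z i + int (p i))) = F z)" if "F \<in> A" for F
    using assms(2)[OF that] by (simp add: periodic_def)
  then obtain p where p: "\<And>F i. F \<in> A \<Longrightarrow> i < d \<Longrightarrow> p F i > 0"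
    "\<And>F i z. F \<in> A \<Longrightarrow> i < d \<Longrightarrow> z \<in> lattice d \<Longrightarrow> F (z(i := z i + int (p F i))) = F z"
    by metis
  define P where "P = (\<Prod>F\<in>A. \<Prod>i<d. p F i)"
  have "P > 0"
    unfolding P_def using p(1) by (intro prod_pos) auto
  moreover have "F (z(i := z i + int P)) = F z" if "F \<in> A" "i < d" "z \<in> lattice d" for F i z
  proof -
    have "p F i dvd P"
      unfolding P_def using that assms(1)
      by (meson dvd_prodI dvd_trans finite_lessThan lessThan_iff)
    then obtain n where n: "P = n * p F i"
      by (auto simp: dvd_def mult.commute)
    have "F (z(i := z i + int k * int (p F i))) = F z" for k
    proof (induction k)
      case (Suc k)
      define w where "w = z(i := z i + int k * int (p F i))"
      have "w \<in> lattice d"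
        using that by (auto simp: w_def lattice_def)
      from p(2)[OF that(1,2) this] have "F (w(i := w i + int (p F i))) = F z"
        using Suc unfolding w_def by (rule trans)
      moreover have "z(i := z i + int (Suc k) * int (p F i)) = w(i := w i + int (p F i))"
        by (auto simp: w_def fun_eq_iff algebra_simps)
      ultimately show ?case
        by (simp only:)
    qed simp
    from this[of n] show ?thesis
      by (simp add: n)
  qed
  ultimately show ?thesis
    by blast
qed

text \<open>
  Every point is a translate, by multiples of the period, of one in the finite period box.
\<close>

lemma periodic_bounded:
  assumes "periodic d F"
  shows "\<exists>C\<ge>0. \<forall>z\<in>lattice d. \<bar>F z\<bar> \<le> C"
proof -
  obtain P where P: "P > 0" "\<And>i z. i < d \<Longrightarrow> z \<in> lattice d \<Longrightarrow> F (z(i := z i + int P)) = F z"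
    using common_period[of "{F}" d] assms by auto
  define B where "B = {z \<in> lattice d. \<forall>i<d. z i \<in> {0..<int P}}"
  have "B \<subseteq> (\<lambda>h i. if i < d then h i else 0) ` (PiE {..<d} (\<lambda>_. {0..<int P}))"
  proof
    fix z assume z: "z \<in> B"
    then have "z = (\<lambda>i. if i < d then restrict z {..<d} i else 0)"
      by (auto simp: B_def lattice_def fun_eq_iff)
    moreover have "restrict z {..<d} \<in> PiE {..<d} (\<lambda>_. {0..<int P})"
      using z by (auto simp: B_def)
    ultimately show "z \<in> (\<lambda>h i. if i < d then h i else 0) ` (PiE {..<d} (\<lambda>_. {0..<int P}))"
      by blast
  qed
  then have fin: "finite B"
    by (rule finite_subset) (intro finite_imageI finite_PiE; simp)
  define C where "C = (\<Sum>z\<in>B. \<bar>F z\<bar>)"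
  have "\<bar>F z\<bar> \<le> C" if z: "z \<in> lattice d" for z
  proof -
    define w where "w = (\<lambda>i. z i + (- (z i div int P)) * int P)"
    have w: "w i = z i mod int P" for i
      by (simp add: w_def minus_div_mult_eq_mod[symmetric])
    have "w \<in> B"
      using z P(1) by (auto simp: B_def lattice_def w)
    moreover have "F w = F z"
      unfolding w_def using z by (intro periodic_translate[OF P(2)]) (auto simp: lattice_def)
    ultimately show ?thesis
      unfolding C_def using fin member_le_sum[of w B "\<lambda>z. \<bar>F z\<bar>"] by simp
  qed
  moreover have "C \<ge> 0"
    by (simp add: C_def sum_nonneg)
  ultimately show ?thesis
    by blast
qed

lemma periodic_family_bounded:
  assumes "finite A" "\<And>F. F \<in> A \<Longrightarrow> periodic d F"
  shows "\<exists>C\<ge>0. \<forall>F\<in>A. \<forall>z\<in>lattice d. \<bar>F z\<bar> \<le> C"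
proof -
  obtain c where c: "\<And>F. F \<in> A \<Longrightarrow> c F \<ge> 0 \<and> (\<forall>z\<in>lattice d. \<bar>F z\<bar> \<le> c F)"
    using periodic_bounded[OF assms(2)] by metis
  have "c F \<le> (\<Sum>F\<in>A. c F)" if "F \<in> A" for F
    using that assms(1) c by (intro member_le_sum) auto
  then show ?thesis
    using c by (intro exI[of _ "\<Sum>F\<in>A. c F"]) (auto intro!: sum_nonneg intro: order_trans)
qed

lemma finite_sign_seqs: "finite (sign_seqs m)"
proof -
  have "(UNIV :: sign set) = {Plus, Minus}"
    using sign.exhaust by auto
  then have "finite (UNIV :: sign set)"
    by (metis finite.emptyI finite.insertI)
  from finite_lists_length_eq[OF this, of m] show ?thesis
    by (simp add: sign_seqs_def)
qed

text \<open>The direction in which the octant of \<open>\<omega>\<close> is unbounded.\<close>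

definition octant_sign :: "nat \<Rightarrow> sign list \<Rightarrow> nat \<Rightarrow> int" where
  "octant_sign d1 \<omega> i =
    (if i < d1 then 1 else if i < d1 + length \<omega> then (case \<omega> ! (i - d1) of Plus \<Rightarrow> 1 | Minus \<Rightarrow> -1) else 0)"

definition octant_part :: "nat \<Rightarrow> sign list \<Rightarrow> point set" where
  "octant_part d1 \<omega> = {z \<in> lattice (d1 + length \<omega>).
    \<forall>i<d1 + length \<omega>. if octant_sign d1 \<omega> i = 1 then z i \<ge> 1 else z i \<le> 0}"

lemma octant_part_subset: "octant_part d1 \<omega> \<subseteq> domain d1 (length \<omega>)"
  by (auto simp: octant_part_def domain_def octant_sign_def split: if_splits)

lemma ypart_in_octant_iff:
  assumes z: "z \<in> octant_part d1 \<omega>" and len: "length \<omega>' = length \<omega>"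
  shows "ypart d1 z \<in> octant \<omega>' \<longleftrightarrow> \<omega>' = \<omega>"
proof -
  have mem: "z (d1 + j) \<in> half_line s \<longleftrightarrow> \<omega> ! j = s" if "j < length \<omega>" for j s
  proof -
    have "if octant_sign d1 \<omega> (d1 + j) = 1 then z (d1 + j) \<ge> 1 else z (d1 + j) \<le> 0"
      using z that by (simp add: octant_part_def)
    then show ?thesis
      using that by (cases s; cases "\<omega> ! j") (auto simp: octant_sign_def)
  qed
  have "ypart d1 z \<in> lattice (length \<omega>')"
    using z len by (auto simp: octant_part_def lattice_def ypart_def)
  then have "ypart d1 z \<in> octant \<omega>' \<longleftrightarrow> (\<forall>j<length \<omega>. \<omega> ! j = \<omega>' ! j)"
    using len by (auto simp: octant_def ypart_def mem)
  also have "\<dots> \<longleftrightarrow> \<omega>' = \<omega>"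
    using len by (metis nth_equalityI)
  finally show ?thesis .
qed

lemma octant_decomposition_eq:
  assumes dec: "octant_decomposition d1 (length \<omega>) F G" and z: "z \<in> octant_part d1 \<omega>"
  shows "F z = G \<omega> z"
proof -
  have "F z = (\<Sum>\<omega>'\<in>sign_seqs (length \<omega>). G \<omega>' z * indicator (octant \<omega>') (ypart d1 z))"
    using dec subsetD[OF octant_part_subset z] unfolding octant_decomposition_def by blast
  also have "\<dots> = (\<Sum>\<omega>'\<in>sign_seqs (length \<omega>). if \<omega>' = \<omega> then G \<omega> z else 0)"
    by (rule sum.cong) (auto simp: sign_seqs_def ypart_in_octant_iff[OF z])
  also have "\<dots> = G \<omega> z"
    using finite_sign_seqs by (simp add: sign_seqs_def)
  finally show ?thesis .
qed

text \<open>
  Every octant periodic function agrees at each point with one of its finitely many periodic components;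
  this is what bounds it.
\<close>

lemma domain_in_octant_part:
  assumes "z \<in> domain d1 d2"
  shows "\<exists>\<omega>\<in>sign_seqs d2. z \<in> octant_part d1 \<omega>"
proof -
  define \<omega> where "\<omega> = map (\<lambda>j. if z (d1 + j) \<ge> 1 then Plus else Minus) [0..<d2]"
  have "z \<in> octant_part d1 \<omega>"
    using assms by (auto simp: octant_part_def octant_sign_def domain_def \<omega>_def)
  moreover have "\<omega> \<in> sign_seqs d2"
    by (simp add: \<omega>_def sign_seqs_def)
  ultimately show ?thesis
    by blast
qed

lemma octant_decomposition_bounded:
  assumes "octant_decomposition d1 d2 F G"
  shows "\<exists>C\<ge>0. \<forall>z\<in>domain d1 d2. \<bar>F z\<bar> \<le> C"
proof -
  have "\<exists>C\<ge>0. \<forall>F\<in>G ` sign_seqs d2. \<forall>z\<in>lattice (d1 + d2). \<bar>F z\<bar> \<le> C"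
    using assms by (intro periodic_family_bounded finite_imageI finite_sign_seqs)
      (auto simp: octant_decomposition_def)
  then obtain C where C: "C \<ge> 0" "\<And>\<omega> z. \<omega> \<in> sign_seqs d2 \<Longrightarrow> z \<in> lattice (d1 + d2) \<Longrightarrow> \<bar>G \<omega> z\<bar> \<le> C"
    by auto
  have "\<bar>F z\<bar> \<le> C" if z: "z \<in> domain d1 d2" for z
  proof -
    obtain \<omega> where \<omega>: "\<omega> \<in> sign_seqs d2" "z \<in> octant_part d1 \<omega>"
      using domain_in_octant_part[OF z] by blast
    then show ?thesis
      using octant_decomposition_eq[of d1 \<omega> F G z] assms C(2)[of \<omega> z] z
      by (simp add: sign_seqs_def domain_def)
  qed
  then show ?thesis
    using C(1) by blast
qed

lemma common_coeff_bound:
  assumes "\<exists>C\<ge>0. \<forall>z\<in>S. \<bar>V z\<bar> \<le> C" "\<And>i. i < d \<Longrightarrow> \<exists>C\<ge>0. \<forall>z\<in>S. \<bar>a i z\<bar> \<le> C"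
  shows "\<exists>C\<ge>0. coeffs_bounded d S a V C"
proof -
  obtain C0 where C0: "C0 \<ge> 0" "\<forall>z\<in>S. \<bar>V z\<bar> \<le> C0"
    using assms(1) by blast
  obtain c where c: "\<And>i. i < d \<Longrightarrow> c i \<ge> 0 \<and> (\<forall>z\<in>S. \<bar>a i z\<bar> \<le> c i)"
    using assms(2) by metis
  have le: "c i \<le> C0 + (\<Sum>i<d. c i)" if "i < d" for i
    using that C0(1) c member_le_sum[of i "{..<d}" c] by force
  have "0 \<le> (\<Sum>i<d. c i)"
    using c by (intro sum_nonneg) auto
  moreover have "\<bar>a i z\<bar> \<le> C0 + (\<Sum>i<d. c i)" if "i < d" "z \<in> S" for i z
    using c[OF that(1)] le[OF that(1)] that(2) by force
  ultimately show ?thesis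
    unfolding coeffs_bounded_def using C0
    by (intro exI[of _ "C0 + (\<Sum>i<d. c i)"]) force
qed

lemma ell2_norm_off: "S \<subseteq> S' \<Longrightarrow> (\<And>z. z \<notin> S \<Longrightarrow> f z = 0) \<Longrightarrow> ell2_norm S f = ell2_norm S' f"
  unfolding ell2_norm_def by (rule arg_cong[where f = sqrt], rule infsum_cong_neutral) auto

text \<open>
  A finitely supported function moved by a large multiple of the period into the octant sees the
  operator \<open>H\<close> there exactly as it saw \<open>H\<^sub>\<omega>\<close> before.
\<close>

lemma translate_into_octant:
  fixes d1 :: nat and \<omega> :: "sign list"
  defines "d2 \<equiv> length \<omega>"
  defines "d \<equiv> d1 + d2"
  defines "D \<equiv> domain d1 d2"
  assumes d: "d \<ge> 1"
    and V: "octant_decomposition d1 d2 V V\<omega>"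
    and a: "\<And>i. i < d \<Longrightarrow> octant_decomposition d1 d2 (a i) (\<lambda>\<omega>. a\<omega> \<omega> i)"
    and F: "finite F" "F \<subseteq> lattice d" and f: "\<And>z. z \<notin> F \<Longrightarrow> f z = 0"
    and E: "finite E"
  shows "\<exists>g G. finite G \<and> G \<subseteq> D - E \<and> (\<forall>z. z \<notin> G \<longrightarrow> g z = 0) \<and>
    ell2_norm D g = ell2_norm (lattice d) f \<and>
    ell2_norm D (minus_scalar (jacobi_op d D a V) l g)
      = ell2_norm (lattice d) (minus_scalar (jacobi_op d (lattice d) (a\<omega> \<omega>) (V\<omega> \<omega>)) l f)"
proof -
  define sg where "sg = octant_sign d1 \<omega>"
  have \<omega>: "\<omega> \<in> sign_seqs d2"
    by (simp add: sign_seqs_def d2_def)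
  have sg: "sg i = 1 \<or> sg i = -1" if "i < d" for i
    using that by (auto simp: sg_def octant_sign_def d_def d2_def split: sign.split)
  have sg0: "sg i = 0" if "i \<ge> d" for i
    using that by (auto simp: sg_def octant_sign_def d_def d2_def)
  have "\<exists>P>0. \<forall>F\<in>insert (V\<omega> \<omega>) (a\<omega> \<omega> ` {..<d}). \<forall>i<d. \<forall>z\<in>lattice d. F (z(i := z i + int P)) = F z"
    using V a \<omega> by (intro common_period) (auto simp: octant_decomposition_def d_def)
  then obtain P where P: "P > 0"
    and PV: "\<And>i z. i < d \<Longrightarrow> z \<in> lattice d \<Longrightarrow> V\<omega> \<omega> (z(i := z i + int P)) = V\<omega> \<omega> z"
    and Pa: "\<And>j i z. j < d \<Longrightarrow> i < d \<Longrightarrow> z \<in> lattice d \<Longrightarrow> a\<omega> \<omega> j (z(i := z i + int P)) = a\<omega> \<omega> j z"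
    by auto
  define K where "K = (\<Sum>z\<in>F \<union> E. \<Sum>i<d. \<bar>z i\<bar>)"
  have K: "\<bar>z i\<bar> \<le> K" if "z \<in> F \<union> E" "i < d" for z i
  proof -
    have "\<bar>z i\<bar> \<le> (\<Sum>i<d. \<bar>z i\<bar>)"
      using that by (intro member_le_sum) auto
    also have "\<dots> \<le> K"
      unfolding K_def using that F(1) E by (intro member_le_sum) (auto intro: sum_nonneg)
    finally show ?thesis .
  qed
  define k where "k = 2 * K + 2"
  have K0: "K \<ge> 0"
    by (simp add: K_def sum_nonneg)
  have kP: "k * int P \<ge> 2 * K + 2"
    using P K0 mult_left_mono[of 1 "int P" k] by (simp add: k_def)
  define \<tau> where "\<tau> z = (\<lambda>i. z i + k * sg i * int P)" for z
  define \<rho> where "\<rho> z = (\<lambda>i. z i + - (k * sg i) * int P)" for z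
  have \<tau>\<rho>: "\<tau> (\<rho> z) = z" "\<rho> (\<tau> z) = z" for z
    by (auto simp: \<tau>_def \<rho>_def fun_eq_iff)
  have \<rho>_lattice: "\<rho> z \<in> lattice d \<longleftrightarrow> z \<in> lattice d" for z
    using sg0 by (auto simp: \<rho>_def lattice_def)
  have bij: "bij \<rho>"
    by (rule bij_betw_byWitness[where f' = \<tau>]) (auto simp: \<tau>\<rho>)
  have V\<rho>: "V\<omega> \<omega> (\<rho> z) = V\<omega> \<omega> z" if "z \<in> lattice d" for z
    unfolding \<rho>_def by (rule periodic_translate[OF PV that]) (auto simp: sg0)
  have a\<rho>: "a\<omega> \<omega> i (\<rho> z) = a\<omega> \<omega> i z" if "z \<in> lattice d" "i < d" for z i
    unfolding \<rho>_def by (rule periodic_translate[OF Pa[OF that(2)] that(1)]) (auto simp: sg0)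
  have \<rho>_upd: "\<rho> (z(i := z i + m)) = (\<rho> z)(i := \<rho> z i + m)" for z i m
    by (auto simp: \<rho>_def fun_eq_iff)
  have \<rho>_upd': "\<rho> (z(i := z i - m)) = (\<rho> z)(i := \<rho> z i - m)" for z i m
    by (auto simp: \<rho>_def fun_eq_iff)
  define Q where "Q = octant_part d1 \<omega>"
  have QD: "Q \<subseteq> D" "D \<subseteq> lattice d"
    using octant_part_subset[of d1 \<omega>] by (auto simp: Q_def D_def d2_def domain_def d_def)
  have Q_iff: "z \<in> Q \<longleftrightarrow> z \<in> lattice d \<and> (\<forall>i<d. if sg i = 1 then z i \<ge> 1 else z i \<le> 0)" for z
    by (simp add: Q_def octant_part_def d_def d2_def sg_def)
  define g where "g = f \<circ> \<rho>"
  define G where "G = \<tau> ` F"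
  have gG: "g z = 0" if "z \<notin> G" for z
    using that f[of "\<rho> z"] by (force simp: g_def G_def \<tau>\<rho> image_iff)
  have deep: "z(i := z i + m) \<in> Q" if z: "z \<in> G" and m: "\<bar>m\<bar> \<le> 1" and i: "i < d" for z i m
  proof -
    obtain w where w: "w \<in> F" "z = \<tau> w"
      using z by (auto simp: G_def)
    have "z \<in> lattice d"
      using w F(2) \<rho>_lattice[of z] by (auto simp: \<tau>\<rho>)
    moreover have "if sg j = 1 then z j \<ge> 2 else z j \<le> - 2" if "j < d" for j
      using sg[OF that] K[of w j] w that kP K0 by (auto simp: \<tau>_def)
    ultimately show ?thesis
      unfolding Q_iff using m i by (auto simp: lattice_def split: if_splits) (smt (verit))+
  qed
  have GQ: "G \<subseteq> Q"
    using deep[of _ 0 0] d by auto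
  have GE: "z \<notin> E" if z: "z \<in> G" for z
  proof
    assume "z \<in> E"
    obtain w where w: "w \<in> F" "z = \<tau> w"
      using z by (auto simp: G_def)
    show False
      using sg[of 0] K[of w 0] K[of z 0] d kP K0 w \<open>z \<in> E\<close> by (auto simp: \<tau>_def)
  qed
  define H where "H = jacobi_op d D a V"
  define T where "T = jacobi_op d (lattice d) (a\<omega> \<omega>) (V\<omega> \<omega>)"
  have VQ: "V z = V\<omega> \<omega> z" and aQ: "i < d \<Longrightarrow> a i z = a\<omega> \<omega> i z" if "z \<in> Q" for z i
    using that octant_decomposition_eq[of d1 \<omega> V V\<omega> z] V
      octant_decomposition_eq[of d1 \<omega> "a i" "\<lambda>\<omega>. a\<omega> \<omega> i" z] a[of i]
    by (simp_all add: Q_def d2_def)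
  have HT: "H g z = T f (\<rho> z)" for z
  proof (cases "z \<in> lattice d")
    case False
    then show ?thesis
      using QD(2) \<rho>_lattice[of z] by (auto simp: H_def T_def jacobi_op_def)
  next
    case True
    have fg: "f (\<rho> w) = g w" for w
      by (simp add: g_def)
    have T_eq: "T f (\<rho> z) =
        (\<Sum>i<d. of_real (a\<omega> \<omega> i (z(i := z i - 1))) * g (z(i := z i - 1))
              + of_real (a\<omega> \<omega> i z) * g (z(i := z i + 1))) + of_real (V\<omega> \<omega> z) * g z"
    proof -
      have low: "z(i := z i - 1) \<in> lattice d" if "i < d" for i
        using True that by (auto simp: lattice_def)
      have "T f (\<rho> z) =
        (\<Sum>i<d. of_real (a\<omega> \<omega> i (\<rho> (z(i := z i - 1)))) * f (\<rho> (z(i := z i - 1)))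
              + of_real (a\<omega> \<omega> i (\<rho> z)) * f (\<rho> (z(i := z i + 1)))) + of_real (V\<omega> \<omega> (\<rho> z)) * f (\<rho> z)"
        using True unfolding T_def jacobi_op_def \<rho>_lattice \<rho>_upd \<rho>_upd' by simp
      also have "\<dots> = (\<Sum>i<d. of_real (a\<omega> \<omega> i (z(i := z i - 1))) * g (z(i := z i - 1))
              + of_real (a\<omega> \<omega> i z) * g (z(i := z i + 1))) + of_real (V\<omega> \<omega> z) * g z"
        unfolding fg V\<rho>[OF True]
        by (intro arg_cong2[of _ _ _ _ "(+)"] sum.cong refl) (auto simp: a\<rho>[OF True] a\<rho>[OF low])
      finally show ?thesis .
    qed
    show ?thesis
    proof (cases "z \<in> Q")
      case zQ: True
      have low: "of_real (a i (z(i := z i - 1))) * g (z(i := z i - 1))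
          = of_real (a\<omega> \<omega> i (z(i := z i - 1))) * g (z(i := z i - 1))" if "i < d" for i
        using aQ[of "z(i := z i - 1)" i] gG[of "z(i := z i - 1)"] GQ that by (cases "z(i := z i - 1) \<in> G") auto
      have zD: "z \<in> D"
        using zQ QD by blast
      show ?thesis
        unfolding T_eq H_def jacobi_op_def using zD
        by (simp add: VQ[OF zQ] aQ[OF zQ] low)
    next
      case zQ: False
      have gz: "g z = 0"
        using zQ GQ gG by blast
      have up: "g (z(i := z i + 1)) = 0" if "i < d" for i
      proof (rule gG, rule notI)
        assume "z(i := z i + 1) \<in> G"
        from deep[OF this, of "-1" i] that zQ show False
          by simp
      qed
      have down: "g (z(i := z i - 1)) = 0" if "i < d" for i
      proof (rule gG, rule notI)
        assume "z(i := z i - 1) \<in> G"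
        from deep[OF this, of 1 i] that zQ show False
          by simp
      qed
      show ?thesis
        unfolding T_eq H_def jacobi_op_def by (simp add: gz up down)
    qed
  qed
  have transfer: "ell2_norm D h = ell2_norm (lattice d) u"
    if h: "\<And>z. h z = u (\<rho> z)" and hD: "\<And>z. z \<notin> D \<Longrightarrow> h z = 0" for h u
  proof -
    have u: "u w = 0" if "w \<notin> lattice d" for w
      using h[of "\<tau> w"] hD[of "\<tau> w"] QD(2) that \<rho>_lattice[of "\<tau> w"] by (auto simp: \<tau>\<rho>)
    have "ell2_norm D h = ell2_norm UNIV (\<lambda>z. u (\<rho> z))"
    proof -
      have "h = (\<lambda>z. u (\<rho> z))"
        using h by (rule ext)
      then show ?thesis
        using ell2_norm_off[of D UNIV h] hD by blast
    qed
    also have "\<dots> = ell2_norm UNIV u"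
      unfolding ell2_norm_def using infsum_reindex_bij_betw[OF bij, of "\<lambda>z. (cmod (u z))\<^sup>2"] by simp
    also have "\<dots> = ell2_norm (lattice d) u"
      by (rule ell2_norm_off[symmetric]) (auto simp: u)
    finally show ?thesis .
  qed
  have "ell2_norm D g = ell2_norm (lattice d) f"
    using gG GQ QD by (intro transfer) (auto simp: g_def)
  moreover have "ell2_norm D (minus_scalar H l g) = ell2_norm (lattice d) (minus_scalar T l f)"
  proof (rule transfer)
    show "minus_scalar H l g z = minus_scalar T l f (\<rho> z)" for z
      unfolding minus_scalar_def HT by (simp add: g_def)
    show "minus_scalar H l g z = 0" if "z \<notin> D" for z
    proof -
      have "g z = 0"
        using gG GQ QD that by blast
      then show ?thesis
        using that by (simp add: minus_scalar_def H_def jacobi_op_def)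
    qed
  qed
  moreover have "finite G" "G \<subseteq> D - E"
    using F(1) GQ QD GE by (auto simp: G_def)
  ultimately show ?thesis
    unfolding H_def T_def using gG by (intro exI[of _ g] exI[of _ G]) auto
qed

text \<open>
  Approximate eigenvectors of \<open>H\<^sub>\<omega>\<close>, cut off to finite support and moved into the octant one after the
  other beyond all supports used before, are a Weyl sequence of \<open>H\<close>.
\<close>

lemma octant_spectrum_subset_ess_spectrum:
  assumes d: "d1 + d2 \<ge> 1" and \<omega>: "\<omega> \<in> sign_seqs d2"
    and V: "octant_decomposition d1 d2 V V\<omega>"
    and a: "\<And>i. i < d1 + d2 \<Longrightarrow> octant_decomposition d1 d2 (a i) (\<lambda>\<omega>. a\<omega> \<omega> i)"
  shows "spectrum (lattice (d1 + d2)) (jacobi_op (d1 + d2) (lattice (d1 + d2)) (a\<omega> \<omega>) (V\<omega> \<omega>))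
    \<subseteq> ess_spectrum (domain d1 d2) (jacobi_op (d1 + d2) (domain d1 d2) a V)"
proof
  define d where "d = d1 + d2"
  define D where "D = domain d1 d2"
  define H where "H = jacobi_op d D a V"
  define T where "T = jacobi_op d (lattice d) (a\<omega> \<omega>) (V\<omega> \<omega>)"
  have len: "length \<omega> = d2"
    using \<omega> by (simp add: sign_seqs_def)
  fix l assume "l \<in> spectrum (lattice (d1 + d2)) (jacobi_op (d1 + d2) (lattice (d1 + d2)) (a\<omega> \<omega>) (V\<omega> \<omega>))"
  then have l: "l \<in> spectrum (lattice d) T"
    by (simp add: d_def T_def)
  obtain C where "C \<ge> 0" "coeffs_bounded d (lattice d) (a\<omega> \<omega>) (V\<omega> \<omega>) C"
    using common_coeff_bound[of "lattice d" "V\<omega> \<omega>" d "a\<omega> \<omega>"] periodic_bounded V a \<omega>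
    by (force simp: octant_decomposition_def d_def)
  then interpret T: bounded_symmetric "lattice d" T "(2 * real d + 1) * C"
    unfolding T_def by (rule jacobi_op_bounded_symmetric)
  obtain C' where "C' \<ge> 0" "coeffs_bounded d D a V C'"
    using common_coeff_bound[of D V d a] octant_decomposition_bounded[OF V] octant_decomposition_bounded[OF a]
    by (auto simp: d_def D_def)
  then interpret H: bounded_symmetric D H "(2 * real d + 1) * C'"
    unfolding H_def by (rule jacobi_op_bounded_symmetric)
  define good where "good n E gG \<longleftrightarrow> finite (snd gG) \<and> snd gG \<subseteq> D - E \<and>
      (\<forall>z. z \<notin> snd gG \<longrightarrow> fst gG z = 0) \<and> ell2_norm D (fst gG) = 1 \<and>
      ell2_norm D (minus_scalar H l (fst gG)) \<le> (1 / 4) ^ n"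
    for n :: nat and E and gG :: "(point \<Rightarrow> complex) \<times> point set"
  have "\<exists>gG. good n E gG" if E: "finite E" for n E
  proof -
    obtain f F where F: "finite F" "F \<subseteq> lattice d" "\<And>z. z \<notin> F \<Longrightarrow> f z = 0"
      and f: "ell2_norm (lattice d) f = 1" "ell2_norm (lattice d) (T.shifted l f) \<le> (1 / 4) ^ n"
      using T.approximate_eigenvector[OF l, of "(1 / 4) ^ n"] by auto
    obtain g G where "finite G" "G \<subseteq> D - E" "\<forall>z. z \<notin> G \<longrightarrow> g z = 0"
      "ell2_norm D g = ell2_norm (lattice d) f"
      "ell2_norm D (minus_scalar H l g) = ell2_norm (lattice d) (T.shifted l f)"
      using translate_into_octant[of d1 \<omega> V V\<omega> a a\<omega> F f E l] d V a F E
      unfolding len d_def[symmetric] D_def[symmetric] H_def[symmetric] T_def[symmetric] by auto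
    then have "good n E (g, G)"
      using f by (simp add: good_def)
    then show ?thesis
      by blast
  qed
  then have "\<forall>n E. \<exists>gG. finite E \<longrightarrow> good n E gG"
    by blast
  then obtain nxt where nxt: "\<And>n E. finite E \<Longrightarrow> good n E (nxt n E)"
    by metis
  define U where "U = rec_nat {} (\<lambda>n E. E \<union> snd (nxt n E))"
  have U_Suc: "U (Suc n) = U n \<union> snd (nxt n (U n))" for n
    by (simp add: U_def)
  have U_fin: "finite (U n)" for n
  proof (induction n)
    case (Suc n)
    then show ?case
      using nxt[OF Suc, of n] by (simp add: U_Suc good_def)
  qed (simp add: U_def)
  define g where "g n = fst (nxt n (U n))" for n
  define G where "G n = snd (nxt n (U n))" for n
  have good: "good n (U n) (g n, G n)" for n
    using nxt[OF U_fin] by (simp add: g_def G_def)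
  have G: "finite (G n)" "G n \<subseteq> D" "\<And>z. z \<notin> G n \<Longrightarrow> g n z = 0" for n
    using good[of n] by (auto simp: good_def)
  have U_mono: "G m \<subseteq> U n" if "m < n" for m n
    using that by (induction n) (auto simp: U_Suc G_def less_Suc_eq)
  have disj: "G m \<inter> G n = {}" if "m \<noteq> n" for m n
    using that good[of m] good[of n] U_mono[of m n] U_mono[of n m]
    by (cases "m < n") (auto simp: good_def)
  have "l \<in> ess_spectrum D H"
  proof (rule H.weyl_sequence_imp_ess_spectrum)
    show "g n \<in> ell2 D" for n
      by (rule ell2_finite_support(1)[OF G])
    show "ell2_norm D (g n) = 1" "ell2_norm D (H.shifted l (g n)) \<le> (1 / 4) ^ n" for n
      using good[of n] by (auto simp: good_def)
    show "ell2_inner D (g m) (g n) = 0" if "m \<noteq> n" for m n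
    proof -
      have "cnj (g m z) * g n z = 0" if "z \<in> G m" for z
        using G(3)[of z n] disj[OF \<open>m \<noteq> n\<close>] that by auto
      then show ?thesis
        by (subst ell2_inner_finite_support[OF G(1)[of m] G(2)[of m] G(3)]) (auto intro: sum.neutral)
    qed
  qed
  then show "l \<in> ess_spectrum (domain d1 d2) (jacobi_op (d1 + d2) (domain d1 d2) a V)"
    by (simp add: D_def H_def d_def)
qed

section \<open>Algebraic symmetric operators\<close>

text \<open>
  \<open>p(T) f\<close> by Horner's scheme.
\<close>

definition poly_op :: "complex poly \<Rightarrow> 'a operator \<Rightarrow> 'a operator" where
  "poly_op p T f = fold_coeffs (\<lambda>c g. (\<lambda>z. c * f z + T g z)) p (\<lambda>z. 0)"

lemma poly_op_0 [simp]: "poly_op 0 T f = (\<lambda>z. 0)"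
  by (simp add: poly_op_def)

lemma poly_op_pCons:
  assumes "clinear_op T"
  shows "poly_op (pCons c p) T f = (\<lambda>z. c * f z + T (poly_op p T f) z)"
proof (cases "c = 0 \<and> p = 0")
  case True
  then show ?thesis
    by (simp add: clinear_op_simps[OF assms])
next
  case False
  then show ?thesis
    by (auto simp: poly_op_def)
qed

context
  fixes T :: "'a operator"
  assumes T: "clinear_op T"
begin

lemma poly_op_linear: "clinear_op (poly_op p T)"
proof (induction p)
  case 0
  then show ?case
    by (simp add: clinear_op_def)
next
  case (pCons c p)
  show ?case
    by (auto simp: clinear_op_def poly_op_pCons[OF T] clinear_op_simps[OF pCons.IH]
        clinear_op_simps[OF T] algebra_simps fun_eq_iff)
qed

lemma poly_op_commute:
  assumes U: "clinear_op U" and UT: "\<And>f. U (T f) = T (U f)"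
  shows "U (poly_op p T f) = poly_op p T (U f)"
  by (induction p) (simp_all add: poly_op_pCons[OF T] clinear_op_simps[OF U] UT)

lemma poly_op_add: "poly_op (p + q) T f = (\<lambda>z. poly_op p T f z + poly_op q T f z)"
proof (induction p arbitrary: q)
  case (pCons c p)
  show ?case
  proof (cases q)
    case q: (pCons d q')
    have "poly_op (pCons c p + q) T f = (\<lambda>z. (c + d) * f z + T (poly_op (p + q') T f) z)"
      by (simp add: q poly_op_pCons[OF T])
    also have "\<dots> = (\<lambda>z. (c + d) * f z + (T (poly_op p T f) z + T (poly_op q' T f) z))"
      by (simp only: pCons.IH clinear_op_simps(2)[OF T])
    finally show ?thesis
      by (simp add: q poly_op_pCons[OF T] algebra_simps)
  qed
qed simp

lemma poly_op_smult: "poly_op (smult c p) T f = (\<lambda>z. c * poly_op p T f z)"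
  by (induction p) (simp_all add: poly_op_pCons[OF T] clinear_op_simps[OF T] algebra_simps)

lemma poly_op_mult: "poly_op (p * q) T f = poly_op p T (poly_op q T f)"
  by (induction p) (simp_all add: poly_op_pCons[OF T] poly_op_add poly_op_smult)

lemma poly_op_1 [simp]: "poly_op 1 T f = f"
  unfolding one_pCons by (simp add: poly_op_pCons[OF T] clinear_op_simps[OF T])

end

definition eigen_family :: "'a set \<Rightarrow> 'a operator \<Rightarrow> real set \<Rightarrow> (real \<Rightarrow> 'a \<Rightarrow> complex) \<Rightarrow> bool" where
  "eigen_family S T R g \<longleftrightarrow> (\<forall>r\<in>R. g r \<in> ell2 S \<and> T (g r) = (\<lambda>z. of_real r * g r z))"

definition eigen_decomposable :: "'a set \<Rightarrow> 'a operator \<Rightarrow> real set \<Rightarrow> bool" where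
  "eigen_decomposable S T R \<longleftrightarrow> finite R \<and>
    (\<forall>f\<in>ell2 S. \<exists>g. eigen_family S T R g \<and> f = (\<lambda>z. \<Sum>r\<in>R. g r z))"

lemma eigen_decomposable_affine:
  assumes R: "eigen_decomposable S T R" and s: "s \<noteq> 0"
    and U: "\<And>f. f \<in> ell2 S \<Longrightarrow> U f = (\<lambda>z. of_real s * T f z + of_real m * f z)"
  shows "eigen_decomposable S U ((\<lambda>r. s * r + m) ` R)"
  unfolding eigen_decomposable_def
proof (intro conjI ballI)
  show "finite ((\<lambda>r. s * r + m) ` R)"
    using R by (simp add: eigen_decomposable_def)
  fix f assume f: "f \<in> ell2 S"
  obtain g where g: "eigen_family S T R g" "f = (\<lambda>z. \<Sum>r\<in>R. g r z)"
    using R f by (auto simp: eigen_decomposable_def)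
  define h where "h q = g ((q - m) / s)" for q
  have h: "h (s * r + m) = g r" for r
    using s by (simp add: h_def)
  have inj: "inj_on (\<lambda>r. s * r + m) R"
    using s by (auto simp: inj_on_def)
  have "eigen_family S U ((\<lambda>r. s * r + m) ` R) h"
    using g(1) by (auto simp: eigen_family_def h U distrib_right mult.assoc)
  moreover have "f = (\<lambda>z. \<Sum>r\<in>(\<lambda>r. s * r + m) ` R. h r z)"
    by (simp add: sum.reindex[OF inj] h g(2))
  ultimately show "\<exists>h. eigen_family S U ((\<lambda>r. s * r + m) ` R) h \<and>
      f = (\<lambda>z. \<Sum>r\<in>(\<lambda>r. s * r + m) ` R. h r z)"
    by blast
qed

context bounded_symmetric
begin

lemma eigenvectors_orthogonal:
  assumes f: "f \<in> ell2 S" "T f = (\<lambda>z. of_real r * f z)"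
    and g: "g \<in> ell2 S" "T g = (\<lambda>z. of_real s * g z)" and "r \<noteq> s"
  shows "ell2_inner S f g = 0"
proof -
  have "of_real r * ell2_inner S f g = ell2_inner S (T f) g"
    by (simp add: f(2) ell2_inner_scale_left)
  also have "\<dots> = ell2_inner S f (T g)"
    by (rule symmetric[OF f(1) g(1)])
  also have "\<dots> = of_real s * ell2_inner S f g"
    by (simp add: g(2) ell2_inner_scale_right)
  finally show ?thesis
    using \<open>r \<noteq> s\<close> by simp
qed

lemma eigen_family_inner_sum:
  assumes g: "eigen_family S T R g" and h: "eigen_family S T R h" and R: "finite R" and r: "r \<in> R"
  shows "ell2_inner S (g r) (\<lambda>z. \<Sum>s\<in>R. c s * h s z) = c r * ell2_inner S (g r) (h r)"
proof -
  have "ell2_inner S (g r) (\<lambda>z. \<Sum>s\<in>R. c s * h s z) = (\<Sum>s\<in>R. ell2_inner S (g r) (\<lambda>z. c s * h s z))"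
    using g h r by (intro ell2_inner_sum_right ell2_scale) (auto simp: eigen_family_def)
  also have "\<dots> = (\<Sum>s\<in>R. if s = r then c r * ell2_inner S (g r) (h r) else 0)"
    using eigenvectors_orthogonal[of "g r" r] g h r
    by (intro sum.cong) (auto simp: eigen_family_def ell2_inner_scale_right)
  also have "\<dots> = c r * ell2_inner S (g r) (h r)"
    using R r by simp
  finally show ?thesis .
qed

lemma eigen_family_sum_eq_0:
  assumes g: "eigen_family S T R g" and R: "finite R" and zero: "\<And>z. (\<Sum>r\<in>R. g r z) = 0" and r: "r \<in> R"
  shows "g r = 0"
proof -
  have "ell2_inner S (g r) (g r) = ell2_inner S (g r) (\<lambda>z. \<Sum>s\<in>R. 1 * g s z)"
    using eigen_family_inner_sum[OF g g R r, of "\<lambda>s. 1"] by simp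
  also have "\<dots> = 0"
    by (simp add: zero)
  finally have "ell2_norm S (g r) = 0"
    using g r by (simp add: ell2_inner_self eigen_family_def)
  then show ?thesis
    using ell2_norm_eq_0D g r by (auto simp: eigen_family_def)
qed

lemma eigen_family_diff:
  "eigen_family S T R g \<Longrightarrow> eigen_family S T R h \<Longrightarrow> eigen_family S T R (\<lambda>r z. g r z - h r z)"
  by (auto simp: eigen_family_def clinear_op_simps[OF linear] ell2_minus algebra_simps)

lemma eigen_family_unique:
  assumes "eigen_family S T R g" "eigen_family S T R h" "finite R"
    and "(\<lambda>z. \<Sum>r\<in>R. g r z) = (\<lambda>z. \<Sum>r\<in>R. h r z)" "r \<in> R"
  shows "g r = h r"
proof -
  have "(\<lambda>z. g r z - h r z) = 0"
    using assms
    by (intro eigen_family_sum_eq_0[OF eigen_family_diff]) (auto simp: sum_subtractf fun_eq_iff)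
  then show ?thesis
    by (auto simp: fun_eq_iff)
qed

text \<open>
  A symmetric operator annihilated by a nonzero polynomial is diagonalizable. Removing one root \<open>x\<close>
  of the polynomial leaves \<open>(T - x) f\<close> decomposed; dividing its components by \<open>r - x\<close> decomposes \<open>f\<close> up
  to a vector \<open>u\<close> with \<open>(T - x)\<^sup>2 u = 0\<close>, and symmetry improves this to \<open>(T - x) u = 0\<close> for real \<open>x\<close>
  and to \<open>u = 0\<close> otherwise.
\<close>

lemma annihilated_imp_eigen_decomposable:
  assumes p: "p \<noteq> 0" and ann: "\<And>f. f \<in> ell2 S \<Longrightarrow> poly_op p T f = (\<lambda>z. 0)"
  shows "\<exists>R. eigen_decomposable S T R"
proof -
  obtain A where A: "p = smult (lead_coeff p) (\<Prod>x\<in>#A. [:-x, 1:])"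
    using alg_closed_imp_factorization[OF p] by blast
  define R where "R = Re ` set_mset A"
  have R: "finite R"
    by (simp add: R_def)
  have dec: "\<exists>g. eigen_family S T R g \<and> f = (\<lambda>z. \<Sum>r\<in>R. g r z)"
    if "Re ` set_mset B \<subseteq> R" "f \<in> ell2 S" "poly_op (\<Prod>x\<in>#B. [:-x, 1:]) T f = (\<lambda>z. 0)" for B f
    using that
  proof (induction B arbitrary: f)
    case empty
    then have "f = (\<lambda>z. 0)"
      by (simp add: linear)
    then show ?case
      by (intro exI[of _ "\<lambda>r z. 0"]) (auto simp: eigen_family_def clinear_op_simps[OF linear])
  next
    case (add x B)
    note f = add.prems(2)
    define h where "h = (\<lambda>z. T f z - x * f z)"
    have hS: "h \<in> ell2 S"
      unfolding h_def by (intro ell2_minus ell2_scale maps f)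
    have "poly_op [:-x, 1:] T f = h"
      by (simp add: poly_op_pCons[OF linear] clinear_op_simps[OF linear] h_def)
    then have "poly_op (\<Prod>x\<in>#B. [:-x, 1:]) T h = (\<lambda>z. 0)"
      using add.prems(3) by (simp add: poly_op_mult[OF linear] mult.commute[of "[:-x, 1:]"] del: mult_pCons_left mult_pCons_right)
    from add.IH[OF _ hS this] add.prems(1) obtain g
      where g: "eigen_family S T R g" "h = (\<lambda>z. \<Sum>r\<in>R. g r z)"
      by auto
    have gS: "g r \<in> ell2 S" "T (g r) = (\<lambda>z. of_real r * g r z)" if "r \<in> R" for r
      using g(1) that by (auto simp: eigen_family_def)
    define R' where "R' = {r \<in> R. of_real r \<noteq> x}"
    have R': "finite R'" "R' \<subseteq> R"
      using R by (auto simp: R'_def)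
    define u where "u = (\<lambda>z. f z - (\<Sum>r\<in>R'. inverse (of_real r - x) * g r z))"
    have uS: "u \<in> ell2 S"
      unfolding u_def using R'(2) gS by (intro ell2_minus ell2_sum ell2_scale f) auto
    have Tu: "T u z - x * u z = (if Re x \<in> R - R' then g (Re x) z else 0)" for z
    proof -
      have "T u z - x * u z = h z - (\<Sum>r\<in>R'. inverse (of_real r - x) * (of_real r * g r z) - x * (inverse (of_real r - x) * g r z))"
      proof -
        have "T (\<lambda>z. \<Sum>r\<in>R'. inverse (of_real r - x) * g r z) z
            = (\<Sum>r\<in>R'. inverse (of_real r - x) * (of_real r * g r z))"
          unfolding clinear_op_sum[OF linear] using R'(2) gS(2) by (intro sum.cong) auto
        then have "T u z = T f z - (\<Sum>r\<in>R'. inverse (of_real r - x) * (of_real r * g r z))"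
          by (simp only: u_def clinear_op_simps(5)[OF linear])
        then show ?thesis
          by (simp add: u_def h_def sum_subtractf sum_distrib_left right_diff_distrib)
      qed
      also have "(\<Sum>r\<in>R'. inverse (of_real r - x) * (of_real r * g r z) - x * (inverse (of_real r - x) * g r z)) = (\<Sum>r\<in>R'. g r z)"
      proof (rule sum.cong[OF refl])
        fix r assume "r \<in> R'"
        then have "of_real r - x \<noteq> 0"
          by (auto simp: R'_def)
        then have "inverse (of_real r - x) * (of_real r - x) = 1"
          by simp
        then show "inverse (of_real r - x) * (of_real r * g r z) - x * (inverse (of_real r - x) * g r z) = g r z"
          by (metis (no_types, opaque_lifting) left_diff_distrib mult.assoc mult.left_commute mult_1 right_diff_distrib)
      qed
      also have "h z - (\<Sum>r\<in>R'. g r z) = (\<Sum>r\<in>R - R'. g r z)"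
        using R R' by (simp add: g(2) sum_diff)
      also have "R - R' = (if Re x \<in> R - R' then {Re x} else {})"
        by (auto simp: R'_def)
      finally show ?thesis
        by (simp split: if_splits)
    qed
    have Tu0: "T u = (\<lambda>z. x * u z)"
    proof (cases "Re x \<in> R - R'")
      case True
      define k where "k = g (Re x)"
      have x: "x = of_real (Re x)"
        using True by (simp add: R'_def)
      have k: "k \<in> ell2 S" "T k = (\<lambda>z. x * k z)"
        using gS[of "Re x"] True x by (auto simp: k_def)
      have eq: "k = (\<lambda>z. T u z - x * u z)"
        using True Tu by (simp add: k_def)
      have "ell2_inner S k k = ell2_inner S k (T u) - x * ell2_inner S k u"
        using k(1) uS maps[OF uS]
        by (subst (2) eq) (simp add: ell2_inner_minus_right ell2_scale ell2_inner_scale_right)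
      also have "ell2_inner S k (T u) = ell2_inner S (T k) u"
        by (rule symmetric[OF k(1) uS, symmetric])
      also have "\<dots> = cnj x * ell2_inner S k u"
        by (simp add: k(2) ell2_inner_scale_left)
      also have "cnj x = x"
        by (subst (1 2) x) simp
      finally have "ell2_norm S k = 0"
        using ell2_inner_self[OF k(1)] by simp
      then have "k = 0"
        using ell2_norm_eq_0D k(1) by blast
      then show ?thesis
        using eq by (auto simp: fun_eq_iff)
    next
      case False
      then show ?thesis
        using Tu by (auto simp: fun_eq_iff)
    qed
    have u0: "u = (\<lambda>z. 0)" if "Re x \<notin> R - R'"
    proof -
      have "Re x \<in> R"
        using add.prems(1) by auto
      then have "of_real (Re x) \<noteq> x"
        using that by (auto simp: R'_def)
      then have "cnj x \<noteq> x"
        by (metis Reals_cnj_iff of_real_Re)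
      moreover have "cnj x * ell2_inner S u u = x * ell2_inner S u u"
        using symmetric[OF uS uS] by (simp add: Tu0 ell2_inner_scale_left ell2_inner_scale_right)
      ultimately have "ell2_norm S u = 0"
        using ell2_inner_self[OF uS] by simp
      then show ?thesis
        using ell2_norm_eq_0D[OF uS] by (simp add: zero_fun_def)
    qed
    define g' where "g' r = (if r \<in> R' then (\<lambda>z. inverse (of_real r - x) * g r z) else u)" for r
    have "eigen_family S T R g'"
      unfolding eigen_family_def
    proof
      fix r assume r: "r \<in> R"
      show "g' r \<in> ell2 S \<and> T (g' r) = (\<lambda>z. of_real r * g' r z)"
      proof (cases "r \<in> R'")
        case True
        then show ?thesis
          using gS[OF r] by (simp add: g'_def ell2_scale clinear_op_simps[OF linear] mult.left_commute)
      next
        case False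
        then have "of_real r = x"
          using r by (simp add: R'_def)
        then show ?thesis
          using uS Tu0 False by (simp add: g'_def)
      qed
    qed
    moreover have "f z = (\<Sum>r\<in>R. g' r z)" for z
    proof -
      have "(\<Sum>r\<in>R. g' r z) = (\<Sum>r\<in>R'. g' r z) + (\<Sum>r\<in>R - R'. g' r z)"
        using R R'(2) by (simp add: sum.subset_diff)
      also have "(\<Sum>r\<in>R'. g' r z) = (\<Sum>r\<in>R'. inverse (of_real r - x) * g r z)"
        by (rule sum.cong) (auto simp: g'_def)
      also have "(\<Sum>r\<in>R - R'. g' r z) = u z"
      proof (cases "Re x \<in> R - R'")
        case True
        then have "R - R' = {Re x}"
          by (auto simp: R'_def)
        moreover have "Re x \<notin> R'"
          using True by simp
        ultimately show ?thesis
          by (simp add: g'_def)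
      next
        case False
        have "R - R' = (if Re x \<in> R - R' then {Re x} else {})"
          by (auto simp: R'_def)
        with False have "R - R' = {}"
          by simp
        then show ?thesis
          using u0[OF False] by (simp only: sum.empty)
      qed
      finally show ?thesis
        by (simp add: u_def)
    qed
    ultimately show ?case
      by blast
  qed
  have "lead_coeff p \<noteq> 0"
    using p by simp
  then have "poly_op (\<Prod>x\<in>#A. [:-x, 1:]) T f = (\<lambda>z. 0)" if "f \<in> ell2 S" for f
  proof -
    have "(\<lambda>z. lead_coeff p * poly_op (\<Prod>x\<in>#A. [:-x, 1:]) T f z) = (\<lambda>z. 0)"
      using ann[OF that] A poly_op_smult[OF linear] by metis
    then show ?thesis
      using \<open>lead_coeff p \<noteq> 0\<close> by (auto simp: fun_eq_iff)
  qed
  then have "eigen_decomposable S T R"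
    unfolding eigen_decomposable_def using dec[of A] R by (auto simp: R_def)
  then show ?thesis
    by blast
qed

text \<open>
  Decompose \<open>f\<close> for \<open>U\<close> and each component for \<open>T\<close>. As \<open>U\<close> commutes with \<open>T\<close>, it maps the second
  decomposition of a \<open>U\<close>-eigenvector to a decomposition of its multiple; by uniqueness the parts are
  eigenvectors of \<open>U\<close> as well.
\<close>

lemma eigen_decomposable_commuting_sum:
  assumes R: "eigen_decomposable S T R" and Q: "eigen_decomposable S U Q"
    and U: "clinear_op U" "\<And>f. f \<in> ell2 S \<Longrightarrow> U f \<in> ell2 S"
    and comm: "\<And>f. f \<in> ell2 S \<Longrightarrow> U (T f) = T (U f)"
  shows "eigen_decomposable S (\<lambda>f z. T f z + U f z) ((\<lambda>(r, q). r + q) ` (R \<times> Q))"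
proof -
  define RQ where "RQ = (\<lambda>(r, q). r + q) ` (R \<times> Q)"
  have fin: "finite R" "finite Q"
    using R Q by (auto simp: eigen_decomposable_def)
  have "\<exists>k. eigen_family S (\<lambda>f z. T f z + U f z) RQ k \<and> f = (\<lambda>z. \<Sum>s\<in>RQ. k s z)" if f: "f \<in> ell2 S" for f
  proof -
    obtain g where g: "eigen_family S U Q g" "f = (\<lambda>z. \<Sum>q\<in>Q. g q z)"
      using Q f by (auto simp: eigen_decomposable_def)
    have "\<exists>h. eigen_family S T R h \<and> g q = (\<lambda>z. \<Sum>r\<in>R. h r z)" if "q \<in> Q" for q
      using R g(1) that by (auto simp: eigen_decomposable_def eigen_family_def)
    then obtain h where h: "\<And>q. q \<in> Q \<Longrightarrow> eigen_family S T R (h q)"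
      "\<And>q. q \<in> Q \<Longrightarrow> g q = (\<lambda>z. \<Sum>r\<in>R. h q r z)"
      by metis
    have hS: "h q r \<in> ell2 S" "T (h q r) = (\<lambda>z. of_real r * h q r z)" if "q \<in> Q" "r \<in> R" for q r
      using h(1)[OF that(1)] that(2) by (auto simp: eigen_family_def)
    have Uh: "U (h q r) = (\<lambda>z. of_real q * h q r z)" if q: "q \<in> Q" and r: "r \<in> R" for q r
    proof -
      define w where "w r = (\<lambda>z. U (h q r) z - of_real q * h q r z)" for r
      have "T (w r) = (\<lambda>z. of_real r * w r z)" if "r \<in> R" for r
      proof -
        have "T (w r) = (\<lambda>z. T (U (h q r)) z - of_real q * T (h q r) z)"
          by (simp only: w_def clinear_op_simps(4,5)[OF linear])
        also have "T (U (h q r)) = (\<lambda>z. of_real r * U (h q r) z)"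
          by (simp only: comm[OF hS(1)[OF q that], symmetric] hS(2)[OF q that] clinear_op_simps(4)[OF U(1)])
        finally show ?thesis
          by (simp add: hS(2)[OF q that] w_def algebra_simps)
      qed
      then have "eigen_family S T R w"
        using hS(1)[OF q] by (auto simp: eigen_family_def w_def intro!: ell2_minus ell2_scale U(2))
      moreover have "(\<Sum>r\<in>R. w r z) = 0" for z
      proof -
        have "(\<Sum>r\<in>R. w r z) = U (g q) z - of_real q * g q z"
          using clinear_op_sum[OF U(1), of "\<lambda>r. 1" "h q" R]
          by (simp add: w_def h(2)[OF q] sum_subtractf sum_distrib_left)
        then show ?thesis
          using g(1) q by (simp add: eigen_family_def)
      qed
      ultimately have "w r = 0"
        using eigen_family_sum_eq_0 fin(1) r by blast
      then show ?thesis
        by (auto simp: w_def fun_eq_iff)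
    qed
    define k where "k s = (\<lambda>z. \<Sum>x\<in>{x \<in> R \<times> Q. fst x + snd x = s}. h (snd x) (fst x) z)" for s
    have "eigen_family S (\<lambda>f z. T f z + U f z) RQ k"
      unfolding eigen_family_def
    proof
      fix s
      have lin: "L (k s) = (\<lambda>z. \<Sum>x\<in>{x \<in> R \<times> Q. fst x + snd x = s}. L (h (snd x) (fst x)) z)"
        if "clinear_op L" for L
        unfolding k_def using clinear_op_sum[OF that, of "\<lambda>x. 1"] by simp
      have "k s \<in> ell2 S"
        unfolding k_def by (intro ell2_sum hS) auto
      moreover have "T (k s) z + U (k s) z = of_real s * k s z" for z
        unfolding lin[OF linear] lin[OF U(1)] sum.distrib[symmetric]
        unfolding k_def sum_distrib_left
        by (intro sum.cong) (auto simp: hS(2) Uh distrib_right)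
      ultimately show "k s \<in> ell2 S \<and> (\<lambda>z. T (k s) z + U (k s) z) = (\<lambda>z. of_real s * k s z)"
        by simp
    qed
    moreover have "f z = (\<Sum>s\<in>RQ. k s z)" for z
    proof -
      have "f z = (\<Sum>x\<in>R \<times> Q. h (snd x) (fst x) z)"
      proof -
        have "f z = (\<Sum>q\<in>Q. \<Sum>r\<in>R. h q r z)"
          by (simp add: g(2) h(2))
        also have "\<dots> = (\<Sum>r\<in>R. \<Sum>q\<in>Q. h q r z)"
          by (rule sum.swap)
        finally show ?thesis
          by (simp add: sum.cartesian_product case_prod_beta)
      qed
      also have "\<dots> = (\<Sum>s\<in>RQ. k s z)"
        unfolding k_def using fin by (subst sum.group) (auto simp: RQ_def)
      finally show ?thesis .
    qed
    ultimately show ?thesis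
      by blast
  qed
  then show ?thesis
    unfolding eigen_decomposable_def RQ_def using fin by auto
qed

end

section \<open>Spectral projections of diagonalizable operators\<close>

text \<open>
  The interval \<open>(\<alpha>, \<beta>)\<close> is a gap of the essential spectrum that contains \<open>N\<close> eigenvalues, with
  infinitely many dimensions of spectral subspace on either side.
\<close>

definition gap_with_eigenvalues :: "'a set \<Rightarrow> 'a operator \<Rightarrow> real \<Rightarrow> real \<Rightarrow> nat \<Rightarrow> bool" where
  "gap_with_eigenvalues S T \<alpha> \<beta> N \<longleftrightarrow>
    (let I = complex_of_real ` {\<alpha><..<\<beta>}
     in eigenvalue_count S T I N \<and> spectrum S T \<inter> I = eigenvalues S T \<inter> I \<and>
      (\<exists>t\<le>\<alpha>. complex_of_real t \<in> spectrum S T) \<and> (\<exists>t\<ge>\<beta>. complex_of_real t \<in> spectrum S T) \<and>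
      (\<exists>E. spectral_measure S T E \<and> \<not> finite_dim (E {..\<alpha>} ` ell2 S) \<and> \<not> finite_dim (E {\<beta>..} ` ell2 S)))"

locale diagonal_operator = bounded_symmetric +
  fixes R :: "real set"
  assumes decomposable: "eigen_decomposable S T R"
begin

lemma finite_R: "finite R"
  using decomposable by (simp add: eigen_decomposable_def)

text \<open>
  The choice is harmless: the decomposition is unique by orthogonality of eigenvectors.
\<close>

definition eigen_part :: "real \<Rightarrow> 'a operator" where
  "eigen_part r f = (SOME g. eigen_family S T R g \<and> f = (\<lambda>z. \<Sum>r\<in>R. g r z)) r"

lemma eigen_part_family:
  assumes "f \<in> ell2 S"
  shows "eigen_family S T R (\<lambda>r. eigen_part r f)" "(\<Sum>r\<in>R. eigen_part r f z) = f z"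
proof -
  define g where "g = (SOME g. eigen_family S T R g \<and> f = (\<lambda>z. \<Sum>r\<in>R. g r z))"
  have "\<exists>g. eigen_family S T R g \<and> f = (\<lambda>z. \<Sum>r\<in>R. g r z)"
    using decomposable assms by (simp add: eigen_decomposable_def)
  from someI_ex[OF this] have g: "eigen_family S T R g" "f = (\<lambda>z. \<Sum>r\<in>R. g r z)"
    unfolding g_def by blast+
  have eq: "eigen_part r f = g r" for r
    by (simp add: eigen_part_def g_def)
  show "eigen_family S T R (\<lambda>r. eigen_part r f)"
    using g(1) by (simp add: eq)
  show "(\<Sum>r\<in>R. eigen_part r f z) = f z"
    using fun_cong[OF g(2), of z] by (simp add: eq)
qed

lemma eigen_part_in_ell2: "f \<in> ell2 S \<Longrightarrow> r \<in> R \<Longrightarrow> eigen_part r f \<in> ell2 S"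
  and eigen_part_eigen: "f \<in> ell2 S \<Longrightarrow> r \<in> R \<Longrightarrow> T (eigen_part r f) = (\<lambda>z. of_real r * eigen_part r f z)"
  using eigen_part_family(1) by (auto simp: eigen_family_def)

lemma eigen_part_unique:
  assumes "eigen_family S T R g" "f = (\<lambda>z. \<Sum>r\<in>R. g r z)" "r \<in> R"
  shows "eigen_part r f = g r"
proof -
  have f: "f \<in> ell2 S"
    unfolding assms(2) using assms(1) by (intro ell2_sum) (auto simp: eigen_family_def)
  have "(\<lambda>z. \<Sum>r\<in>R. eigen_part r f z) = (\<lambda>z. \<Sum>r\<in>R. g r z)"
    unfolding eigen_part_family(2)[OF f] using assms(2) by simp
  then show ?thesis
    by (rule eigen_family_unique[OF eigen_part_family(1)[OF f] assms(1) finite_R _ assms(3)])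
qed

lemma eigen_part_lincomb:
  assumes "f \<in> ell2 S" "g \<in> ell2 S" "r \<in> R"
  shows "eigen_part r (\<lambda>z. c * f z + g z) = (\<lambda>z. c * eigen_part r f z + eigen_part r g z)"
proof (rule eigen_part_unique[OF _ _ assms(3), of "\<lambda>r z. c * eigen_part r f z + eigen_part r g z"])
  show "eigen_family S T R (\<lambda>r z. c * eigen_part r f z + eigen_part r g z)"
    unfolding eigen_family_def
  proof (intro ballI conjI)
    fix s assume s: "s \<in> R"
    show "(\<lambda>z. c * eigen_part s f z + eigen_part s g z) \<in> ell2 S"
      by (intro ell2_lincomb eigen_part_in_ell2 assms s)
    show "T (\<lambda>z. c * eigen_part s f z + eigen_part s g z)
        = (\<lambda>z. of_real s * (c * eigen_part s f z + eigen_part s g z))"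
      unfolding clinear_op_simps(1)[OF linear] eigen_part_eigen[OF assms(1) s] eigen_part_eigen[OF assms(2) s]
      by (simp add: distrib_left mult.left_commute)
  qed
  show "(\<lambda>z. c * f z + g z) = (\<lambda>z. \<Sum>r\<in>R. c * eigen_part r f z + eigen_part r g z)"
    by (simp add: sum.distrib sum_distrib_left[symmetric] eigen_part_family(2) assms)
qed

definition spectral_projection :: "real set \<Rightarrow> 'a operator" where
  "spectral_projection A f = (\<lambda>z. \<Sum>r\<in>R. (if r \<in> A then 1 else 0) * eigen_part r f z)"

lemma weighted_eigen_parts_inner:
  assumes "f \<in> ell2 S" "g \<in> ell2 S"
  shows "ell2_inner S (\<lambda>z. \<Sum>r\<in>R. b r * eigen_part r f z) (\<lambda>z. \<Sum>r\<in>R. c r * eigen_part r g z)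
    = (\<Sum>r\<in>R. cnj (b r) * c r * ell2_inner S (eigen_part r f) (eigen_part r g))"
proof -
  have "ell2_inner S (\<lambda>z. \<Sum>r\<in>R. b r * eigen_part r f z) (\<lambda>z. \<Sum>r\<in>R. c r * eigen_part r g z)
      = (\<Sum>r\<in>R. ell2_inner S (\<lambda>z. b r * eigen_part r f z) (\<lambda>z. \<Sum>r\<in>R. c r * eigen_part r g z))"
    using assms by (intro ell2_inner_sum_left ell2_sum ell2_scale eigen_part_in_ell2)
  also have "\<dots> = (\<Sum>r\<in>R. cnj (b r) * c r * ell2_inner S (eigen_part r f) (eigen_part r g))"
    by (rule sum.cong[OF refl])
      (simp add: ell2_inner_scale_left mult.assoc
        eigen_family_inner_sum[OF eigen_part_family(1)[OF assms(1)] eigen_part_family(1)[OF assms(2)] finite_R])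
  finally show ?thesis .
qed

lemma weighted_eigen_parts_norm:
  assumes "f \<in> ell2 S"
  shows "(ell2_norm S (\<lambda>z. \<Sum>r\<in>R. c r * eigen_part r f z))\<^sup>2
    = (\<Sum>r\<in>R. (cmod (c r))\<^sup>2 * (ell2_norm S (eigen_part r f))\<^sup>2)"
proof -
  have mem: "(\<lambda>z. \<Sum>r\<in>R. c r * eigen_part r f z) \<in> ell2 S"
    using assms by (intro ell2_sum ell2_scale eigen_part_in_ell2)
  have "complex_of_real ((ell2_norm S (\<lambda>z. \<Sum>r\<in>R. c r * eigen_part r f z))\<^sup>2)
      = (\<Sum>r\<in>R. cnj (c r) * c r * ell2_inner S (eigen_part r f) (eigen_part r f))"
    unfolding ell2_inner_self[OF mem, symmetric] by (rule weighted_eigen_parts_inner[OF assms assms])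
  also have "\<dots> = (\<Sum>r\<in>R. of_real ((cmod (c r))\<^sup>2 * (ell2_norm S (eigen_part r f))\<^sup>2))"
  proof (rule sum.cong[OF refl])
    fix r assume "r \<in> R"
    then show "cnj (c r) * c r * ell2_inner S (eigen_part r f) (eigen_part r f)
        = of_real ((cmod (c r))\<^sup>2 * (ell2_norm S (eigen_part r f))\<^sup>2)"
      unfolding of_real_mult complex_norm_square
      by (simp only: ell2_inner_self[OF eigen_part_in_ell2[OF assms]] mult.commute)
  qed
  finally show ?thesis
    by (simp only: of_real_sum[symmetric] of_real_eq_iff)
qed

lemma expansion_norm:
  assumes "f \<in> ell2 S"
  shows "(ell2_norm S f)\<^sup>2 = (\<Sum>r\<in>R. (ell2_norm S (eigen_part r f))\<^sup>2)"
  using weighted_eigen_parts_norm[OF assms, of "\<lambda>r. 1"] by (simp add: eigen_part_family(2)[OF assms])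

lemma T_expansion:
  assumes "f \<in> ell2 S"
  shows "T f = (\<lambda>z. \<Sum>r\<in>R. of_real r * eigen_part r f z)"
proof -
  have "T f = T (\<lambda>z. \<Sum>r\<in>R. 1 * eigen_part r f z)"
    by (simp add: eigen_part_family(2)[OF assms])
  also have "\<dots> = (\<lambda>z. \<Sum>r\<in>R. of_real r * eigen_part r f z)"
    unfolding clinear_op_sum[OF linear]
    by (auto intro!: sum.cong simp: eigen_part_eigen[OF assms])
  finally show ?thesis .
qed

lemma quadratic_form:
  assumes "f \<in> ell2 S"
  shows "ell2_inner S f (T f) = of_real (\<Sum>r\<in>R. r * (ell2_norm S (eigen_part r f))\<^sup>2)"
proof -
  have "ell2_inner S f (T f)
      = ell2_inner S (\<lambda>z. \<Sum>r\<in>R. 1 * eigen_part r f z) (\<lambda>z. \<Sum>r\<in>R. of_real r * eigen_part r f z)"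
    by (simp add: eigen_part_family(2)[OF assms] T_expansion[OF assms])
  also have "\<dots> = (\<Sum>r\<in>R. cnj 1 * of_real r * ell2_inner S (eigen_part r f) (eigen_part r f))"
    by (rule weighted_eigen_parts_inner[OF assms assms])
  also have "\<dots> = of_real (\<Sum>r\<in>R. r * (ell2_norm S (eigen_part r f))\<^sup>2)"
    unfolding of_real_sum
    by (rule sum.cong) (simp_all add: ell2_inner_self eigen_part_in_ell2 assms)
  finally show ?thesis .
qed

definition proper_eigenvalues :: "real set" where
  "proper_eigenvalues = {r \<in> R. \<exists>f\<in>ell2 S. eigen_part r f \<noteq> 0}"

lemma proper_eigenvalues_subset: "complex_of_real ` proper_eigenvalues \<subseteq> eigenvalues S T"
proof
  fix l assume "l \<in> complex_of_real ` proper_eigenvalues"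
  then obtain r f where r: "l = of_real r" "r \<in> R" "f \<in> ell2 S" "eigen_part r f \<noteq> 0"
    by (auto simp: proper_eigenvalues_def)
  then have "eigen_part r f \<in> eigenspace S T l"
    by (auto simp: eigenspace_def minus_scalar_def eigen_part_in_ell2 eigen_part_eigen)
  then show "l \<in> eigenvalues S T"
    using r(4) by (auto simp: eigenvalues_def)
qed

lemma eigenvalues_subset_spectrum: "eigenvalues S T \<subseteq> spectrum S T"
proof
  fix l assume "l \<in> eigenvalues S T"
  then obtain f where f: "f \<in> ell2 S" "f \<noteq> 0" "minus_scalar T l f = 0"
    by (auto simp: eigenvalues_def eigenspace_def)
  have "minus_scalar T l 0 = 0"
    using clinear_op_simps(3)[OF shifted_linear, of l] by (simp add: zero_fun_def)
  then have "\<not> inj_on (minus_scalar T l) (ell2 S)"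
    using f ell2_zero(2)[of S] by (metis inj_onD)
  then show "l \<in> spectrum S T"
    by (auto simp: spectrum_def resolvent_set_def bij_betw_def)
qed

text \<open>
  By the expansion, \<open>T - l\<close> is bounded below by the distance of \<open>l\<close> to the eigenvalues, which is positive;
  capping it at \<open>1\<close> covers the case without eigenvalues.
\<close>

lemma spectrum_subset_proper_eigenvalues: "spectrum S T \<subseteq> complex_of_real ` proper_eigenvalues"
proof
  fix l assume l: "l \<in> spectrum S T"
  show "l \<in> complex_of_real ` proper_eigenvalues"
  proof (rule ccontr)
    assume not: "l \<notin> complex_of_real ` proper_eigenvalues"
    define c where "c = Min (insert 1 ((\<lambda>r. cmod (of_real r - l)) ` proper_eigenvalues))"
    have fin: "finite proper_eigenvalues"
      using finite_R by (simp add: proper_eigenvalues_def)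
    have c: "c > 0" "\<And>r. r \<in> proper_eigenvalues \<Longrightarrow> c \<le> cmod (of_real r - l)"
      using fin not by (auto simp: c_def intro: Min_le)
    have "c * ell2_norm S f \<le> ell2_norm S (shifted l f)" if f: "f \<in> ell2 S" for f
    proof -
      have "shifted l f = (\<lambda>z. \<Sum>r\<in>R. (of_real r - l) * eigen_part r f z)"
        by (simp add: minus_scalar_def T_expansion[OF f] left_diff_distrib sum_subtractf
            sum_distrib_left[symmetric] eigen_part_family(2)[OF f])
      then have "(ell2_norm S (shifted l f))\<^sup>2
          = (\<Sum>r\<in>R. (cmod (of_real r - l))\<^sup>2 * (ell2_norm S (eigen_part r f))\<^sup>2)"
        using weighted_eigen_parts_norm[OF f] by simp
      also have "\<dots> \<ge> (\<Sum>r\<in>R. c\<^sup>2 * (ell2_norm S (eigen_part r f))\<^sup>2)"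
      proof (rule sum_mono)
        fix r assume r: "r \<in> R"
        show "c\<^sup>2 * (ell2_norm S (eigen_part r f))\<^sup>2
            \<le> (cmod (of_real r - l))\<^sup>2 * (ell2_norm S (eigen_part r f))\<^sup>2"
        proof (cases "r \<in> proper_eigenvalues")
          case True
          then show ?thesis
            using c by (intro mult_right_mono power_mono) auto
        next
          case False
          then show ?thesis
            using r f by (simp add: proper_eigenvalues_def)
        qed
      qed
      also have "(\<Sum>r\<in>R. c\<^sup>2 * (ell2_norm S (eigen_part r f))\<^sup>2) = (c * ell2_norm S f)\<^sup>2"
        by (simp add: power_mult_distrib expansion_norm[OF f] sum_distrib_left)
      finally show ?thesis
        by (rule power2_le_imp_le) simp
    qed
    then have "l \<in> resolvent_set S T"
      by (rule bounded_below_imp_resolvent[OF c(1)])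
    then show False
      using l by (simp add: spectrum_def)
  qed
qed

lemma spectrum_eq: "spectrum S T = complex_of_real ` proper_eigenvalues"
  and eigenvalues_eq: "eigenvalues S T = complex_of_real ` proper_eigenvalues"
  using proper_eigenvalues_subset eigenvalues_subset_spectrum spectrum_subset_proper_eigenvalues
  by blast+

lemma spectral_projection_in_ell2: "f \<in> ell2 S \<Longrightarrow> spectral_projection A f \<in> ell2 S"
  unfolding spectral_projection_def by (intro ell2_sum ell2_scale eigen_part_in_ell2)

lemma eigen_part_spectral_projection:
  assumes "f \<in> ell2 S" "r \<in> R"
  shows "eigen_part r (spectral_projection A f) = (\<lambda>z. (if r \<in> A then 1 else 0) * eigen_part r f z)"
proof (rule eigen_part_unique[OF _ _ assms(2), of "\<lambda>r z. (if r \<in> A then 1 else 0) * eigen_part r f z"])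
  show "eigen_family S T R (\<lambda>r z. (if r \<in> A then 1 else 0) * eigen_part r f z)"
    using assms(1)
    by (simp add: eigen_family_def eigen_part_in_ell2 eigen_part_eigen clinear_op_simps(3)[OF linear])
qed (simp add: spectral_projection_def)

lemma spectral_projection_linear:
  assumes "f \<in> ell2 S" "g \<in> ell2 S"
  shows "spectral_projection A (\<lambda>z. c * f z + g z)
    = (\<lambda>z. c * spectral_projection A f z + spectral_projection A g z)"
proof
  fix z
  have "spectral_projection A (\<lambda>z. c * f z + g z) z
      = (\<Sum>r\<in>R. c * ((if r \<in> A then 1 else 0) * eigen_part r f z) + (if r \<in> A then 1 else 0) * eigen_part r g z)"
    unfolding spectral_projection_def by (rule sum.cong) (simp_all add: eigen_part_lincomb assms)
  then show "spectral_projection A (\<lambda>z. c * f z + g z) z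
      = c * spectral_projection A f z + spectral_projection A g z"
    by (simp only: sum.distrib sum_distrib_left spectral_projection_def)
qed

lemma spectral_projection_orthogonal: "orthogonal_projection S (spectral_projection A)"
  unfolding orthogonal_projection_def
proof (intro conjI ballI allI)
  fix f assume f: "f \<in> ell2 S"
  show "spectral_projection A f \<in> ell2 S"
    by (rule spectral_projection_in_ell2[OF f])
  show "spectral_projection A (spectral_projection A f) = spectral_projection A f"
  proof
    fix z
    have "spectral_projection A (spectral_projection A f) z
        = (\<Sum>r\<in>R. (if r \<in> A then 1 else 0) * eigen_part r (spectral_projection A f) z)"
      by (simp only: spectral_projection_def[of A "spectral_projection A f"])
    also have "\<dots> = (\<Sum>r\<in>R. (if r \<in> A then 1 else 0) * eigen_part r f z)"
      by (rule sum.cong) (simp_all add: eigen_part_spectral_projection[OF f])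
    finally show "spectral_projection A (spectral_projection A f) z = spectral_projection A f z"
      by (simp only: spectral_projection_def)
  qed
  fix g assume g: "g \<in> ell2 S"
  show "spectral_projection A (\<lambda>z. c * f z + g z)
      = (\<lambda>z. c * spectral_projection A f z + spectral_projection A g z)" for c
    by (rule spectral_projection_linear[OF f g])
  have "ell2_inner S (spectral_projection A f) g
      = ell2_inner S (\<lambda>z. \<Sum>r\<in>R. (if r \<in> A then 1 else 0) * eigen_part r f z) (\<lambda>z. \<Sum>r\<in>R. 1 * eigen_part r g z)"
    by (simp add: spectral_projection_def eigen_part_family(2)[OF g])
  also have "\<dots> = (\<Sum>r\<in>R. (if r \<in> A then 1 else 0) * ell2_inner S (eigen_part r f) (eigen_part r g))"
    unfolding weighted_eigen_parts_inner[OF f g] by (rule sum.cong) auto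
  also have "\<dots> = ell2_inner S (\<lambda>z. \<Sum>r\<in>R. 1 * eigen_part r f z) (\<lambda>z. \<Sum>r\<in>R. (if r \<in> A then 1 else 0) * eigen_part r g z)"
    unfolding weighted_eigen_parts_inner[OF f g] by (rule sum.cong) auto
  also have "\<dots> = ell2_inner S f (spectral_projection A g)"
    by (simp add: spectral_projection_def eigen_part_family(2)[OF f])
  finally show "ell2_inner S (spectral_projection A f) g = ell2_inner S f (spectral_projection A g)" .
qed

lemma spectral_projection_norm:
  assumes "f \<in> ell2 S"
  shows "(ell2_norm S (spectral_projection A f))\<^sup>2 = (\<Sum>r\<in>R \<inter> A. (ell2_norm S (eigen_part r f))\<^sup>2)"
proof -
  have "(ell2_norm S (spectral_projection A f))\<^sup>2
      = (\<Sum>r\<in>R. if r \<in> A then (ell2_norm S (eigen_part r f))\<^sup>2 else 0)"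
    unfolding spectral_projection_def weighted_eigen_parts_norm[OF assms] by (rule sum.cong) auto
  then show ?thesis
    by (simp add: sum.inter_restrict[OF finite_R])
qed

text \<open>
  The scalar spectral measure is a sum of point masses; countable additivity holds because only
  finitely many members of a disjoint family meet \<open>R\<close>.
\<close>

lemma spectral_projection_measure: "spectral_measure S T spectral_projection"
  unfolding spectral_measure_def
proof (intro conjI ballI allI impI)
  show "orthogonal_projection S (spectral_projection A)" for A
    by (rule spectral_projection_orthogonal)
next
  fix f assume f: "f \<in> ell2 S"
  show "spectral_projection UNIV f = f"
    by (simp add: spectral_projection_def eigen_part_family(2)[OF f])
next
  fix A :: "nat \<Rightarrow> real set" and f
  assume A: "range A \<subseteq> sets borel \<and> disjoint_family A" and f: "f \<in> ell2 S"
  have disj: "i = j" if "r \<in> A i" "r \<in> A j" for r i j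
    using A that by (auto simp: disjoint_family_on_def)
  have "\<exists>n. \<forall>k\<ge>n. r \<notin> A k" for r
  proof (cases "\<exists>k. r \<in> A k")
    case True
    then obtain k where k: "r \<in> A k"
      by blast
    have "r \<notin> A m" if "m \<ge> Suc k" for m
      using disj[of r m k] k that by auto
    then show ?thesis
      by blast
  qed auto
  then obtain n where n: "\<And>r k. k \<ge> n r \<Longrightarrow> r \<notin> A k"
    by metis
  define N where "N = Max (insert 0 (n ` R))"
  have N: "r \<notin> A k" if "r \<in> R" "k \<ge> N" for r k
    using n[of r k] that finite_R by (auto simp: N_def)
  have "spectral_projection (\<Union>k. A k) f z = (\<Sum>k<m. spectral_projection (A k) f) z" if "m \<ge> N" for m z
  proof -
    have "(\<Sum>k<m. spectral_projection (A k) f) z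
        = (\<Sum>r\<in>R. (\<Sum>k<m. if r \<in> A k then 1 else 0) * eigen_part r f z)"
      unfolding fun_sum_apply spectral_projection_def sum_distrib_right by (rule sum.swap)
    also have "\<dots> = spectral_projection (\<Union>k. A k) f z"
      unfolding spectral_projection_def
    proof (intro sum.cong arg_cong2[of _ _ _ _ "(*)"] refl)
      fix r assume r: "r \<in> R"
      show "(\<Sum>k<m. if r \<in> A k then 1 else 0) = (if r \<in> (\<Union>k. A k) then 1 else 0 :: complex)"
      proof (cases "\<exists>k. r \<in> A k")
        case True
        then obtain k where k: "r \<in> A k"
          by blast
        have "k < m"
          using N[OF r, of k] k that by (meson not_le order_trans)
        have "r \<in> A j \<longleftrightarrow> j = k" for j
          using disj k by blast
        then have "(\<Sum>j<m. if r \<in> A j then 1 else 0) = (\<Sum>j<m. if j = k then 1 else 0 :: complex)"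
          by simp
        then show ?thesis
          using k \<open>k < m\<close> by auto
      qed auto
    qed
    finally show ?thesis ..
  qed
  then have "spectral_projection (\<Union>k. A k) f - (\<Sum>k<m. spectral_projection (A k) f) = 0" if "m \<ge> N" for m
    using that by (auto simp: fun_eq_iff)
  then show "(\<lambda>m. ell2_norm S (spectral_projection (\<Union>k. A k) f - (\<Sum>k<m. spectral_projection (A k) f))) \<longlonglongrightarrow> 0"
    by (intro tendsto_eventually eventually_sequentiallyI[of N]) simp
next
  fix f assume f: "f \<in> ell2 S"
  define w where "w r = (ell2_norm S (eigen_part r f))\<^sup>2" for r
  define M' where "M' = distr (point_measure R (\<lambda>r. ennreal (w r))) borel (\<lambda>r. r)"
  have w: "w r \<ge> 0" for r
    by (simp add: w_def)
  have meas: "(\<lambda>r. r) \<in> measurable (point_measure R (\<lambda>r. ennreal (w r))) borel"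
    by (rule measurableI) (auto simp: space_point_measure sets_point_measure)
  have em: "emeasure M' A = ennreal ((ell2_norm S (spectral_projection A f))\<^sup>2)" if "A \<in> sets borel" for A
  proof -
    have "emeasure M' A = emeasure (point_measure R (\<lambda>r. ennreal (w r))) (R \<inter> A)"
      unfolding M'_def using that
      by (subst emeasure_distr[OF meas]) (auto simp: space_point_measure Int_commute)
    also have "\<dots> = (\<Sum>r\<in>R \<inter> A. ennreal (w r))"
      using finite_R by (intro emeasure_point_measure_finite) auto
    finally show ?thesis
      using w by (simp add: spectral_projection_norm[OF f] w_def[symmetric] sum_ennreal)
  qed
  have "sigma_sets UNIV (sets borel) = (sets borel :: real set set)"
    using sets.sigma_sets_eq[of "borel :: real measure"] by simp
  then have "measure_of UNIV (sets borel) (\<lambda>A. ennreal ((ell2_norm S (spectral_projection A f))\<^sup>2))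
      = measure_of UNIV (sets borel) (emeasure M')"
    by (intro measure_of_eq) (simp_all add: em)
  also have "\<dots> = M'"
    using measure_of_of_measure[of M'] by (simp add: M'_def)
  finally have mu: "measure_of UNIV (sets borel) (\<lambda>A. ennreal ((ell2_norm S (spectral_projection A f))\<^sup>2)) = M'" .
  have int: "integrable (point_measure R (\<lambda>r. ennreal (w r))) (\<lambda>r. r)"
    using finite_R by (rule integrable_point_measure_finite)
  have id: "(\<lambda>t::real. t) \<in> borel_measurable borel"
    by simp
  have "integrable M' (\<lambda>t. t)"
    unfolding M'_def integrable_distr_eq[OF meas id] by (rule int)
  moreover have "(\<integral>t. t \<partial>M') = (\<Sum>r\<in>R. r * w r)"
  proof -
    have "(\<integral>t. t \<partial>M') = (\<integral>t. t \<partial>point_measure R (\<lambda>r. ennreal (w r)))"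
      unfolding M'_def by (rule integral_distr[OF meas id])
    also have "\<dots> = (\<Sum>r\<in>R. w r *\<^sub>R r)"
      using finite_R w by (intro lebesgue_integral_point_measure_finite) auto
    finally show ?thesis
      by (simp add: mult.commute)
  qed
  ultimately show "let \<mu> = measure_of UNIV (sets borel)
              (\<lambda>A. ennreal ((ell2_norm S (spectral_projection A f))\<^sup>2))
        in integrable \<mu> (\<lambda>t. t) \<and> ell2_inner S f (T f) = of_real (\<integral>t. t \<partial>\<mu>)"
    unfolding mu Let_def by (simp add: quadratic_form[OF f] w_def)
qed

text \<open>
  If the form of \<open>T\<close> is diagonal with entries beyond \<open>m\<close> on infinitely many orthonormal vectors, then it
  is beyond \<open>m\<close> on their span; there the spectral projection beyond \<open>m\<close> is injective. The sign \<open>\<sigma>\<close>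
  selects the side.
\<close>

lemma spectral_projection_infinite_dim:
  fixes \<phi> :: "nat \<Rightarrow> 'a \<Rightarrow> complex" and \<sigma> m :: real
  assumes \<phi>: "\<And>n. \<phi> n \<in> ell2 S" and norm: "\<And>n. ell2_norm S (\<phi> n) = 1"
    and orth: "\<And>n k. n \<noteq> k \<Longrightarrow> ell2_inner S (\<phi> n) (\<phi> k) = 0"
    and T_orth: "\<And>n k. n \<noteq> k \<Longrightarrow> ell2_inner S (\<phi> n) (T (\<phi> k)) = 0"
    and T_diag: "\<And>n. \<sigma> * Re (ell2_inner S (\<phi> n) (T (\<phi> n))) > \<sigma> * m"
    and A: "\<And>r. r \<in> R - A \<Longrightarrow> \<sigma> * r \<le> \<sigma> * m"
  shows "\<not> finite_dim (spectral_projection A ` ell2 S)"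
proof
  assume "finite_dim (spectral_projection A ` ell2 S)"
  then obtain B where B: "finite B" "spectral_projection A ` ell2 S \<subseteq> cfun.span B"
    by (auto simp: finite_dim_def)
  define k where "k = card B"
  have "spectral_projection A (\<phi> j) \<in> cfun.span B" for j
    using B(2) \<phi> by blast
  then obtain t j0 where j0: "j0 \<le> k" "t j0 \<noteq> 0"
    and rel: "\<And>z. (\<Sum>j\<le>k. t j * spectral_projection A (\<phi> j) z) = 0"
    using span_linear_relation[OF B(1), of "\<lambda>j. spectral_projection A (\<phi> j)"] unfolding k_def by blast
  define f where "f = (\<lambda>z. \<Sum>j\<le>k. t j * \<phi> j z)"
  have f: "f \<in> ell2 S"
    unfolding f_def by (intro ell2_sum ell2_scale \<phi>)
  have proj_sum: "spectral_projection A (\<lambda>z. \<Sum>j\<in>J. t j * \<phi> j z) = (\<lambda>z. \<Sum>j\<in>J. t j * spectral_projection A (\<phi> j) z)"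
    if "finite J" for J
    using that
  proof (induction J)
    case empty
    show ?case
      using spectral_projection_linear[of "\<lambda>z. 0" "\<lambda>z. 0" A "-1"] by simp
  next
    case (insert j J)
    have "spectral_projection A (\<lambda>z. t j * \<phi> j z + (\<Sum>j\<in>J. t j * \<phi> j z))
        = (\<lambda>z. t j * spectral_projection A (\<phi> j) z + spectral_projection A (\<lambda>z. \<Sum>j\<in>J. t j * \<phi> j z) z)"
      by (intro spectral_projection_linear \<phi> ell2_sum ell2_scale)
    with insert show ?case
      by simp
  qed
  have "spectral_projection A f = (\<lambda>z. 0)"
    unfolding f_def by (subst proj_sum) (simp_all add: rel)
  then have "(\<Sum>r\<in>R \<inter> A. (ell2_norm S (eigen_part r f))\<^sup>2) = 0"
    using spectral_projection_norm[OF f, of A] by simp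
  then have part0: "ell2_norm S (eigen_part r f) = 0" if "r \<in> R" "r \<in> A" for r
    using that finite_R by (simp add: sum_nonneg_eq_0_iff)
  have "\<sigma> * (\<Sum>r\<in>R. r * (ell2_norm S (eigen_part r f))\<^sup>2) \<le> \<sigma> * (m * (\<Sum>r\<in>R. (ell2_norm S (eigen_part r f))\<^sup>2))"
    unfolding sum_distrib_left
  proof (rule sum_mono)
    fix r assume r: "r \<in> R"
    show "\<sigma> * (r * (ell2_norm S (eigen_part r f))\<^sup>2) \<le> \<sigma> * (m * (ell2_norm S (eigen_part r f))\<^sup>2)"
    proof (cases "r \<in> A")
      case True
      then show ?thesis
        using part0 r by simp
    next
      case False
      have "\<sigma> * r * (ell2_norm S (eigen_part r f))\<^sup>2 \<le> \<sigma> * m * (ell2_norm S (eigen_part r f))\<^sup>2"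
        using A r False by (intro mult_right_mono) auto
      then show ?thesis
        by (simp add: mult.assoc)
    qed
  qed
  then have upper: "\<sigma> * Re (ell2_inner S f (T f)) \<le> \<sigma> * m * (ell2_norm S f)\<^sup>2"
    by (simp add: quadratic_form[OF f] expansion_norm[OF f] mult.assoc)
  have gram: "ell2_inner S f (\<lambda>z. \<Sum>j\<le>k. t j * \<psi> j z) = (\<Sum>j\<le>k. of_real ((cmod (t j))\<^sup>2) * ell2_inner S (\<phi> j) (\<psi> j))"
    if \<psi>: "\<And>j. \<psi> j \<in> ell2 S" and diag: "\<And>i j. i \<noteq> j \<Longrightarrow> ell2_inner S (\<phi> i) (\<psi> j) = 0" for \<psi>
  proof -
    have "ell2_inner S f (\<lambda>z. \<Sum>j\<le>k. t j * \<psi> j z)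
        = (\<Sum>i\<le>k. ell2_inner S (\<lambda>z. t i * \<phi> i z) (\<lambda>z. \<Sum>j\<le>k. t j * \<psi> j z))"
      unfolding f_def by (intro ell2_inner_sum_left ell2_sum ell2_scale \<phi> \<psi>)
    also have "\<dots> = (\<Sum>i\<le>k. \<Sum>j\<le>k. ell2_inner S (\<lambda>z. t i * \<phi> i z) (\<lambda>z. t j * \<psi> j z))"
      by (intro sum.cong refl ell2_inner_sum_right ell2_scale \<phi> \<psi>)
    also have "\<dots> = (\<Sum>i\<le>k. \<Sum>j\<le>k. if j = i then of_real ((cmod (t i))\<^sup>2) * ell2_inner S (\<phi> i) (\<psi> i) else 0)"
    proof (intro sum.cong refl)
      fix i j
      show "ell2_inner S (\<lambda>z. t i * \<phi> i z) (\<lambda>z. t j * \<psi> j z)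
          = (if j = i then of_real ((cmod (t i))\<^sup>2) * ell2_inner S (\<phi> i) (\<psi> i) else 0)"
        unfolding complex_norm_square using diag[of i j]
        by (simp add: ell2_inner_scale_left ell2_inner_scale_right mult_ac)
    qed
    also have "\<dots> = (\<Sum>i\<le>k. of_real ((cmod (t i))\<^sup>2) * ell2_inner S (\<phi> i) (\<psi> i))"
      by simp
    finally show ?thesis .
  qed
  have "ell2_inner S f f = (\<Sum>j\<le>k. of_real ((cmod (t j))\<^sup>2))"
    using gram[of \<phi>, OF \<phi> orth] by (simp add: ell2_inner_self[OF \<phi>] norm f_def[symmetric])
  then have nf: "(ell2_norm S f)\<^sup>2 = (\<Sum>j\<le>k. (cmod (t j))\<^sup>2)"
    unfolding ell2_inner_self[OF f] of_real_sum[symmetric] of_real_eq_iff .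
  have "T f = (\<lambda>z. \<Sum>j\<le>k. t j * T (\<phi> j) z)"
    unfolding f_def by (rule clinear_op_sum[OF linear])
  then have "Re (ell2_inner S f (T f)) = (\<Sum>j\<le>k. (cmod (t j))\<^sup>2 * Re (ell2_inner S (\<phi> j) (T (\<phi> j))))"
    using gram[of "\<lambda>j. T (\<phi> j)", OF maps[OF \<phi>] T_orth] by (simp del: of_real_power)
  then have "\<sigma> * Re (ell2_inner S f (T f)) = (\<Sum>j\<le>k. (cmod (t j))\<^sup>2 * (\<sigma> * Re (ell2_inner S (\<phi> j) (T (\<phi> j)))))"
    by (simp add: sum_distrib_left mult_ac)
  also have "\<dots> > (\<Sum>j\<le>k. (cmod (t j))\<^sup>2 * (\<sigma> * m))"
  proof (rule sum_strict_mono_ex1)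
    show "\<forall>j\<in>{..k}. (cmod (t j))\<^sup>2 * (\<sigma> * m) \<le> (cmod (t j))\<^sup>2 * (\<sigma> * Re (ell2_inner S (\<phi> j) (T (\<phi> j))))"
      by (intro ballI mult_left_mono less_imp_le[OF T_diag]) simp
    show "\<exists>j\<in>{..k}. (cmod (t j))\<^sup>2 * (\<sigma> * m) < (cmod (t j))\<^sup>2 * (\<sigma> * Re (ell2_inner S (\<phi> j) (T (\<phi> j))))"
      using j0 by (intro bexI[of _ j0] mult_strict_left_mono[OF T_diag]) auto
  qed simp
  also have "(\<Sum>j\<le>k. (cmod (t j))\<^sup>2 * (\<sigma> * m)) = \<sigma> * m * (ell2_norm S f)\<^sup>2"
    by (simp add: nf sum_distrib_left mult_ac)
  finally show False
    using upper by simp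
qed

lemma spectral_projection_finite_dim_trivial:
  assumes "proper_eigenvalues \<inter> A = {}"
  shows "finite_dim (spectral_projection A ` ell2 S)"
proof -
  have "spectral_projection A f = 0" if f: "f \<in> ell2 S" for f
  proof -
    have "eigen_part r f = 0" if "r \<in> R" "r \<in> A" for r
      using assms that f by (auto simp: proper_eigenvalues_def)
    then show ?thesis
      by (auto simp: spectral_projection_def fun_eq_iff intro!: sum.neutral)
  qed
  then have "spectral_projection A ` ell2 S \<subseteq> cfun.span {}"
    by auto
  then show ?thesis
    unfolding finite_dim_def by blast
qed

text \<open>
  The vectors \<open>\<phi>\<^sub>n\<close> and \<open>\<psi>\<^sub>n\<close> witness infinitely many dimensions above and below \<open>m\<close>, the only point of
  \<open>R\<close> inside the gap.
\<close>

lemma gap_statement: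
  fixes \<phi> \<psi> :: "nat \<Rightarrow> 'a \<Rightarrow> complex" and \<alpha> \<beta> m :: real
  assumes m: "\<alpha> < m" "m < \<beta>" and gap: "\<And>r. r \<in> R \<Longrightarrow> \<alpha> < r \<Longrightarrow> r < \<beta> \<Longrightarrow> r = m"
    and eig: "finite_dim (eigenspace S T m)" "cfun.dim (eigenspace S T m) = N"
    and \<phi>: "\<And>n. \<phi> n \<in> ell2 S" "\<And>n. ell2_norm S (\<phi> n) = 1"
      "\<And>n k. n \<noteq> k \<Longrightarrow> ell2_inner S (\<phi> n) (\<phi> k) = 0"
      "\<And>n k. n \<noteq> k \<Longrightarrow> ell2_inner S (\<phi> n) (T (\<phi> k)) = 0"
      "\<And>n. Re (ell2_inner S (\<phi> n) (T (\<phi> n))) > m"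
    and \<psi>: "\<And>n. \<psi> n \<in> ell2 S" "\<And>n. ell2_norm S (\<psi> n) = 1"
      "\<And>n k. n \<noteq> k \<Longrightarrow> ell2_inner S (\<psi> n) (\<psi> k) = 0"
      "\<And>n k. n \<noteq> k \<Longrightarrow> ell2_inner S (\<psi> n) (T (\<psi> k)) = 0"
      "\<And>n. Re (ell2_inner S (\<psi> n) (T (\<psi> n))) < m"
  shows "gap_with_eigenvalues S T \<alpha> \<beta> N"
proof -
  define I where "I = complex_of_real ` {\<alpha><..<\<beta>}"
  have "proper_eigenvalues \<subseteq> R"
    by (auto simp: proper_eigenvalues_def)
  then have sub: "eigenvalues S T \<inter> I \<subseteq> {of_real m}"
    using gap by (auto simp: eigenvalues_eq I_def)
  have "eigenvalue_count S T I N"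
  proof (cases "of_real m \<in> eigenvalues S T")
    case True
    then have "eigenvalues S T \<inter> I = {of_real m}"
      using sub m by (auto simp: I_def)
    then show ?thesis
      by (simp add: eigenvalue_count_def eig)
  next
    case False
    \<comment> \<open>The eigenspace is trivial, which forces \<open>N = 0\<close>.\<close>
    then have empty: "eigenvalues S T \<inter> I = {}"
      using sub by auto
    have "eigenspace S T m \<subseteq> cfun.span {}"
      using False by (auto simp: eigenvalues_def)
    then have "cfun.dim (eigenspace S T m) \<le> card ({} :: ('a \<Rightarrow> complex) set)"
      by (intro cfun.dim_le_card) auto
    then show ?thesis
      using empty eig(2) by (simp add: eigenvalue_count_def)
  qed
  moreover have low: "\<not> finite_dim (spectral_projection {..\<alpha>} ` ell2 S)"
    by (rule spectral_projection_infinite_dim[of \<psi> "-1" m, OF \<psi>(1-4)]) (use \<psi>(5) gap m in force)+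
  moreover have high: "\<not> finite_dim (spectral_projection {\<beta>..} ` ell2 S)"
    by (rule spectral_projection_infinite_dim[of \<phi> 1 m, OF \<phi>(1-4)]) (use \<phi>(5) gap m in force)+
  moreover have "\<exists>t\<le>\<alpha>. complex_of_real t \<in> spectrum S T"
    using low spectral_projection_finite_dim_trivial[of "{..\<alpha>}"] by (auto simp: spectrum_eq)
  moreover have "\<exists>t\<ge>\<beta>. complex_of_real t \<in> spectrum S T"
    using high spectral_projection_finite_dim_trivial[of "{\<beta>..}"] by (auto simp: spectrum_eq)
  ultimately show ?thesis
    unfolding gap_with_eigenvalues_def Let_def I_def
    using spectral_projection_measure by (auto simp: spectrum_eq eigenvalues_eq)
qed

end

section \<open>Chebyshev polynomials of an operator\<close>

text \<open>
  \<open>cheb j x = U\<^sub>j(x / 2)\<close> for the Chebyshev polynomials \<open>U\<^sub>j\<close> of the second kind: these are the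
  characteristic polynomials of paths.
\<close>

fun cheb :: "nat \<Rightarrow> complex poly" where
  "cheb 0 = 1"
| "cheb (Suc 0) = [:0, 1:]"
| "cheb (Suc (Suc j)) = pCons 0 (cheb (Suc j)) + smult (-1) (cheb j)"

lemma degree_cheb: "degree (cheb j) \<le> j \<and> coeff (cheb j) j = 1"
proof (induction j rule: cheb.induct)
  case (3 j)
  have "degree (pCons 0 (cheb (Suc j)) + smult (-1) (cheb j)) \<le> Suc (Suc j)"
    using 3 by (intro degree_add_le order_trans[OF degree_pCons_le] order_trans[OF degree_smult_le]) auto
  moreover have "coeff (cheb j) (Suc (Suc j)) = 0"
    using 3 by (intro coeff_eq_0) auto
  ultimately show ?case
    using 3 by simp
qed auto

definition chebU :: "nat \<Rightarrow> 'a operator \<Rightarrow> 'a operator" where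
  "chebU j T = poly_op (cheb j) T"

context
  fixes T :: "'a operator"
  assumes T: "clinear_op T"
begin

lemma chebU_0: "chebU 0 T f = f"
  by (simp add: chebU_def T)

lemma chebU_1: "chebU (Suc 0) T f = T f"
  by (simp add: chebU_def poly_op_pCons[OF T] clinear_op_simps[OF T])

lemma chebU_rec: "chebU (Suc (Suc j)) T f = (\<lambda>z. T (chebU (Suc j) T f) z - chebU j T f z)"
  unfolding chebU_def cheb.simps poly_op_add[OF T] poly_op_smult[OF T] poly_op_pCons[OF T] by simp

lemma chebU_commute:
  "clinear_op U \<Longrightarrow> (\<And>f. U (T f) = T (U f)) \<Longrightarrow> U (chebU j T f) = chebU j T (U f)"
  unfolding chebU_def by (rule poly_op_commute[OF T])

lemma chebU_rec': "chebU (Suc (Suc j)) T f = (\<lambda>z. chebU (Suc j) T (T f) z - chebU j T f z)"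
  by (simp add: chebU_rec chebU_commute[OF T])

lemma chebU_chebU: "chebU j T (chebU k T f) = chebU k T (chebU j T f)"
  unfolding chebU_def poly_op_mult[OF T, symmetric] by (simp add: mult.commute)

end

section \<open>Decoupled chains along one axis\<close>

text \<open>
  The integers are cut between \<open>0\<close> and \<open>1\<close>; the cells \<open>{1..n}\<close> and, on both sides of it,
  intervals of length \<open>n + 1\<close> form a partition. This is the position in the cell: \<open>0..n\<close> in a long
  cell, and \<open>1..n\<close> in the short one, which behaves like a long one that has lost its site \<open>0\<close>.
\<close>

definition cell_pos :: "nat \<Rightarrow> int \<Rightarrow> int" where
  "cell_pos n x = (if x \<ge> 1 then x else x - 1) mod (int n + 1)"

definition short_cell :: "nat \<Rightarrow> int set" where
  "short_cell n = {1..int n}"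

lemma cell_pos_bounds: "0 \<le> cell_pos n x" "cell_pos n x \<le> int n"
  unfolding cell_pos_def using pos_mod_bound[of "int n + 1" "if x \<ge> 1 then x else x - 1"] by auto

lemma cell_pos_short: "x \<in> short_cell n \<Longrightarrow> cell_pos n x = x"
  by (simp add: cell_pos_def short_cell_def)

lemma cell_pos_0: "cell_pos n 0 = int n"
  by (simp add: cell_pos_def zmod_minus1)

lemma mod_Suc_int: "x mod N \<noteq> N - 1 \<Longrightarrow> N > 0 \<Longrightarrow> (x + 1) mod N = x mod N + 1" for x N :: int
proof -
  assume "x mod N \<noteq> N - 1" "N > 0"
  then have "0 \<le> x mod N + 1" "x mod N + 1 < N"
    using pos_mod_bound[of N x] pos_mod_sign[of N x] by linarith+
  then have "(x mod N + 1) mod N = x mod N + 1"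
    by (rule mod_pos_pos_trivial)
  then show ?thesis
    by (simp add: mod_add_left_eq)
qed

lemma cell_pos_next:
  assumes "cell_pos n x \<noteq> int n"
  shows "cell_pos n (x + 1) = cell_pos n x + 1"
    and "x + 1 \<in> short_cell n \<longleftrightarrow> x \<in> short_cell n"
proof -
  have x0: "x \<noteq> 0"
    using assms cell_pos_0 by auto
  then have sign: "x + 1 \<ge> 1 \<longleftrightarrow> x \<ge> 1"
    by auto
  show "cell_pos n (x + 1) = cell_pos n x + 1"
    using assms sign mod_Suc_int[of x "int n + 1"] mod_Suc_int[of "x - 1" "int n + 1"]
    by (auto simp: cell_pos_def)
  have "x \<noteq> int n"
    using assms cell_pos_short[of "int n" n] x0 by (auto simp: short_cell_def)
  then show "x + 1 \<in> short_cell n \<longleftrightarrow> x \<in> short_cell n"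
    using x0 by (auto simp: short_cell_def)
qed

lemma cell_pos_add:
  assumes "int k \<le> int n - cell_pos n x"
  shows "cell_pos n (x + int k) = cell_pos n x + int k \<and>
    (x + int k \<in> short_cell n \<longleftrightarrow> x \<in> short_cell n)"
  using assms
proof (induction k)
  case (Suc k)
  then have IH: "cell_pos n (x + int k) = cell_pos n x + int k"
    "x + int k \<in> short_cell n \<longleftrightarrow> x \<in> short_cell n"
    by auto
  have "cell_pos n (x + int k) \<noteq> int n"
    using IH(1) Suc.prems by simp
  from cell_pos_next[OF this] IH show ?case
    by (simp add: add.assoc add.commute[of 1])
qed simp

lemma long_cell_start:
  assumes "x \<notin> short_cell n"
  defines "y \<equiv> x - cell_pos n x"
  shows "cell_pos n y = 0" "y \<notin> short_cell n" "y \<ge> 1 \<longleftrightarrow> x \<ge> 1"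
proof -
  define N where "N = int n + 1"
  have N: "N > 0"
    by (simp add: N_def)
  have "cell_pos n y = 0 \<and> y \<notin> short_cell n \<and> (y \<ge> 1 \<longleftrightarrow> x \<ge> 1)"
  proof (cases "x \<ge> 1")
    case True
    then have "x \<ge> N"
      using assms(1) by (auto simp: short_cell_def N_def)
    have y: "y = N * (x div N)"
      using True by (simp add: y_def cell_pos_def N_def minus_mod_eq_mult_div)
    have "x div N \<ge> 1"
      using \<open>x \<ge> N\<close> N by (simp add: pos_imp_zdiv_pos_iff int_one_le_iff_zero_less)
    then have "y \<ge> N"
      unfolding y using N mult_left_mono[of 1 "x div N" N] by simp
    moreover have "y mod N = 0"
      by (simp add: y)
    ultimately show ?thesis
      using True by (auto simp: cell_pos_def short_cell_def N_def)
  next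
    case False
    then have y: "y = x - (x - 1) mod N"
      by (simp add: y_def cell_pos_def N_def)
    have "(x - 1) mod N \<ge> 0"
      using N by simp
    then have "y \<le> 0"
      using False y by auto
    moreover have "y - 1 = N * ((x - 1) div N)"
      using minus_mod_eq_mult_div[of "x - 1" N] y by simp
    then have "(y - 1) mod N = 0"
      by simp
    ultimately show ?thesis
      using False by (auto simp: cell_pos_def short_cell_def N_def)
  qed
  then show "cell_pos n y = 0" "y \<notin> short_cell n" "y \<ge> 1 \<longleftrightarrow> x \<ge> 1"
    by auto
qed

definition bond :: "nat \<Rightarrow> int \<Rightarrow> real" where
  "bond n x = (if cell_pos n x = int n then 0 else 1)"

definition end_site :: "nat \<Rightarrow> int \<Rightarrow> real" where
  "end_site n x = (if cell_pos n x = 0 then 1 else 0)"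

text \<open>
  In long cells the first site has no bond to the left; for the short cell the missing bond is the one
  between \<open>0\<close> and \<open>1\<close>, across the boundary of the half-line.
\<close>

lemma bond_before_start: "x \<notin> short_cell n \<Longrightarrow> cell_pos n x = 0 \<Longrightarrow> bond n (x - 1) = 0"
  using cell_pos_next(1)[of n "x - 1"] cell_pos_bounds[of n "x - 1"] by (auto simp: bond_def)

text \<open>
  The Jacobi operator of the chains along axis \<open>i\<close>: all bonds inside cells are \<open>1\<close>, and the first site
  of every long cell carries the potential \<open>c\<close>.
\<close>

definition axis_op :: "nat \<Rightarrow> point set \<Rightarrow> nat \<Rightarrow> real \<Rightarrow> nat \<Rightarrow> point operator" where
  "axis_op d D n c i =
    jacobi_op d D (\<lambda>j z. if j = i then bond n (z i) else 0) (\<lambda>z. c * end_site n (z i))"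

lemma axis_op_apply:
  assumes "i < d" "z \<in> D"
  shows "axis_op d D n c i f z =
    of_real (bond n (z i - 1)) * f (z(i := z i - 1)) + of_real (bond n (z i)) * f (z(i := z i + 1))
    + of_real (c * end_site n (z i)) * f z"
proof -
  have "(\<Sum>j<d. of_real (if j = i then bond n ((z(j := z j - 1)) i) else 0) * f (z(j := z j - 1))
            + of_real (if j = i then bond n (z i) else 0) * f (z(j := z j + 1)))
      = (\<Sum>j<d. if j = i then of_real (bond n (z i - 1)) * f (z(i := z i - 1))
            + of_real (bond n (z i)) * f (z(i := z i + 1)) else 0)"
    by (rule sum.cong) auto
  also have "\<dots> = of_real (bond n (z i - 1)) * f (z(i := z i - 1)) + of_real (bond n (z i)) * f (z(i := z i + 1))"
    using assms(1) by simp
  finally show ?thesis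
    using assms(2) by (simp add: axis_op_def jacobi_op_def)
qed

lemma axis_op_off: "z \<notin> D \<Longrightarrow> axis_op d D n c i f z = 0"
  by (simp add: axis_op_def jacobi_op_def)

lemma axis_op_linear: "clinear_op (axis_op d D n c i)"
  unfolding axis_op_def by (rule jacobi_op_linear)

lemma axis_op_bounded_symmetric: "bounded_symmetric D (axis_op d D n c i) ((2 * real d + 1) * (1 + \<bar>c\<bar>))"
  unfolding axis_op_def
  by (rule jacobi_op_bounded_symmetric) (auto simp: coeffs_bounded_def bond_def end_site_def)

text \<open>A set of sites that no bond along axis \<open>i\<close> leaves.\<close>

definition chain_closed :: "nat \<Rightarrow> nat \<Rightarrow> point set \<Rightarrow> bool" where
  "chain_closed n i X \<longleftrightarrow> (\<forall>z\<in>X. (cell_pos n (z i) \<noteq> int n \<longrightarrow> z(i := z i + 1) \<in> X) \<and>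
    (cell_pos n (z i - 1) \<noteq> int n \<longrightarrow> z(i := z i - 1) \<in> X))"

lemma axis_op_local:
  assumes "i < d" "chain_closed n i X" "\<And>z. z \<in> X \<Longrightarrow> f z = 0" "z \<in> X"
  shows "axis_op d D n c i f z = 0"
proof (cases "z \<in> D")
  case True
  have "of_real (bond n (z i - 1)) * f (z(i := z i - 1)) = 0" "of_real (bond n (z i)) * f (z(i := z i + 1)) = 0"
    using assms(2,3,4) by (auto simp: bond_def chain_closed_def)
  then show ?thesis
    unfolding axis_op_apply[OF assms(1) True] by (simp only: assms(3)[OF assms(4)] mult_zero_right add_0)
qed (rule axis_op_off)

lemma chebU_axis_op_local:
  assumes "i < d" "chain_closed n i X" "\<And>z. z \<in> X \<Longrightarrow> f z = 0" "z \<in> X"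
  shows "chebU j (axis_op d D n c i) f z = 0"
  using assms(4)
proof (induction j arbitrary: z rule: cheb.induct)
  case (3 j)
  then show ?case
    using axis_op_local[OF assms(1,2) "3.IH"(1)] by (simp add: chebU_rec[OF axis_op_linear])
qed (use assms axis_op_local[OF assms(1-3)] in \<open>simp_all add: chebU_0[OF axis_op_linear] chebU_1[OF axis_op_linear]\<close>)

lemma domain_move:
  assumes "z \<in> domain d1 d2" "i < d1 + d2" "z i \<ge> 1 \<longrightarrow> x \<ge> 1"
  shows "z(i := x) \<in> domain d1 d2"
  using assms by (auto simp: domain_def lattice_def)

text \<open>
  On a chain, \<open>U\<^sub>m\<close> of the operator transports the value from \<open>m\<close> sites below to the top end:
  this is the recursion of the Chebyshev polynomials, started at an end without potential.
\<close>

lemma chebU_axis_op_top: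
  fixes d1 d2 n i :: nat and c :: real
  defines "d \<equiv> d1 + d2" and "D \<equiv> domain d1 d2"
  defines "A \<equiv> axis_op d D n c i"
  assumes z: "z \<in> D" and i: "i < d" and k: "int k = int n - cell_pos n (z i)" and m: "m \<le> k"
  shows "chebU m A f (z(i := z i + int k)) = f (z(i := z i + int (k - m)))"
  using m
proof (induction m arbitrary: f rule: cheb.induct)
  case 1
  then show ?case
    by (simp add: A_def chebU_0[OF axis_op_linear])
next
  case 2
  define w where "w = z(i := z i + int k)"
  have w: "w \<in> D" "w i = z i + int k"
    using z i by (auto simp: w_def D_def d_def intro!: domain_move)
  have "cell_pos n (z i + int k) = int n"
    using cell_pos_add[of k n "z i"] k by simp
  moreover have "cell_pos n (z i + int k - 1) \<noteq> int n"
  proof -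
    have eq: "z i + int k - 1 = z i + int (k - 1)"
      using 2 by (simp add: of_nat_diff)
    have "cell_pos n (z i + int (k - 1)) = cell_pos n (z i) + int (k - 1)"
      using cell_pos_add[of "k - 1" n "z i"] k by auto
    then show ?thesis
      unfolding eq using k 2 by (simp add: of_nat_diff)
  qed
  ultimately have "A f w = f (w(i := w i - 1))"
    using 2 k cell_pos_bounds[of n "z i"]
    by (simp add: A_def axis_op_apply[OF i w(1)] w(2) bond_def end_site_def)
  moreover have "w(i := w i - 1) = z(i := z i + int (k - Suc 0))"
    using 2 by (auto simp: w_def of_nat_diff)
  ultimately have "chebU (Suc 0) A f w = f (z(i := z i + int (k - Suc 0)))"
    by (simp only: A_def chebU_1[OF axis_op_linear])
  then show ?case
    unfolding w_def .
next
  case (3 m)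
  have lin: "clinear_op A"
    by (simp add: A_def axis_op_linear)
  define w where "w = z(i := z i + int (k - Suc m))"
  have w: "w \<in> D" "w i = z i + int (k - Suc m)"
    using z i by (auto simp: w_def D_def d_def intro!: domain_move)
  have pos: "cell_pos n (w i) = int n - 1 - int m" "cell_pos n (w i - 1) = int n - 2 - int m"
  proof -
    have "cell_pos n (w i) = cell_pos n (z i) + int (k - Suc m)"
      unfolding w(2) using cell_pos_add[of "k - Suc m" n "z i"] k by auto
    then show "cell_pos n (w i) = int n - 1 - int m"
      using k 3(3) by (simp add: of_nat_diff)
    have "w i - 1 = z i + int (k - Suc (Suc m))"
      unfolding w(2) using 3(3) by (simp add: of_nat_diff)
    then have "cell_pos n (w i - 1) = cell_pos n (z i) + int (k - Suc (Suc m))"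
      using cell_pos_add[of "k - Suc (Suc m)" n "z i"] k by auto
    then show "cell_pos n (w i - 1) = int n - 2 - int m"
      using k 3(3) by (simp add: of_nat_diff)
  qed
  have "cell_pos n (w i) \<noteq> 0"
    using pos(1) k 3(3) cell_pos_bounds[of n "z i"] by auto
  then have "A f w = f (w(i := w i - 1)) + f (w(i := w i + 1))"
    using pos by (simp add: A_def axis_op_apply[OF i w(1)] bond_def end_site_def)
  moreover have "w(i := w i - 1) = z(i := z i + int (k - Suc (Suc m)))" "w(i := w i + 1) = z(i := z i + int (k - m))"
    using 3(3) by (auto simp: w_def of_nat_diff)
  ultimately have "A f w = f (z(i := z i + int (k - Suc (Suc m)))) + f (z(i := z i + int (k - m)))"
    by simp
  moreover have "chebU (Suc m) A (A f) (z(i := z i + int k)) = A f w"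
    unfolding w_def by (rule "3.IH"(1)) (use 3(3) in simp)
  moreover have "chebU m A f (z(i := z i + int k)) = f (z(i := z i + int (k - m)))"
    by (rule "3.IH"(2)) (use 3(3) in simp)
  ultimately show ?case
    unfolding chebU_rec'[OF lin] by (simp only: add_diff_cancel_right')
qed

text \<open>
  The characteristic equation of the two kinds of chains. It is checked at the top end, where the
  previous lemma turns it into the boundary condition at the bottom end, and carried to the other
  sites by operators that commute with it.
\<close>

lemma chebU_axis_op_short:
  fixes d1 d2 n i :: nat and c :: real
  defines "d \<equiv> d1 + d2" and "D \<equiv> domain d1 d2"
  defines "A \<equiv> axis_op d D n c i"
  assumes z: "z \<in> D" and i: "i < d" and short: "z i \<in> short_cell n"
  shows "chebU n A f z = 0"
proof -
  have lin: "clinear_op A"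
    by (simp add: A_def axis_op_linear)
  define b where "b = z(i := 1)"
  have b: "b \<in> D" "b i = 1"
    using z i by (auto simp: b_def D_def d_def intro!: domain_move)
  have n: "n \<ge> 1"
    using short by (auto simp: short_cell_def)
  have pos1: "cell_pos n 1 = 1" "1 \<in> short_cell n"
    using n cell_pos_short[of 1 n] by (auto simp: short_cell_def)
  define t where "t = z(i := int n)"
  have t: "t = b(i := b i + int (n - 1))"
    using n by (auto simp: t_def b_def)
  have top: "chebU m A g t = g (z(i := int n - int m))" if "m \<le> n - 1" for m g
    using chebU_axis_op_top[OF b(1)[unfolded D_def] i[unfolded d_def], of "n - 1" n m c g] that n pos1
    unfolding t A_def D_def d_def by (simp add: b_def of_nat_diff)
  have end0: "chebU n A g t = 0" for g
  proof (cases "n = 1")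
    case True
    have tD: "t \<in> D"
      using b True by (simp add: t_def b_def)
    have "A g t = 0"
      using True pos1 cell_pos_0[of n]
      unfolding A_def axis_op_apply[OF i tD] by (simp add: t_def bond_def end_site_def)
    then show ?thesis
      using True by (simp add: chebU_1[OF lin])
  next
    case False
    then have "n = Suc (Suc (n - 2))"
      using n by simp
    then obtain m where m: "n = Suc (Suc m)"
      by blast
    have "A g b = g (b(i := b i + 1))"
      using False pos1 cell_pos_0[of n] n
      by (simp add: A_def axis_op_apply[OF i b(1)] b(2) bond_def end_site_def)
    moreover have "chebU (Suc m) A (A g) t = A g b" "chebU m A g t = g (b(i := b i + 1))"
      using top[of "Suc m" "A g"] top[of m g] by (auto simp: m b_def)
    ultimately show ?thesis
      by (simp add: m chebU_rec'[OF lin])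
  qed
  define m where "m = nat (int n - z i)"
  have m: "m \<le> n - 1" "int n - int m = z i"
    using short by (auto simp: m_def short_cell_def)
  have "chebU n A f z = chebU m A (chebU n A f) t"
    using top[OF m(1), of "chebU n A f"] by (simp add: m(2))
  also have "\<dots> = 0"
    by (simp add: chebU_chebU[OF lin, of m n] end0)
  finally show ?thesis .
qed

lemma chebU_axis_op_long:
  fixes d1 d2 n i :: nat and c :: real
  defines "d \<equiv> d1 + d2" and "D \<equiv> domain d1 d2"
  defines "A \<equiv> axis_op d D n c i"
  assumes z: "z \<in> D" and i: "i < d" and long: "z i \<notin> short_cell n"
  shows "chebU (Suc n) A f z = of_real c * chebU n A f z"
proof -
  have lin: "clinear_op A"
    by (simp add: A_def axis_op_linear)
  define b where "b = z(i := z i - cell_pos n (z i))"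
  note start = long_cell_start[OF long]
  have b: "b \<in> D" "b i = z i - cell_pos n (z i)"
    using z i start(3) by (auto simp: b_def D_def d_def intro!: domain_move)
  have pos: "cell_pos n (b i) = 0" "b i \<notin> short_cell n"
    using start by (auto simp: b(2))
  define t where "t = b(i := b i + int n)"
  have top: "chebU m A g t = g (b(i := b i + int (n - m)))" if "m \<le> n" for m g
    using chebU_axis_op_top[OF b(1)[unfolded D_def] i[unfolded d_def], of n n m c g] that pos
    unfolding t_def A_def D_def d_def by simp
  have Ab: "A g b = of_real (bond n (b i)) * g (b(i := b i + 1)) + of_real c * g b" for g
    using pos bond_before_start[OF pos(2,1)]
    by (simp add: A_def axis_op_apply[OF i b(1)] end_site_def)
  have end_eq: "chebU (Suc n) A g t = of_real c * chebU n A g t" for g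
  proof (cases n)
    case 0
    then have "t = b" "bond n (b i) = 0"
      using pos by (auto simp: t_def bond_def)
    then show ?thesis
      using 0 by (simp add: chebU_0[OF lin] chebU_1[OF lin] Ab)
  next
    case (Suc m)
    have "chebU (Suc m) A (A g) t = A g b" "chebU m A g t = g (b(i := b i + 1))" "chebU n A g t = g b"
      using top[of "Suc m" "A g"] top[of m g] top[of n g] by (auto simp: Suc)
    moreover have "bond n (b i) = 1"
      using pos Suc by (simp add: bond_def)
    ultimately show ?thesis
      by (simp add: Suc chebU_rec'[OF lin] Ab)
  qed
  define m where "m = n - nat (cell_pos n (z i))"
  have m: "m \<le> n" "b(i := b i + int (n - m)) = z"
    using cell_pos_bounds[of n "z i"] by (auto simp: m_def b_def)
  have "chebU (Suc n) A f z = chebU m A (chebU (Suc n) A f) t"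
    using top[OF m(1), of "chebU (Suc n) A f"] by (simp add: m(2))
  also have "\<dots> = of_real c * chebU m A (chebU n A f) t"
    unfolding chebU_chebU[OF lin, of m "Suc n"] chebU_chebU[OF lin, of m n] by (rule end_eq)
  also have "chebU m A (chebU n A f) t = chebU n A f z"
    using top[OF m(1), of "chebU n A f"] by (simp add: m(2))
  finally show ?thesis .
qed

text \<open>
  The product of the characteristic equations of both kinds of chains annihilates the operator.
\<close>

lemma axis_op_decomposable:
  assumes i: "i < d1 + d2"
  shows "\<exists>R. eigen_decomposable (domain d1 d2) (axis_op (d1 + d2) (domain d1 d2) n c i) R"
proof -
  define A where "A = axis_op (d1 + d2) (domain d1 d2) n c i"
  have lin: "clinear_op A"
    by (simp add: A_def axis_op_linear)
  interpret bounded_symmetric "domain d1 d2" A "(2 * real (d1 + d2) + 1) * (1 + \<bar>c\<bar>)"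
    unfolding A_def by (rule axis_op_bounded_symmetric)
  define q where "q = cheb (Suc n) + smult (- of_real c) (cheb n)"
  have "coeff q (Suc n) = 1"
    using degree_cheb[of "Suc n"] degree_cheb[of n] by (simp add: q_def coeff_eq_0)
  then have "cheb n * q \<noteq> 0"
    using degree_cheb[of n] by auto
  moreover have "poly_op (cheb n * q) A f = (\<lambda>z. 0)" if f: "f \<in> ell2 (domain d1 d2)" for f
  proof
    fix z
    have q: "poly_op q A g z = chebU (Suc n) A g z - of_real c * chebU n A g z" for g
      unfolding q_def chebU_def poly_op_add[OF lin] poly_op_smult[OF lin] by simp
    have both: "poly_op (cheb n * q) A f = chebU n A (poly_op q A f)"
      "poly_op (cheb n * q) A f = poly_op q A (chebU n A f)"
      unfolding chebU_def poly_op_mult[OF lin, symmetric] by (simp_all add: mult.commute)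
    consider "z \<notin> domain d1 d2" | "z \<in> domain d1 d2" "z i \<in> short_cell n" | "z \<in> domain d1 d2" "z i \<notin> short_cell n"
      by blast
    then show "poly_op (cheb n * q) A f z = 0"
    proof cases
      case 1
      have mem: "poly_op p A f \<in> ell2 (domain d1 d2)" for p
        using f by (induction p) (auto simp: poly_op_pCons[OF lin] intro!: ell2_lincomb maps)
      show ?thesis
        by (rule ell2_off[OF mem 1])
    next
      case 2
      show ?thesis
        unfolding both(1) unfolding A_def by (rule chebU_axis_op_short[OF 2(1) i 2(2)])
    next
      case 3
      then show ?thesis
        unfolding both(2) q using chebU_axis_op_long[OF 3(1) i 3(2)] by (simp add: A_def)
    qed
  qed
  ultimately show ?thesis
    using annihilated_imp_eigen_decomposable unfolding A_def[symmetric] by blast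
qed

text \<open>
  The operators act on different coordinates. The restriction to \<open>D\<close> does not interfere, because the
  only way out of \<open>D\<close> would be the bond between \<open>0\<close> and \<open>1\<close>, which is absent.
\<close>

lemma axis_op_commute:
  fixes d1 d2 :: nat
  defines "d \<equiv> d1 + d2" and "D \<equiv> domain d1 d2"
  assumes ij: "i < d" "j < d" "i \<noteq> j"
  shows "axis_op d D n c i (axis_op d D n' c' j f) = axis_op d D n' c' j (axis_op d D n c i f)"
proof
  fix z
  define raw where "raw n c i f z = of_real (bond n (z i - 1)) * f (z(i := z i - 1))
    + of_real (bond n (z i)) * f (z(i := z i + 1)) + of_real (c * end_site n (z i)) * f z"
    for n c i and f :: "point \<Rightarrow> complex" and z
  have nested: "axis_op d D n c i (axis_op d D n' c' j f) z = raw n c i (raw n' c' j f) z"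
    if "z \<in> D" "i < d" "j < d" for i j n n' c c'
  proof -
    have "z(i := z i + 1) \<in> D"
      using that by (auto simp: D_def d_def intro!: domain_move)
    moreover have "z(i := z i - 1) \<in> D \<or> bond n (z i - 1) = 0"
    proof (cases "z i = 1")
      case True
      then show ?thesis
        by (simp add: bond_def cell_pos_0)
    next
      case False
      then show ?thesis
        using that by (auto simp: D_def d_def intro!: domain_move)
    qed
    ultimately show ?thesis
      using that by (auto simp: axis_op_apply raw_def)
  qed
  show "axis_op d D n c i (axis_op d D n' c' j f) z = axis_op d D n' c' j (axis_op d D n c i f) z"
  proof (cases "z \<in> D")
    case True
    have "raw n c i (raw n' c' j f) z = raw n' c' j (raw n c i f) z"
      using ij(3) unfolding raw_def by (simp add: fun_upd_twist[OF ij(3)] algebra_simps)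
    then show ?thesis
      using nested[OF True] ij by simp
  qed (simp add: axis_op_off)
qed

section \<open>Joint kernels\<close>

lemma bounded_symmetric_add:
  assumes "bounded_symmetric S T M" "bounded_symmetric S U M'"
  shows "bounded_symmetric S (\<lambda>f z. T f z + of_real c * U f z) (M + \<bar>c\<bar> * M')"
proof -
  interpret T: bounded_symmetric S T M by fact
  interpret U: bounded_symmetric S U M' by fact
  show ?thesis
  proof
    show "clinear_op (\<lambda>f z. T f z + of_real c * U f z)"
      by (simp add: clinear_op_def clinear_op_simps[OF T.linear] clinear_op_simps[OF U.linear] algebra_simps)
    fix f assume f: "f \<in> ell2 S"
    show "(\<lambda>z. T f z + of_real c * U f z) \<in> ell2 S"
      by (intro ell2_plus ell2_scale T.maps U.maps f)
    have "ell2_norm S (\<lambda>z. T f z + of_real c * U f z) \<le> ell2_norm S (T f) + ell2_norm S (\<lambda>z. of_real c * U f z)"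
      by (intro ell2_plus ell2_scale T.maps U.maps f)
    also have "\<dots> \<le> M * ell2_norm S f + \<bar>c\<bar> * (M' * ell2_norm S f)"
      unfolding ell2_norm_scale norm_of_real
      by (intro add_mono mult_left_mono T.bounded U.bounded f) simp
    finally show "ell2_norm S (\<lambda>z. T f z + of_real c * U f z) \<le> (M + \<bar>c\<bar> * M') * ell2_norm S f"
      by (simp add: algebra_simps)
    fix g assume g: "g \<in> ell2 S"
    have "ell2_inner S (\<lambda>z. T f z + of_real c * U f z) g
        = ell2_inner S (T f) g + ell2_inner S (\<lambda>z. of_real c * U f z) g"
      by (intro ell2_inner_plus_left ell2_scale T.maps U.maps f g)
    also have "\<dots> = ell2_inner S f (T g) + ell2_inner S f (\<lambda>z. of_real c * U g z)"
      by (simp add: ell2_inner_scale_left ell2_inner_scale_right T.symmetric U.symmetric f g)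
    also have "\<dots> = ell2_inner S f (\<lambda>z. T g z + of_real c * U g z)"
      by (intro ell2_inner_plus_right[symmetric] ell2_scale T.maps U.maps f g)
    finally show "ell2_inner S (\<lambda>z. T f z + of_real c * U f z) g
        = ell2_inner S f (\<lambda>z. T g z + of_real c * U g z)" .
  qed
qed

text \<open>
  On an eigenspace of \<open>T\<close> for \<open>q \<noteq> 0\<close> the equation \<open>H f + c T f = 0\<close> reads \<open>H f = - c q f\<close>, which a
  large \<open>c\<close> makes incompatible with the bound of \<open>H\<close>.
\<close>

lemma (in bounded_symmetric) kernel_of_dominant_sum:
  assumes Q: "eigen_decomposable S T Q" and H: "bounded_symmetric S H M'"
    and comm: "\<And>f. f \<in> ell2 S \<Longrightarrow> T (H f) = H (T f)"
    and large: "\<And>q. q \<in> Q \<Longrightarrow> q \<noteq> 0 \<Longrightarrow> M' < \<bar>c * q\<bar>"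
    and f: "f \<in> ell2 S" and zero: "\<And>z. H f z + of_real c * T f z = 0"
  shows "T f = 0" "H f = 0"
proof -
  interpret H: bounded_symmetric S H M' by fact
  obtain g where g: "eigen_family S T Q g" "f = (\<lambda>z. \<Sum>q\<in>Q. g q z)"
    using Q f by (auto simp: eigen_decomposable_def)
  have fin: "finite Q"
    using Q by (simp add: eigen_decomposable_def)
  have gS: "g q \<in> ell2 S" "T (g q) = (\<lambda>z. of_real q * g q z)" if "q \<in> Q" for q
    using g(1) that by (auto simp: eigen_family_def)
  have sum: "L f = (\<lambda>z. \<Sum>q\<in>Q. L (g q) z)" if "clinear_op L" for L
    using clinear_op_sum[OF that, of "\<lambda>q. 1" g Q] by (simp add: g(2))
  define k where "k q = (\<lambda>z. H (g q) z + of_real c * T (g q) z)" for q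
  have "eigen_family S T Q k"
    unfolding eigen_family_def
  proof (intro ballI conjI)
    fix q assume q: "q \<in> Q"
    show "k q \<in> ell2 S"
      unfolding k_def by (intro ell2_plus ell2_scale H.maps maps gS q)
    have "T (H (g q)) = (\<lambda>z. of_real q * H (g q) z)"
      unfolding comm[OF gS(1)[OF q]] gS(2)[OF q] by (rule clinear_op_simps(4)[OF H.linear])
    then show "T (k q) = (\<lambda>z. of_real q * k q z)"
      unfolding k_def clinear_op_simps(2,4)[OF linear] gS(2)[OF q]
      by (simp add: clinear_op_simps[OF linear] gS(2)[OF q] algebra_simps)
  qed
  moreover have "(\<Sum>q\<in>Q. k q z) = 0" for z
    using zero[of z] sum[OF H.linear] sum[OF linear]
    by (simp add: k_def sum.distrib sum_distrib_left)
  ultimately have k0: "k q = 0" if "q \<in> Q" for q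
    using eigen_family_sum_eq_0 fin that by blast
  have g0: "g q = 0" if q: "q \<in> Q" "q \<noteq> 0" for q
  proof (rule ccontr)
    assume "g q \<noteq> 0"
    then have pos: "ell2_norm S (g q) > 0"
      using ell2_norm_eq_0D[OF gS(1)[OF q(1)]] by (metis ell2_norm_nonneg less_eq_real_def)
    have "H (g q) = (\<lambda>z. - of_real (c * q) * g q z)"
    proof
      fix z
      have "H (g q) z + of_real c * (of_real q * g q z) = 0"
        using fun_cong[OF k0[OF q(1)], of z] by (simp add: k_def gS(2)[OF q(1)])
      then have "H (g q) z = - (of_real c * (of_real q * g q z))"
        by (simp only: eq_neg_iff_add_eq_0)
      then show "H (g q) z = - of_real (c * q) * g q z"
        by (simp only: of_real_mult mult_minus_left mult.assoc)
    qed
    then have "ell2_norm S (H (g q)) = \<bar>c * q\<bar> * ell2_norm S (g q)"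
      by (simp only: ell2_norm_scale norm_minus_cancel norm_of_real)
    also have "\<dots> > M' * ell2_norm S (g q)"
      using large[OF q] pos by simp
    finally show False
      using H.bounded[OF gS(1)[OF q(1)]] by simp
  qed
  have "T (g q) z = 0" if "q \<in> Q" for q z
    using g0[OF that] gS(2)[OF that] by (cases "q = 0") auto
  then have "T f z = 0" for z
    using sum[OF linear] by simp
  then show "T f = 0"
    by (simp add: fun_eq_iff)
  with zero show "H f = 0"
    by (auto simp: fun_eq_iff)
qed

text \<open>
  The \<open>h\<^sub>u\<close> are independent by evaluation at the \<open>x\<^sub>v\<close>, and \<open>f - \<Sum> f(x\<^sub>u) h\<^sub>u\<close> vanishes at all \<open>x\<^sub>v\<close>, so that
  they span \<open>K\<close>.
\<close>

lemma dim_by_evaluation: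
  fixes K :: "('a \<Rightarrow> complex) set" and x :: "nat \<Rightarrow> 'a"
  assumes K: "\<And>f g c. f \<in> K \<Longrightarrow> g \<in> K \<Longrightarrow> (\<lambda>z. c * f z + g z) \<in> K" "(\<lambda>z. 0) \<in> K"
    and h: "\<And>u. u < N \<Longrightarrow> h u \<in> K"
    and dual: "\<And>u v. u < N \<Longrightarrow> v < N \<Longrightarrow> h u (x v) = (if u = v then 1 else 0)"
    and det: "\<And>f. f \<in> K \<Longrightarrow> (\<And>u. u < N \<Longrightarrow> f (x u) = 0) \<Longrightarrow> f = 0"
  shows "finite_dim K" "cfun.dim K = N"
proof -
  define B where "B = h ` {..<N}"
  have inj: "inj_on h {..<N}"
  proof (rule inj_onI)
    fix u v assume uv: "u \<in> {..<N}" "v \<in> {..<N}" "h u = h v"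
    have "(if v = u then 1 else 0) = (1 :: complex)"
      using uv dual[of u u] dual[of v u] by (simp only: lessThan_iff) simp
    then show "u = v"
      by (simp split: if_splits)
  qed
  have comb: "(\<lambda>z. \<Sum>u<n. c u * h u z) \<in> K" if "n \<le> N" for n c
    using that by (induction n) (auto simp: K(2) add.commute intro!: K(1) h)
  have span: "K \<subseteq> cfun.span B"
  proof
    fix f assume f: "f \<in> K"
    define g where "g = (\<lambda>z. (- 1) * (\<Sum>u<N. f (x u) * h u z) + f z)"
    have "g \<in> K"
      unfolding g_def by (intro K(1) comb f) simp
    moreover have "g (x v) = 0" if "v < N" for v
    proof -
      have "(\<Sum>u<N. f (x u) * h u (x v)) = (\<Sum>u<N. if u = v then f (x v) else 0)"
        using that by (intro sum.cong) (auto simp: dual)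
      then show ?thesis
        using that by (simp add: g_def)
    qed
    ultimately have g0: "g = 0"
      by (rule det)
    have "f = (\<Sum>u<N. (\<lambda>z. f (x u) * h u z))"
    proof
      fix z
      define s where "s = (\<Sum>u<N. f (x u) * h u z)"
      have "(- 1) * s + f z = 0"
        using fun_cong[OF g0, of z] unfolding g_def s_def by (simp only: zero_fun_apply)
      then have "f z = s"
        by simp
      then show "f z = (\<Sum>u<N. (\<lambda>z. f (x u) * h u z)) z"
        unfolding s_def fun_sum_apply .
    qed
    also have "\<dots> \<in> cfun.span B"
      by (intro cfun.span_sum cfun.span_scale cfun.span_base) (auto simp: B_def)
    finally show "f \<in> cfun.span B" .
  qed
  have indep: "cfun.independent B"
  proof (rule cfun.independent_if_scalars_zero)
    show "finite B"
      by (simp add: B_def)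
    fix w b assume zero: "(\<Sum>b\<in>B. (\<lambda>z. w b * b z)) = 0" and b: "b \<in> B"
    obtain v where v: "v < N" "b = h v"
      using b by (auto simp: B_def)
    have "0 = (\<Sum>b\<in>B. (\<lambda>z. w b * b z)) (x v)"
      using zero by simp
    also have "\<dots> = (\<Sum>u<N. w (h u) * h u (x v))"
      unfolding fun_sum_apply B_def by (simp add: sum.reindex[OF inj])
    also have "\<dots> = (\<Sum>u<N. if u = v then w (h v) else 0)"
      using v(1) by (intro sum.cong) (auto simp: dual)
    finally show "w b = 0"
      using v by simp
  qed
  show "finite_dim K"
    unfolding finite_dim_def using span by (intro exI[of _ B]) (auto simp: B_def)
  have "cfun.dim K = card B"
    by (rule cfun.dim_unique[OF _ span indep]) (auto simp: B_def h)
  then show "cfun.dim K = N"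
    by (simp add: B_def card_image[OF inj])
qed

section \<open>Corner states\<close>

lemma chain_closedI:
  assumes "\<And>z x. z \<in> X \<Longrightarrow> (x \<in> short_cell n \<longleftrightarrow> z i \<in> short_cell n) \<Longrightarrow> z(i := x) \<in> X"
  shows "chain_closed n i X"
  unfolding chain_closed_def
proof (intro ballI conjI impI)
  fix z assume z: "z \<in> X"
  show "z(i := z i + 1) \<in> X" if "cell_pos n (z i) \<noteq> int n"
    using assms[OF z] cell_pos_next(2)[OF that] by blast
  show "z(i := z i - 1) \<in> X" if "cell_pos n (z i - 1) \<noteq> int n"
    using assms[OF z] cell_pos_next(2)[OF that] by simp
qed

locale corner_model =
  fixes d1 d2 N :: nat
  assumes two: "2 \<le> d1 + d2" and N: "1 \<le> N"
begin

abbreviation "d \<equiv> d1 + d2"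
abbreviation "D \<equiv> domain d1 d2"

text \<open>
  Along the first two axes the short cell has \<open>N\<close> sites; along the others it is a single site and the
  long cells are dimers. Different end potentials along the first two axes separate the spectra of the
  long chains; as \<open>A\<^sub>0\<close> and \<open>A\<^sub>1\<close> enter with opposite signs, positive ones yield spectrum on both sides.
\<close>

definition cell_size :: "nat \<Rightarrow> nat" where
  "cell_size i = (if i < 2 then N else 1)"

definition strength :: "nat \<Rightarrow> real" where
  "strength i = (if i = 0 then 1 else if i = 1 then 2 else 0)"

definition A :: "nat \<Rightarrow> point operator" where
  "A i = axis_op d D (cell_size i) (strength i) i"

text \<open>
  The elements will turn out to live in the corner, where \<open>A\<^sub>0\<close> and \<open>A\<^sub>1\<close> are the same path matrix acting on
  rows and on columns. So this is the space of matrices commuting with a matrix that has \<open>N\<close> simple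
  eigenvalues.
\<close>

definition corner_space :: "(point \<Rightarrow> complex) set" where
  "corner_space = {f \<in> ell2 D. A 0 f = A 1 f \<and> (\<forall>i\<in>{2..<d}. A i f = (\<lambda>z. 0))}"

definition corner :: "point set" where
  "corner = {z. z 0 \<in> short_cell N \<and> z 1 \<in> short_cell N \<and> (\<forall>i\<in>{2..<d}. z i = 1)}"

lemma A_linear: "clinear_op (A i)"
  unfolding A_def by (rule axis_op_linear)

lemma A_commute: "i < d \<Longrightarrow> j < d \<Longrightarrow> A i (A j f) = A j (A i f)"
  unfolding A_def by (cases "i = j") (auto intro: axis_op_commute)

lemma A_bounded_symmetric: "\<exists>M. bounded_symmetric D (A i) M"
  unfolding A_def using axis_op_bounded_symmetric by blast

lemma chebU_A_off: "f \<in> ell2 D \<Longrightarrow> z \<notin> D \<Longrightarrow> chebU j (A i) f z = 0"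
proof (induction j rule: cheb.induct)
  case 1
  then show ?case
    by (simp add: chebU_0[OF A_linear] ell2_off)
next
  case 2
  then show ?case
    by (simp add: chebU_1[OF A_linear]) (simp add: A_def axis_op_off)
next
  case (3 j)
  have "A i (chebU (Suc j) (A i) f) z = 0"
    using 3(4) by (simp add: A_def axis_op_off)
  then show ?case
    using 3 by (simp add: chebU_rec[OF A_linear])
qed

text \<open>For \<open>i \<ge> 2\<close> the long cells are dimers, on which \<open>A\<^sub>i\<close> just exchanges the two sites.\<close>

lemma corner_space_slab:
  assumes f: "f \<in> corner_space" and i: "i \<in> {2..<d}" and zi: "z i \<noteq> 1"
  shows "f z = 0"
proof (cases "z \<in> D")
  case False
  have "f \<in> ell2 D"
    using f by (simp add: corner_space_def)
  then show ?thesis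
    using False by (rule ell2_off)
next
  case True
  have size: "cell_size i = 1" "strength i = 0"
    using i by (auto simp: cell_size_def strength_def)
  have id: "i < d"
    using i by simp
  have A0: "A i f w = 0" for w
    using f i by (simp add: corner_space_def)
  have long: "z i \<notin> short_cell 1"
    using zi by (auto simp: short_cell_def)
  have A_eq: "A i f w = of_real (bond 1 (w i - 1)) * f (w(i := w i - 1)) + of_real (bond 1 (w i)) * f (w(i := w i + 1))"
    if "w \<in> D" for w
    unfolding A_def size axis_op_apply[OF id that] by simp
  show ?thesis
  proof (cases "cell_pos 1 (z i) = 0")
    case True
    define w where "w = z(i := z i + 1)"
    have w: "w \<in> D" "w i = z i + 1"
      using \<open>z \<in> D\<close> i by (auto simp: w_def intro!: domain_move)
    have "cell_pos 1 (w i) = 1"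
      using cell_pos_next(1)[of 1 "z i"] True by (simp add: w(2))
    then have "A i f w = f (w(i := w i - 1))"
      unfolding A_eq[OF w(1)] using True by (simp add: bond_def w(2))
    then show ?thesis
      by (simp add: A0 w_def)
  next
    case False
    then have pos: "cell_pos 1 (z i) = 1"
      using cell_pos_bounds[of 1 "z i"] by auto
    define w where "w = z(i := z i - 1)"
    note start = long_cell_start[OF long, unfolded pos]
    have w: "w \<in> D" "w i = z i - 1"
      using \<open>z \<in> D\<close> i start(3) by (auto simp: w_def intro!: domain_move)
    have "cell_pos 1 (w i) = 0" "w i \<notin> short_cell 1"
      using start(1,2) unfolding w(2) .
    then have "bond 1 (w i - 1) = 0" "bond 1 (w i) = 1"
      by (intro bond_before_start, simp_all add: bond_def)
    then have "A i f w = f (w(i := w i + 1))"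
      unfolding A_eq[OF w(1)] by simp
    then show ?thesis
      by (simp add: A0 w_def)
  qed
qed

lemma corner_space_chebU:
  assumes "f \<in> corner_space"
  shows "chebU j (A 0) f = chebU j (A 1) f"
proof (induction j rule: cheb.induct)
  case 1
  then show ?case
    by (simp add: chebU_0[OF A_linear])
next
  case 2
  then show ?case
    using assms by (simp add: chebU_1[OF A_linear] corner_space_def)
next
  case (3 j)
  have "A 0 (chebU (Suc j) (A 0) f) = chebU (Suc j) (A 1) (A 0 f)"
    unfolding "3.IH"(1) using two by (intro chebU_commute A_linear A_commute) auto
  also have "A 0 f = A 1 f"
    using assms by (simp add: corner_space_def)
  also have "chebU (Suc j) (A 1) (A 1 f) = A 1 (chebU (Suc j) (A 1) f)"
    by (intro chebU_commute[symmetric] A_linear refl)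
  finally show ?case
    by (simp add: chebU_rec[OF A_linear] "3.IH"(2))
qed

text \<open>
  Where one of the first two coordinates lies in a long cell, the characteristic equations of the
  chains in both directions force \<open>U\<^sub>N f = U\<^sub>N\<^sub>+\<^sub>1 f = 0\<close>; for two long cells this uses that the strengths
  differ. The recursion then goes down to \<open>U\<^sub>0 f = f\<close>.
\<close>

lemma corner_space_off_corner:
  assumes f: "f \<in> corner_space" and z: "z \<notin> corner"
  shows "f z = 0"
proof (cases "\<exists>i\<in>{2..<d}. z i \<noteq> 1")
  case True
  then show ?thesis
    using corner_space_slab[OF f] by blast
next
  case False
  define X where "X = {z::point. \<not> (z 0 \<in> short_cell N \<and> z 1 \<in> short_cell N)}"
  have zX: "z \<in> X"
    using False z by (auto simp: X_def corner_def)
  have fS: "f \<in> ell2 D"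
    using f by (simp add: corner_space_def)
  have closed: "chain_closed N 0 X"
    by (rule chain_closedI) (auto simp: X_def)
  have idx: "0 < d" "1 < d"
    using two by auto
  have long0: "chebU (Suc N) (A 0) f w = of_real 1 * chebU N (A 0) f w" if "w \<in> D" "w 0 \<notin> short_cell N" for w
    using chebU_axis_op_long[OF that(1) idx(1) that(2), of 1 f] by (simp add: A_def cell_size_def strength_def)
  have long1: "chebU (Suc N) (A 1) f w = of_real 2 * chebU N (A 1) f w" if "w \<in> D" "w 1 \<notin> short_cell N" for w
    using chebU_axis_op_long[OF that(1) idx(2) that(2), of 2 f] by (simp add: A_def cell_size_def strength_def)
  have short0: "chebU N (A 0) f w = 0" if "w \<in> D" "w 0 \<in> short_cell N" for w
    using chebU_axis_op_short[OF that(1) idx(1) that(2), of 1 f] by (simp add: A_def cell_size_def strength_def)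
  have short1: "chebU N (A 1) f w = 0" if "w \<in> D" "w 1 \<in> short_cell N" for w
    using chebU_axis_op_short[OF that(1) idx(2) that(2), of 2 f] by (simp add: A_def cell_size_def strength_def)
  have start: "chebU N (A 0) f w = 0 \<and> chebU (Suc N) (A 0) f w = 0" if wX: "w \<in> X" for w
  proof (cases "w \<in> D")
    case False
    then show ?thesis
      using chebU_A_off[OF fS] by blast
  next
    case True
    note eq = corner_space_chebU[OF f]
    consider "w 0 \<in> short_cell N" "w 1 \<notin> short_cell N" | "w 0 \<notin> short_cell N" "w 1 \<in> short_cell N"
      | "w 0 \<notin> short_cell N" "w 1 \<notin> short_cell N"
      using wX by (auto simp: X_def)
    then show ?thesis
    proof cases
      case 1
      then show ?thesis
        using short0[OF True] long1[OF True] by (simp add: eq)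
    next
      case 2
      then show ?thesis
        using short1[OF True] long0[OF True] by (simp add: eq)
    next
      case 3
      then show ?thesis
        using long0[OF True] long1[OF True] by (simp add: eq)
    qed
  qed
  have "\<forall>w\<in>X. chebU (N - k) (A 0) f w = 0 \<and> chebU (Suc (N - k)) (A 0) f w = 0" if "k \<le> N" for k
    using that
  proof (induction k)
    case 0
    then show ?case
      using start by simp
  next
    case (Suc k)
    define j where "j = N - Suc k"
    have j: "N - k = Suc j"
      using Suc.prems by (simp add: j_def)
    have IH: "chebU (Suc j) (A 0) f w = 0" "chebU (Suc (Suc j)) (A 0) f w = 0" if "w \<in> X" for w
      using Suc that by (auto simp: j)
    have "chebU j (A 0) f w = 0" if w: "w \<in> X" for w
    proof -
      have "A 0 (chebU (Suc j) (A 0) f) w = 0"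
      proof -
        have "axis_op d D N 1 0 (chebU (Suc j) (A 0) f) w = 0"
          by (rule axis_op_local[OF idx(1) closed _ w]) (rule IH(1))
        then show ?thesis
          by (simp add: A_def cell_size_def strength_def)
      qed
      then show ?thesis
        using IH(2)[OF w] by (simp add: chebU_rec[OF A_linear])
    qed
    then show ?case
      using IH by (simp add: j_def[symmetric])
  qed
  from this[of N] show ?thesis
    using zX by (simp add: chebU_0[OF A_linear])
qed

definition corner_site :: "int \<Rightarrow> int \<Rightarrow> point" where
  "corner_site x y = (\<lambda>i. if i = 0 then x else if i = 1 then y else if i < d then 1 else 0)"

lemma corner_site_eq: "z \<in> D \<Longrightarrow> z \<in> corner \<Longrightarrow> z = corner_site (z 0) (z 1)"
  using two by (auto simp: corner_def corner_site_def domain_def lattice_def fun_eq_iff)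

lemma corner_site_in_domain: "x \<ge> 1 \<Longrightarrow> y \<ge> 1 \<Longrightarrow> corner_site x y \<in> D"
  using two by (auto simp: corner_site_def domain_def lattice_def)

definition top_site :: "nat \<Rightarrow> point" where
  "top_site u = corner_site (int u + 1) (int N)"

lemma top_row:
  assumes "w \<in> D" "w \<in> corner" "w 1 = int N"
  shows "\<exists>u<N. w = top_site u"
proof -
  have "w = top_site (nat (w 0 - 1))" "nat (w 0 - 1) < N"
    using corner_site_eq[OF assms(1,2)] assms by (auto simp: top_site_def corner_def short_cell_def)
  then show ?thesis
    by blast
qed

text \<open>In the corner, \<open>f\<close> is transported down from the top row by \<open>U\<^sub>m(A\<^sub>1) = U\<^sub>m(A\<^sub>0)\<close>.\<close>

lemma corner_space_determined:
  assumes f: "f \<in> corner_space" and zero: "\<And>u. u < N \<Longrightarrow> f (top_site u) = 0"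
  shows "f = 0"
proof -
  have fS: "f \<in> ell2 D"
    using f by (simp add: corner_space_def)
  define X where "X = {w::point. w 1 = int N}"
  have closed: "chain_closed N 0 X"
    by (rule chain_closedI) (simp add: X_def)
  have fX: "f w = 0" if "w \<in> X" for w
  proof (cases "w \<in> D \<and> w \<in> corner")
    case True
    then show ?thesis
      using top_row[of w] zero that by (auto simp: X_def)
  next
    case False
    then show ?thesis
      using corner_space_off_corner[OF f, of w] ell2_off[OF fS, of w] by blast
  qed
  have "f z = 0" for z
  proof (cases "z \<in> D \<and> z \<in> corner")
    case True
    define m where "m = nat (int N - z 1)"
    have z1: "z 1 \<in> short_cell N"
      using True by (simp add: corner_def)
    then have m: "int m = int N - cell_pos N (z 1)" "z 1 + int m = int N"
      using cell_pos_short[OF z1] by (auto simp: m_def short_cell_def)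
    have "f z = chebU m (A 1) f (z(1 := z 1 + int m))"
      using chebU_axis_op_top[of z d1 d2 1 m N m 2 f] True two m(1)
      by (simp add: A_def cell_size_def strength_def)
    also have "\<dots> = chebU m (A 0) f (z(1 := int N))"
      by (simp only: corner_space_chebU[OF f] m(2))
    also have "\<dots> = 0"
    proof -
      have "chebU m (axis_op d D N 1 0) f (z(1 := int N)) = 0"
        by (rule chebU_axis_op_local[OF _ closed fX]) (use two in \<open>auto simp: X_def\<close>)
      then show ?thesis
        by (simp add: A_def cell_size_def strength_def)
    qed
    finally show ?thesis .
  next
    case False
    then show ?thesis
      using corner_space_off_corner[OF f, of z] ell2_off[OF fS, of z] by blast
  qed
  then show ?thesis
    by (simp add: fun_eq_iff)
qed

text \<open>
  \<open>A\<^sub>0 f = A\<^sub>1 f\<close> is a discrete wave equation with the second coordinate as time. This is its solution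
  that starts from a unit vector in the top row, computed by the Chebyshev recursion.
\<close>

definition corner_state :: "nat \<Rightarrow> point \<Rightarrow> complex" where
  "corner_state u z = (if z \<in> D \<and> z \<in> corner
    then chebU (nat (int N - z 1)) (A 0) (\<lambda>w. if w = top_site u then 1 else 0) (z(1 := int N)) else 0)"

lemma corner_state_top: "u < N \<Longrightarrow> v < N \<Longrightarrow> corner_state u (top_site v) = (if u = v then 1 else 0)"
proof -
  assume "u < N" "v < N"
  then have "top_site v \<in> D" "top_site v \<in> corner" "(top_site v) 1 = int N" "top_site v = top_site u \<longleftrightarrow> v = u"
    using two N by (auto simp: top_site_def corner_def corner_site_def short_cell_def fun_eq_iff
        intro!: corner_site_in_domain[unfolded corner_site_def] split: if_splits)
  moreover have "(top_site v)(1 := int N) = top_site v"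
    using calculation(3) by auto
  ultimately show ?thesis
    by (auto simp: corner_state_def chebU_0[OF A_linear])
qed

text \<open>
  The equation at the bottom row is the boundary condition \<open>U\<^sub>N(A\<^sub>0) = 0\<close>, the characteristic equation of
  the short chain.
\<close>

lemma corner_state_in_corner_space:
  "corner_state u \<in> corner_space"
proof -
  define h where "h = corner_state u"
  define e :: "point \<Rightarrow> complex" where "e = (\<lambda>w. if w = top_site u then 1 else 0)"
  define G where "G m = chebU m (A 0) e" for m
  have h_in: "h z = G (nat (int N - z 1)) (z(1 := int N))" if "z \<in> D" "z \<in> corner" for z
    using that by (simp add: h_def corner_state_def G_def e_def)
  have h_out: "h z = 0" if "z \<notin> corner \<or> z \<notin> D" for z
    using that by (auto simp: h_def corner_state_def)
  have "D \<inter> corner \<subseteq> (\<lambda>(x, y). corner_site x y) ` (short_cell N \<times> short_cell N)"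
  proof
    fix z assume "z \<in> D \<inter> corner"
    then show "z \<in> (\<lambda>(x, y). corner_site x y) ` (short_cell N \<times> short_cell N)"
      using corner_site_eq[of z] by (intro image_eqI[of _ _ "(z 0, z 1)"]) (auto simp: corner_def)
  qed
  then have "finite (D \<inter> corner)"
    by (rule finite_subset) (simp add: short_cell_def)
  then have hS: "h \<in> ell2 D"
    by (rule ell2_finite_support(1)) (auto simp: h_out)
  have idx: "0 < d" "1 < d"
    using two by auto
  have closed: "chain_closed N 0 (- corner)" "chain_closed N 1 (- corner)"
    by (rule chain_closedI; auto simp: corner_def)+
  have off: "A 0 h z = 0" "A 1 h z = 0" if "z \<notin> corner" for z
  proof -
    have "axis_op d D N 1 0 h z = 0"
      by (rule axis_op_local[OF idx(1) closed(1)]) (use that h_out in auto)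
    moreover have "axis_op d D N 2 1 h z = 0"
      by (rule axis_op_local[OF idx(2) closed(2)]) (use that h_out in auto)
    ultimately show "A 0 h z = 0" "A 1 h z = 0"
      by (simp_all add: A_def cell_size_def strength_def)
  qed
  have "A 0 h z = A 1 h z" for z
  proof (cases "z \<in> D \<and> z \<in> corner")
    case False
    then show ?thesis
      using off[of z] by (auto simp: A_def axis_op_off)
  next
    case True
    define m where "m = nat (int N - z 1)"
    define w where "w = z(1 := int N)"
    have z: "z \<in> D" "z 0 \<in> short_cell N" "z 1 \<in> short_cell N" "z \<in> corner"
      using True by (auto simp: corner_def)
    have w: "w \<in> D" "w 0 = z 0"
      using z(1) two N by (auto simp: w_def intro!: domain_move)
    have pos: "cell_pos N (z 0) = z 0" "cell_pos N (z 1) = z 1" "z 0 \<ge> 1" "z 1 \<ge> 1" "z 0 \<le> int N" "z 1 \<le> int N"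
      using z cell_pos_short by (auto simp: short_cell_def)
    have m: "int m = int N - z 1"
      using pos by (simp add: m_def)
    have bond: "bond N (x - 1) = (if x = 1 then 0 else 1)" "bond N x = (if x = int N then 0 else 1)"
      "end_site N x = 0" if "x \<in> short_cell N" for x
    proof -
      show "bond N x = (if x = int N then 0 else 1)" "end_site N x = 0"
        using that cell_pos_short[OF that] by (auto simp: bond_def end_site_def short_cell_def)
      show "bond N (x - 1) = (if x = 1 then 0 else 1)"
      proof (cases "x = 1")
        case False
        then have "x - 1 \<in> short_cell N" "x - 1 \<noteq> int N"
          using that by (auto simp: short_cell_def)
        then show ?thesis
          using False cell_pos_short[of "x - 1" N] by (simp add: bond_def)
      qed (simp add: bond_def cell_pos_0)
    qed
    have A0: "A 0 g y = of_real (bond N (y 0 - 1)) * g (y(0 := y 0 - 1)) + of_real (bond N (y 0)) * g (y(0 := y 0 + 1))"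
      if "y \<in> D" "y 0 \<in> short_cell N" for g y
      using bond[OF that(2)] axis_op_apply[OF idx(1) that(1), of N 1 g]
      by (simp add: A_def cell_size_def strength_def)
    have A1: "A 1 h z = of_real (bond N (z 1 - 1)) * h (z(1 := z 1 - 1)) + of_real (bond N (z 1)) * h (z(1 := z 1 + 1))"
      using bond[OF z(3)] axis_op_apply[OF idx(2) z(1), of N 2 h]
      by (simp add: A_def cell_size_def strength_def)
    have move0: "of_real (bond N b) * h (z(0 := x)) = of_real (bond N b) * G m (w(0 := x))"
      if "x \<in> short_cell N \<or> bond N b = 0" for x b
    proof (cases "bond N b = 0")
      case False
      then have x: "x \<in> short_cell N"
        using that by simp
      have "z(0 := x) \<in> D"
        using z(1) x two by (auto simp: short_cell_def intro!: domain_move)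
      moreover have "z(0 := x) \<in> corner"
        using z x by (auto simp: corner_def)
      moreover have "z(0 := x, 1 := int N) = w(0 := x)"
        unfolding w_def by (rule fun_upd_twist) simp
      ultimately show ?thesis
        by (simp add: h_in m_def)
    qed simp
    have "A 0 h z = of_real (bond N (z 0 - 1)) * G m (w(0 := z 0 - 1)) + of_real (bond N (z 0)) * G m (w(0 := z 0 + 1))"
    proof -
      have "z 0 - 1 \<in> short_cell N \<or> bond N (z 0 - 1) = 0" "z 0 + 1 \<in> short_cell N \<or> bond N (z 0) = 0"
        using bond[OF z(2)] pos by (auto simp: short_cell_def)
      then show ?thesis
        unfolding A0[OF z(1,2)] using move0 by metis
    qed
    also have "\<dots> = A 0 (G m) w"
      using A0[OF w(1), of "G m"] z(2) by (simp add: w(2))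
    finally have lhs: "A 0 h z = A 0 (G m) w" .
    have GN: "G N w = 0"
      using chebU_axis_op_short[OF w(1) idx(1), of N 1 e] z(2)
      by (simp add: G_def A_def cell_size_def strength_def w(2))
    have move1: "h (z(1 := x)) = G (nat (int N - x)) w" if "x \<in> short_cell N" for x
    proof -
      have "z(1 := x) \<in> D"
        using z(1) that two by (auto simp: short_cell_def intro!: domain_move)
      moreover have "z(1 := x) \<in> corner"
        using z that by (auto simp: corner_def)
      ultimately show ?thesis
        by (simp add: h_in w_def)
    qed
    have down: "of_real (bond N (z 1 - 1)) * h (z(1 := z 1 - 1)) = G (Suc m) w"
    proof (cases "z 1 = 1")
      case True
      then have "Suc m = N"
        using m N by simp
      then show ?thesis
        using True bond(1)[OF z(3)] GN by simp
    next
      case False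
      then have "z 1 - 1 \<in> short_cell N" "nat (int N - (z 1 - 1)) = Suc m"
        using pos m by (auto simp: short_cell_def)
      then show ?thesis
        using False bond(1)[OF z(3)] move1 by simp
    qed
    have "A 0 (G m) w = A 1 h z"
    proof (cases m)
      case 0
      then have "z 1 = int N"
        using m by simp
      then show ?thesis
        unfolding A1 down using bond(2)[OF z(3)] 0 by (simp add: G_def chebU_0[OF A_linear] chebU_1[OF A_linear])
    next
      case (Suc k)
      then have "z 1 + 1 \<in> short_cell N" "nat (int N - (z 1 + 1)) = k" "z 1 \<noteq> int N"
        using pos m by (auto simp: short_cell_def)
      then have "of_real (bond N (z 1)) * h (z(1 := z 1 + 1)) = G k w"
        using bond(2)[OF z(3)] move1 by simp
      then show ?thesis
        unfolding A1 down by (simp add: Suc G_def chebU_rec[OF A_linear])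
    qed
    then show ?thesis
      by (simp add: lhs)
  qed
  moreover have "A i h z = 0" if i: "i \<in> {2..<d}" for i z
  proof (cases "z i = 1")
    case True
    show ?thesis
    proof (cases "z \<in> D")
      case zD: True
      have "chebU 1 (axis_op d D 1 0 i) h z = 0"
        by (rule chebU_axis_op_short[OF zD]) (use i True in \<open>auto simp: short_cell_def\<close>)
      then show ?thesis
        using i by (simp add: A_def cell_size_def strength_def chebU_1[OF axis_op_linear])
    qed (simp add: A_def axis_op_off)
  next
    case False
    have closed: "chain_closed 1 i {z. z i \<noteq> 1}"
      by (rule chain_closedI) (auto simp: short_cell_def)
    have "h y = 0" if "y i \<noteq> 1" for y
    proof -
      have "y \<notin> corner"
        using that i unfolding corner_def by blast
      then show ?thesis
        using h_out by blast
    qed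
    then have "axis_op d D 1 0 i h z = 0"
      using axis_op_local[OF _ closed, where z = z and f = h and D = D and c = 0 and d = d] False i by auto
    then show ?thesis
      using i by (simp add: A_def cell_size_def strength_def)
  qed
  ultimately show ?thesis
    unfolding corner_space_def h_def[symmetric] using hS by auto
qed

lemma corner_space_dim: "finite_dim corner_space" "cfun.dim corner_space = N"
proof -
  have comb: "(\<lambda>z. c * f z + g z) \<in> corner_space" if "f \<in> corner_space" "g \<in> corner_space" for f g c
    using that by (auto simp: corner_space_def ell2_lincomb clinear_op_simps[OF A_linear])
  have zero: "(\<lambda>z. 0) \<in> corner_space"
    by (simp add: corner_space_def clinear_op_simps[OF A_linear])
  show "finite_dim corner_space" "cfun.dim corner_space = N"
    by (rule dim_by_evaluation[of _ N corner_state top_site, OF comb zero corner_state_in_corner_space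
          corner_state_top corner_space_determined]; assumption)+
qed

definition H :: "(nat \<Rightarrow> real) \<Rightarrow> nat \<Rightarrow> point operator" where
  "H t k f = (\<lambda>z. \<Sum>i<k. of_real (t i) * A i f z)"

text \<open>
  Each further axis gets such a large coefficient that the kernel of the sum is the joint kernel.
\<close>

lemma exists_coefficients:
  assumes "2 \<le> k" "k \<le> d"
  shows "\<exists>t M R. t 0 = 1 \<and> t 1 = - 1 \<and> bounded_symmetric D (H t k) M \<and> eigen_decomposable D (H t k) R \<and>
    (\<forall>f\<in>ell2 D. H t k f = (\<lambda>z. 0) \<longrightarrow> A 0 f = A 1 f \<and> (\<forall>i\<in>{2..<k}. A i f = (\<lambda>z. 0)))"
  using assms
proof (induction k rule: nat_induct_at_least)
  case base
  define t :: "nat \<Rightarrow> real" where "t i = (if i = 0 then 1 else - 1)" for i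
  have idx: "0 < d" "1 < d"
    using two by auto
  have H: "H t 2 = (\<lambda>f z. A 0 f z + of_real (-1) * A 1 f z)"
    by (auto simp: H_def t_def fun_eq_iff numeral_2_eq_2)
  obtain M0 M1 where M: "bounded_symmetric D (A 0) M0" "bounded_symmetric D (A 1) M1"
    using A_bounded_symmetric by blast
  interpret A0: bounded_symmetric D "A 0" M0 by fact
  interpret A1: bounded_symmetric D "A 1" M1 by fact
  obtain R0 R1 where R: "eigen_decomposable D (A 0) R0" "eigen_decomposable D (A 1) R1"
    using axis_op_decomposable[OF idx(1)] axis_op_decomposable[OF idx(2)] unfolding A_def by metis
  have "eigen_decomposable D (\<lambda>f z. of_real (-1) * A 1 f z) ((\<lambda>r. (-1) * r + 0) ` R1)"
    by (rule eigen_decomposable_affine[OF R(2)]) auto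
  then have "eigen_decomposable D (\<lambda>f z. A 0 f z + of_real (-1) * A 1 f z)
      ((\<lambda>(r, q). r + q) ` (R0 \<times> (\<lambda>r. (-1) * r + 0) ` R1))"
  proof (rule A0.eigen_decomposable_commuting_sum[OF R(1)])
    show "clinear_op (\<lambda>f z. of_real (-1) * A 1 f z)"
      by (simp add: clinear_op_def clinear_op_simps[OF A_linear] algebra_simps)
    show "(\<lambda>z. of_real (-1) * A 1 f z) \<in> ell2 D" if "f \<in> ell2 D" for f
      by (intro ell2_scale A1.maps that)
    show "(\<lambda>z. of_real (-1) * A 1 (A 0 f) z) = A 0 (\<lambda>z. of_real (-1) * A 1 f z)" for f
      unfolding clinear_op_simps(4)[OF A_linear] A_commute[OF idx] ..
  qed
  moreover have "bounded_symmetric D (\<lambda>f z. A 0 f z + of_real (-1) * A 1 f z) (M0 + \<bar>-1\<bar> * M1)"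
    by (rule bounded_symmetric_add[OF M])
  moreover have "A 0 f = A 1 f" if "H t 2 f = (\<lambda>z. 0)" for f
    using that unfolding H by (auto simp: fun_eq_iff)
  moreover have "t 0 = 1" "t 1 = - 1"
    by (auto simp: t_def)
  ultimately show ?case
    unfolding H[symmetric] by auto
next
  case (Suc k)
  then obtain t M R where t: "t 0 = 1" "t 1 = - 1" and M: "bounded_symmetric D (H t k) M"
    and R: "eigen_decomposable D (H t k) R"
    and ker: "\<And>f. f \<in> ell2 D \<Longrightarrow> H t k f = (\<lambda>z. 0) \<Longrightarrow> A 0 f = A 1 f \<and> (\<forall>i\<in>{2..<k}. A i f = (\<lambda>z. 0))"
    by auto
  have k: "k < d"
    using Suc.prems by simp
  obtain M' where M': "bounded_symmetric D (A k) M'"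
    using A_bounded_symmetric by blast
  interpret Hk: bounded_symmetric D "H t k" M by fact
  interpret Ak: bounded_symmetric D "A k" M' by fact
  obtain Q where Q: "eigen_decomposable D (A k) Q"
    using axis_op_decomposable[OF k] unfolding A_def by metis
  have comm: "A k (H t k f) = H t k (A k f)" for f
    unfolding H_def clinear_op_sum[OF A_linear] using k by (simp add: A_commute)
  define \<delta> where "\<delta> = Min (insert 1 ((\<lambda>q. \<bar>q\<bar>) ` (Q - {0})))"
  have fin: "finite Q"
    using Q by (simp add: eigen_decomposable_def)
  have \<delta>: "\<delta> > 0" "\<And>q. q \<in> Q \<Longrightarrow> q \<noteq> 0 \<Longrightarrow> \<delta> \<le> \<bar>q\<bar>"
    using fin by (auto simp: \<delta>_def intro: Min_le)
  define c where "c = (\<bar>M\<bar> + 1) / \<delta>"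
  have c: "c > 0" "c * \<delta> = \<bar>M\<bar> + 1"
    using \<delta>(1) by (auto simp: c_def)
  have large: "M < \<bar>c * q\<bar>" if "q \<in> Q" "q \<noteq> 0" for q
  proof -
    have "\<bar>M\<bar> + 1 \<le> c * \<bar>q\<bar>"
      using mult_left_mono[OF \<delta>(2)[OF that], of c] c by simp
    then show ?thesis
      using c(1) by (simp add: abs_mult)
  qed
  define t' where "t' = t(k := c)"
  have H': "H t' (Suc k) = (\<lambda>f z. H t k f z + of_real c * A k f z)"
    by (auto simp: H_def t'_def fun_eq_iff intro!: sum.cong)
  have "eigen_decomposable D (\<lambda>f z. of_real c * A k f z) ((\<lambda>q. c * q + 0) ` Q)"
    using c(1) by (intro eigen_decomposable_affine[OF Q]) auto
  then have "eigen_decomposable D (\<lambda>f z. H t k f z + of_real c * A k f z)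
      ((\<lambda>(r, q). r + q) ` (R \<times> (\<lambda>q. c * q + 0) ` Q))"
  proof (rule Hk.eigen_decomposable_commuting_sum[OF R])
    show "clinear_op (\<lambda>f z. of_real c * A k f z)"
      by (simp add: clinear_op_def clinear_op_simps[OF A_linear] algebra_simps)
    show "(\<lambda>z. of_real c * A k f z) \<in> ell2 D" if "f \<in> ell2 D" for f
      by (intro ell2_scale Ak.maps that)
    show "(\<lambda>z. of_real c * A k (H t k f) z) = H t k (\<lambda>z. of_real c * A k f z)" for f
      by (simp add: comm clinear_op_simps[OF Hk.linear])
  qed
  moreover have "bounded_symmetric D (\<lambda>f z. H t k f z + of_real c * A k f z) (M + \<bar>c\<bar> * M')"
    by (rule bounded_symmetric_add[OF M M'])
  moreover have "A 0 f = A 1 f \<and> (\<forall>i\<in>{2..<Suc k}. A i f = (\<lambda>z. 0))"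
    if f: "f \<in> ell2 D" and zero: "H t' (Suc k) f = (\<lambda>z. 0)" for f
  proof -
    have "H t k f z + of_real c * A k f z = 0" for z
      using zero by (simp add: H' fun_eq_iff)
    from Ak.kernel_of_dominant_sum[OF Q M comm large f this]
    have "A k f = (\<lambda>z. 0)" "H t k f = (\<lambda>z. 0)"
      by (simp_all add: zero_fun_def)
    then show ?thesis
      using ker[OF f] by (auto simp: less_Suc_eq)
  qed
  moreover have "t' 0 = 1" "t' 1 = - 1"
    using t Suc.hyps by (auto simp: t'_def)
  ultimately show ?case
    unfolding H'[symmetric] by blast
qed

lemma H_kernel:
  assumes "2 \<le> d" "t 0 = 1" "t 1 = - 1"
    and "\<And>f. f \<in> ell2 D \<Longrightarrow> H t d f = (\<lambda>z. 0) \<Longrightarrow> A 0 f = A 1 f \<and> (\<forall>i\<in>{2..<d}. A i f = (\<lambda>z. 0))"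
  shows "{f \<in> ell2 D. H t d f = (\<lambda>z. 0)} = corner_space"
proof -
  have "H t d f = (\<lambda>z. 0)" if f: "f \<in> corner_space" for f
  proof
    fix z
    have split: "{..<d} = {0, 1} \<union> {2..<d}"
      using assms(1) by auto
    have "H t d f z = of_real (t 0) * A 0 f z + of_real (t 1) * A 1 f z + (\<Sum>i\<in>{2..<d}. of_real (t i) * A i f z)"
      unfolding H_def split by (subst sum.union_disjoint) auto
    then show "H t d f z = 0"
      using f assms(2,3) by (simp add: corner_space_def)
  qed
  then show ?thesis
    using assms(4) by (auto simp: corner_space_def)
qed

end

section \<open>The prescribed gap\<close>

text \<open>
  On each octant every coordinate keeps its sign, so that \<open>cell_pos\<close> reduces to one of its two branches,
  which are periodic.
\<close>

lemma octant_periodic_cell_pos: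
  "octant_periodic d1 d2 (\<lambda>z. \<Phi> (\<lambda>i. cell_pos (n i) (z i)))"
proof -
  define G where "G \<omega> z = \<Phi> (\<lambda>i. (if octant_sign d1 \<omega> i = 1 then z i else z i - 1) mod (int (n i) + 1))"
    for \<omega> z
  have "octant_decomposition d1 d2 (\<lambda>z. \<Phi> (\<lambda>i. cell_pos (n i) (z i))) G"
    unfolding octant_decomposition_def
  proof (intro conjI ballI)
    fix \<omega>
    show "periodic (d1 + d2) (G \<omega>)"
      unfolding periodic_def
    proof (intro exI[of _ "\<lambda>i. n i + 1"] allI impI conjI ballI)
      fix i and z :: point
      have mods: "(z i + (int (n i) + 1)) mod (int (n i) + 1) = z i mod (int (n i) + 1)"
        "(z i + (int (n i) + 1) - 1) mod (int (n i) + 1) = (z i - 1) mod (int (n i) + 1)"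
        using mod_add_self2[of "z i" "int (n i) + 1"] mod_add_self2[of "z i - 1" "int (n i) + 1"]
        by (simp_all add: algebra_simps)
      have "(if octant_sign d1 \<omega> j = 1 then (z(i := z i + int (n i + 1))) j
            else (z(i := z i + int (n i + 1))) j - 1) mod (int (n j) + 1)
          = (if octant_sign d1 \<omega> j = 1 then z j else z j - 1) mod (int (n j) + 1)" for j
        using mods by (cases "j = i") (simp_all add: add.commute)
      then show "G \<omega> (z(i := z i + int (n i + 1))) = G \<omega> z"
        unfolding G_def by (simp only:)
    qed simp
  next
    fix z assume z: "z \<in> domain d1 d2"
    obtain \<omega> where \<omega>: "\<omega> \<in> sign_seqs d2" "z \<in> octant_part d1 \<omega>"
      using domain_in_octant_part[OF z] by blast
    have len: "length \<omega> = d2"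
      using \<omega>(1) by (simp add: sign_seqs_def)
    have "(\<Sum>\<omega>'\<in>sign_seqs d2. G \<omega>' z * indicator (octant \<omega>') (ypart d1 z))
        = (\<Sum>\<omega>'\<in>sign_seqs d2. if \<omega>' = \<omega> then G \<omega> z else 0)"
      using len by (intro sum.cong) (auto simp: sign_seqs_def ypart_in_octant_iff[OF \<omega>(2)])
    also have "\<dots> = G \<omega> z"
      using finite_sign_seqs \<omega>(1) by simp
    also have "G \<omega> z = \<Phi> (\<lambda>i. cell_pos (n i) (z i))"
    proof -
      have "(if octant_sign d1 \<omega> i = 1 then z i else z i - 1) = (if z i \<ge> 1 then z i else z i - 1)" for i
      proof (cases "i < d1 + d2")
        case True
        then have "if octant_sign d1 \<omega> i = 1 then z i \<ge> 1 else z i \<le> 0"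
          using \<omega>(2) len by (simp add: octant_part_def)
        then show ?thesis
          by (auto split: if_splits)
      next
        case False
        then have "octant_sign d1 \<omega> i = 0" "z i = 0"
          using z len by (auto simp: octant_sign_def domain_def lattice_def)
        then show ?thesis
          by simp
      qed
      then show ?thesis
        unfolding G_def cell_pos_def by (simp only:)
    qed
    finally show "\<Phi> (\<lambda>i. cell_pos (n i) (z i))
        = (\<Sum>\<omega>'\<in>sign_seqs d2. G \<omega>' z * indicator (octant \<omega>') (ypart d1 z))" ..
  qed
  then show ?thesis
    unfolding octant_periodic_def by blast
qed

definition site :: "'a \<Rightarrow> 'a \<Rightarrow> complex" where
  "site z = (\<lambda>w. if w = z then 1 else 0)"

lemma site_ell2:
  assumes "z \<in> S"
  shows "site z \<in> ell2 S" "ell2_norm S (site z) = 1" "ell2_inner S (site z) g = g z"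
proof -
  have F: "finite {z}" "{z} \<subseteq> S" "\<And>w. w \<notin> {z} \<Longrightarrow> site z w = 0"
    using assms by (auto simp: site_def)
  show "site z \<in> ell2 S"
    by (rule ell2_finite_support(1)[OF F])
  have "(ell2_norm S (site z))\<^sup>2 = (\<Sum>w\<in>{z}. (cmod (site z w))\<^sup>2)"
    by (rule ell2_finite_support(2)[OF F])
  also have "\<dots> = 1"
    by (simp add: site_def)
  finally show "ell2_norm S (site z) = 1"
    using ell2_norm_nonneg[of S "site z"] by (simp add: power2_eq_1_iff)
  show "ell2_inner S (site z) g = g z"
    by (subst ell2_inner_finite_support[OF F]) (simp_all add: site_def)
qed

lemma jacobi_op_site:
  assumes "z \<in> S"
  shows "jacobi_op d S a V (site z) z = of_real (V z)"
    and "\<bar>z j - w j\<bar> \<ge> 2 \<Longrightarrow> jacobi_op d S a V (site w) z = 0"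
proof -
  have ne: "z(i := z i - 1) \<noteq> z" "z(i := z i + 1) \<noteq> z" for i
    by (auto simp: fun_eq_iff intro!: exI[of _ i])
  show "jacobi_op d S a V (site z) z = of_real (V z)"
    using assms by (simp add: jacobi_op_def site_def ne)
  assume far: "\<bar>z j - w j\<bar> \<ge> 2"
  have "z \<noteq> w" "z(i := z i - 1) \<noteq> w" "z(i := z i + 1) \<noteq> w" for i
    using far by (auto simp: fun_eq_iff intro!: exI[of _ j])
  then show "jacobi_op d S a V (site w) z = 0"
    by (simp add: jacobi_op_def site_def)
qed

text \<open>
  Sites that differ by at least \<open>2\<close> in some coordinate are not adjacent; on their delta functions the
  form of the operator is diagonal with the values of the potential.
\<close>

lemma jacobi_gap_statement:
  fixes \<alpha> \<beta> m :: real and x y :: "nat \<Rightarrow> point"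
  assumes C: "0 \<le> C" "coeffs_bounded d S a V C"
    and R: "eigen_decomposable S (jacobi_op d S a V) R"
    and m: "\<alpha> < m" "m < \<beta>" and gap: "\<And>r. r \<in> R \<Longrightarrow> \<alpha> < r \<Longrightarrow> r < \<beta> \<Longrightarrow> r = m"
    and eig: "finite_dim (eigenspace S (jacobi_op d S a V) m)"
      "cfun.dim (eigenspace S (jacobi_op d S a V) m) = N"
    and x: "\<And>n. x n \<in> S" "\<And>n k. n \<noteq> k \<Longrightarrow> \<exists>j. \<bar>x n j - x k j\<bar> \<ge> 2" "\<And>n. V (x n) > m"
    and y: "\<And>n. y n \<in> S" "\<And>n k. n \<noteq> k \<Longrightarrow> \<exists>j. \<bar>y n j - y k j\<bar> \<ge> 2" "\<And>n. V (y n) < m"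
  defines "T \<equiv> jacobi_op d S a V"
  shows "gap_with_eigenvalues S T \<alpha> \<beta> N"
proof -
  interpret bounded_symmetric S T "(2 * real d + 1) * C"
    unfolding T_def by (rule jacobi_op_bounded_symmetric[OF C])
  interpret diagonal_operator S T "(2 * real d + 1) * C" R
    by unfold_locales (simp add: T_def R)
  have sites: "ell2_inner S (site (u n)) (site (u k)) = 0" "ell2_inner S (site (u n)) (T (site (u k))) = 0"
    if u: "\<And>n. u n \<in> S" "\<And>n k. n \<noteq> k \<Longrightarrow> \<exists>j. \<bar>u n j - u k j\<bar> \<ge> 2" and nk: "n \<noteq> k"
    for u :: "nat \<Rightarrow> point" and n k
  proof -
    obtain j where j: "\<bar>u n j - u k j\<bar> \<ge> 2"
      using u(2)[OF nk] by blast
    then have "u n \<noteq> u k"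
      by auto
    then show "ell2_inner S (site (u n)) (site (u k)) = 0"
      by (simp add: site_ell2(3)[OF u(1)]) (simp add: site_def)
    show "ell2_inner S (site (u n)) (T (site (u k))) = 0"
      using jacobi_op_site(2)[OF u(1)[of n], where w = "u k"] j by (simp add: site_ell2(3)[OF u(1)] T_def)
  qed
  have diag: "Re (ell2_inner S (site z) (T (site z))) = V z" if "z \<in> S" for z
    by (simp add: site_ell2(3)[OF that] T_def jacobi_op_site(1)[OF that])
  show ?thesis
  proof (rule gap_statement[of \<alpha> m \<beta> N "\<lambda>n. site (x n)" "\<lambda>n. site (y n)", OF m gap eig[folded T_def]])
    fix n k :: nat
    show "site (x n) \<in> ell2 S" "ell2_norm S (site (x n)) = 1"
      "site (y n) \<in> ell2 S" "ell2_norm S (site (y n)) = 1"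
      by (simp_all add: site_ell2 x(1) y(1))
    show "m < Re (ell2_inner S (site (x n)) (T (site (x n))))"
      "Re (ell2_inner S (site (y n)) (T (site (y n)))) < m"
      by (simp_all add: diag x(1,3) y(1,3))
    assume nk: "n \<noteq> k"
    show "ell2_inner S (site (x n)) (site (x k)) = 0" "ell2_inner S (site (x n)) (T (site (x k))) = 0"
      by (rule sites[OF x(1,2) nk]; assumption)+
    show "ell2_inner S (site (y n)) (site (y k)) = 0" "ell2_inner S (site (y n)) (T (site (y k))) = 0"
      by (rule sites[OF y(1,2) nk]; assumption)+
  qed
qed

definition axis_site :: "nat \<Rightarrow> nat \<Rightarrow> int \<Rightarrow> point" where
  "axis_site d j x = (\<lambda>i. if i = j then x else if i < d then 1 else 0)"

lemma axis_site_in_domain: "j < d1 + d2 \<Longrightarrow> x \<ge> 1 \<Longrightarrow> axis_site (d1 + d2) j x \<in> domain d1 d2"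
  by (auto simp: axis_site_def domain_def lattice_def)

text \<open>
  The sites with positive and with negative potential are taken where the first, respectively the second
  coordinate begins a long cell and all others are \<open>1\<close>; every second cell suffices to keep them apart.
\<close>

lemma (in corner_model) gap_model:
  fixes \<alpha> \<beta> :: real
  assumes \<alpha>\<beta>: "\<alpha> < \<beta>"
  shows "\<exists>V a. octant_periodic d1 d2 V \<and> (\<forall>i<d. octant_periodic d1 d2 (a i)) \<and>
    gap_with_eigenvalues D (jacobi_op d D a V) \<alpha> \<beta> N"
proof -
  obtain t M R where t: "t 0 = 1" "t 1 = - 1" and R: "eigen_decomposable D (H t d) R"
    and ker: "\<And>f. f \<in> ell2 D \<Longrightarrow> H t d f = (\<lambda>z. 0) \<Longrightarrow> A 0 f = A 1 f \<and> (\<forall>i\<in>{2..<d}. A i f = (\<lambda>z. 0))"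
    using exists_coefficients[OF two order_refl] by blast
  define m where "m = (\<alpha> + \<beta>) / 2"
  define \<delta> where "\<delta> = Min (insert 1 ((\<lambda>q. \<bar>q\<bar>) ` (R - {0})))"
  have fin: "finite R"
    using R by (simp add: eigen_decomposable_def)
  have \<delta>: "\<delta> > 0" "\<And>q. q \<in> R \<Longrightarrow> q \<noteq> 0 \<Longrightarrow> \<delta> \<le> \<bar>q\<bar>"
    using fin by (auto simp: \<delta>_def intro: Min_le)
  \<comment> \<open>All nonzero moduli in \<open>R\<close> are at least \<open>\<delta>\<close>, which is stretched to the length of the interval; so only
    the point \<open>0\<close> of \<open>R\<close> can be mapped into the interval, and it goes to the centre.\<close>
  define s where "s = (\<beta> - \<alpha>) / \<delta>"
  have s: "s > 0" "s * \<delta> = \<beta> - \<alpha>"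
    using \<delta>(1) \<alpha>\<beta> by (auto simp: s_def)
  define a where "a i z = s * t i * bond (cell_size i) (z i)" for i and z :: point
  define V where "V z = s * (\<Sum>i<d. t i * strength i * end_site (cell_size i) (z i)) + m" for z :: point
  define T where "T = jacobi_op d D a V"
  have V_eq: "V z = s * (end_site N (z 0) - 2 * end_site N (z 1)) + m" for z
  proof -
    have "(\<Sum>i<d. t i * strength i * end_site (cell_size i) (z i))
        = (\<Sum>i\<in>{0, 1}. t i * strength i * end_site (cell_size i) (z i))"
      using two by (intro sum.mono_neutral_right) (auto simp: strength_def)
    also have "\<dots> = end_site N (z 0) - 2 * end_site N (z 1)"
      using t by (simp add: strength_def cell_size_def)
    finally show ?thesis
      by (simp only: V_def)
  qed
  have T_eq: "T f = (\<lambda>z. of_real s * H t d f z + of_real m * f z)" if f: "f \<in> ell2 D" for f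
  proof
    fix z
    show "T f z = of_real s * H t d f z + of_real m * f z"
    proof (cases "z \<in> D")
      case True
      have "H t d f z = (\<Sum>i<d. of_real (t i) *
          (of_real (bond (cell_size i) (z i - 1)) * f (z(i := z i - 1)) + of_real (bond (cell_size i) (z i)) * f (z(i := z i + 1))
           + of_real (strength i * end_site (cell_size i) (z i)) * f z))"
        unfolding H_def A_def using True by (intro sum.cong) (auto simp: axis_op_apply)
      also have "\<dots> = (\<Sum>i<d. of_real (t i * bond (cell_size i) (z i - 1)) * f (z(i := z i - 1))
            + of_real (t i * bond (cell_size i) (z i)) * f (z(i := z i + 1)))
          + of_real (\<Sum>i<d. t i * strength i * end_site (cell_size i) (z i)) * f z"
        by (simp add: sum.distrib[symmetric] sum_distrib_right of_real_sum distrib_left mult.assoc)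
      finally have eq: "H t d f z = \<dots>" .
      show ?thesis
        unfolding eq T_def jacobi_op_def a_def V_def using True
        by (simp add: sum_distrib_left distrib_left distrib_right mult.assoc)
    next
      case False
      then show ?thesis
        by (simp add: T_def jacobi_op_def H_def A_def axis_op_off ell2_off[OF f])
    qed
  qed
  have dec: "eigen_decomposable D T ((\<lambda>r. s * r + m) ` R)"
    using s(1) by (intro eigen_decomposable_affine[OF R] T_eq) auto
  have eig: "eigenspace D T m = corner_space"
  proof -
    have "minus_scalar T m f = 0 \<longleftrightarrow> H t d f = (\<lambda>z. 0)" if "f \<in> ell2 D" for f
      using s(1) by (auto simp: minus_scalar_def T_eq[OF that] fun_eq_iff)
    then have "eigenspace D T m = {f \<in> ell2 D. H t d f = (\<lambda>z. 0)}"
      unfolding eigenspace_def by blast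
    also have "\<dots> = corner_space"
      by (rule H_kernel[OF two t ker])
    finally show ?thesis .
  qed
  have "\<exists>C\<ge>0. coeffs_bounded d D a V C"
  proof (rule common_coeff_bound)
    show "\<exists>C\<ge>0. \<forall>z\<in>D. \<bar>V z\<bar> \<le> C"
      by (intro exI[of _ "3 * s + \<bar>m\<bar>"]) (use s(1) in \<open>auto simp: V_eq end_site_def\<close>)
    show "\<exists>C\<ge>0. \<forall>z\<in>D. \<bar>a i z\<bar> \<le> C" for i
      by (intro exI[of _ "\<bar>s * t i\<bar>"]) (auto simp: a_def bond_def)
  qed
  then obtain C where C: "C \<ge> 0" "coeffs_bounded d D a V C"
    by blast
  have start: "end_site N (2 * (int N + 1) * (int k + 1)) = 1" for k
  proof -
    have "2 * (int N + 1) * (int k + 1) \<ge> 1"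
      using mult_mono[of 1 "2 * (int N + 1)" 1 "int k + 1"] by simp
    then have "cell_pos N (2 * (int N + 1) * (int k + 1)) = 2 * (int N + 1) * (int k + 1) mod (int N + 1)"
      by (simp add: cell_pos_def)
    also have "\<dots> = 0"
    proof -
      have "2 * (int N + 1) * (int k + 1) = (int N + 1) * (2 * (int k + 1))"
        by (simp add: algebra_simps)
      then show ?thesis
        by (simp only: mod_mult_self1_is_0)
    qed
    finally show ?thesis
      by (simp add: end_site_def)
  qed
  have one: "end_site N 1 = 0"
    using cell_pos_short[of 1 N] N by (simp add: end_site_def short_cell_def)
  define x where "x j k = axis_site d j (2 * (int N + 1) * (int k + 1))" for j k
  have xD: "x j k \<in> D" if "j < d" for j k
    unfolding x_def using that mult_mono[of 1 "2 * (int N + 1)" 1 "int k + 1"]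
    by (intro axis_site_in_domain) auto
  have far: "\<exists>i. \<bar>x j k i - x j l i\<bar> \<ge> 2" if "k \<noteq> l" for j k l
  proof -
    have "x j k j - x j l j = 2 * (int N + 1) * (int k - int l)"
      by (simp add: x_def axis_site_def algebra_simps)
    moreover have "2 * 1 \<le> \<bar>2 * (int N + 1)\<bar> * \<bar>int k - int l\<bar>"
      using that by (intro mult_mono) auto
    ultimately show ?thesis
      by (intro exI[of _ j]) (simp add: abs_mult)
  qed
  have idx: "0 < d" "1 < d"
    using two by auto
  have "gap_with_eigenvalues D T \<alpha> \<beta> N"
    unfolding T_def
  proof (rule jacobi_gap_statement[of C d D a V "(\<lambda>r. s * r + m) ` R" \<alpha> m \<beta> N "x 0" "x 1", OF C dec[unfolded T_def]])
    show "\<alpha> < m" "m < \<beta>"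
      using \<alpha>\<beta> by (auto simp: m_def)
    fix q assume "q \<in> (\<lambda>r. s * r + m) ` R" "\<alpha> < q" "q < \<beta>"
    then obtain r where r: "r \<in> R" "q = s * r + m" "\<bar>s * r\<bar> < (\<beta> - \<alpha>) / 2"
      by (auto simp: m_def abs_less_iff field_simps)
    have "r = 0"
    proof (rule ccontr)
      assume "r \<noteq> 0"
      then have "s * \<delta> \<le> s * \<bar>r\<bar>"
        using \<delta>(2)[OF r(1)] s(1) by simp
      then show False
        using r(3) s \<alpha>\<beta> by (simp add: abs_mult)
    qed
    then show "q = m"
      by (simp add: r(2))
  next
    show "finite_dim (eigenspace D (jacobi_op d D a V) m)" "cfun.dim (eigenspace D (jacobi_op d D a V) m) = N"
      using corner_space_dim by (simp_all add: eig T_def[symmetric])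
  next
    fix k l :: nat
    show "x 0 k \<in> D" "x 1 k \<in> D"
      using xD idx by auto
    show "m < V (x 0 k)" "V (x 1 k) < m"
      using s(1) start[of k] one two by (simp_all add: V_eq x_def axis_site_def)
    assume "k \<noteq> l"
    then show "\<exists>j. \<bar>x 0 k j - x 0 l j\<bar> \<ge> 2" "\<exists>j. \<bar>x 1 k j - x 1 l j\<bar> \<ge> 2"
      using far by blast+
  qed
  moreover have "octant_periodic d1 d2 V"
    unfolding V_def end_site_def
    using octant_periodic_cell_pos[of d1 d2 "\<lambda>p. s * (\<Sum>i<d. t i * strength i * (if p i = 0 then 1 else 0)) + m" cell_size] .
  moreover have "octant_periodic d1 d2 (a i)" for i
    unfolding a_def[abs_def] bond_def
    using octant_periodic_cell_pos[of d1 d2 "\<lambda>p. s * t i * (if p i = int (cell_size i) then 0 else 1)" cell_size] .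
  ultimately show ?thesis
    unfolding T_def by blast
qed

text \<open>
  Without hopping the operator multiplies by the potential, here with the ends of the interval as its
  two values.
\<close>

lemma empty_gap_model:
  fixes d1 d2 :: nat and \<alpha> \<beta> :: real
  assumes d: "d1 + d2 \<ge> 1" and \<alpha>\<beta>: "\<alpha> < \<beta>"
  defines "D \<equiv> domain d1 d2"
  shows "\<exists>V a. octant_periodic d1 d2 V \<and> (\<forall>i<d1 + d2. octant_periodic d1 d2 (a i)) \<and>
    gap_with_eigenvalues D (jacobi_op (d1 + d2) D a V) \<alpha> \<beta> 0"
proof -
  define m where "m = (\<alpha> + \<beta>) / 2"
  define V where "V z = (if cell_pos 1 (z 0) = 0 then \<beta> else \<alpha>)" for z :: point
  define a :: "nat \<Rightarrow> point \<Rightarrow> real" where "a i z = 0" for i z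
  define T where "T = jacobi_op (d1 + d2) D a V"
  have m: "\<alpha> < m" "m < \<beta>"
    using \<alpha>\<beta> by (auto simp: m_def)
  have T_eq: "T f z = of_real (V z) * f z" if "f \<in> ell2 D" for f z
    using ell2_off[OF that, of z] by (simp add: T_def jacobi_op_def a_def)
  have dec: "eigen_decomposable D T {\<alpha>, \<beta>}"
    unfolding eigen_decomposable_def
  proof (intro conjI ballI)
    fix f assume f: "f \<in> ell2 D"
    define g where "g r = (\<lambda>z. if V z = r then f z else 0)" for r
    have g: "g r \<in> ell2 D" for r
      by (rule ell2_dominated(1)[OF f]) (simp add: g_def)
    have "eigen_family D T {\<alpha>, \<beta>} g"
    proof -
      have "T (g r) z = of_real r * g r z" for r z
        unfolding T_eq[OF g] by (simp add: g_def)
      then show ?thesis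
        unfolding eigen_family_def using g by auto
    qed
    moreover have "f = (\<lambda>z. \<Sum>r\<in>{\<alpha>, \<beta>}. g r z)"
      using \<alpha>\<beta> by (auto simp: g_def V_def)
    ultimately show "\<exists>g. eigen_family D T {\<alpha>, \<beta>} g \<and> f = (\<lambda>z. \<Sum>r\<in>{\<alpha>, \<beta>}. g r z)"
      by blast
  qed simp
  have "f = 0" if "f \<in> eigenspace D T m" for f
  proof
    fix z
    have "T f z - of_real m * f z = 0"
      using that by (auto simp: eigenspace_def minus_scalar_def fun_eq_iff)
    moreover have "f \<in> ell2 D"
      using that by (simp add: eigenspace_def)
    ultimately have "(of_real (V z) - of_real m) * f z = 0"
      by (simp add: T_eq left_diff_distrib)
    moreover have "V z \<noteq> m"
      using m by (auto simp: V_def)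
    ultimately show "f z = 0 z"
      by simp
  qed
  moreover have "0 \<in> eigenspace D T m"
    by (auto simp: eigenspace_def minus_scalar_def T_eq fun_eq_iff)
  ultimately have eig: "eigenspace D T m = {0}"
    by blast
  have dim: "finite_dim (eigenspace D T m)" "cfun.dim (eigenspace D T m) = 0"
    unfolding eig by (rule dim_by_evaluation[where N = 0]; auto simp: fun_eq_iff)+
  have C: "coeffs_bounded (d1 + d2) D a V (\<bar>\<alpha>\<bar> + \<bar>\<beta>\<bar>)"
    by (auto simp: coeffs_bounded_def a_def V_def)
  define x where "x c k = axis_site (d1 + d2) 0 (2 * int k + c)" for c :: int and k :: nat
  have xD: "x c k \<in> D" if "c \<ge> 1" for c k
    unfolding x_def D_def using that d by (intro axis_site_in_domain) auto
  have far: "\<exists>j. \<bar>x c k j - x c l j\<bar> \<ge> 2" if "k \<noteq> l" for c k l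
    using that by (intro exI[of _ 0]) (auto simp: x_def axis_site_def)
  have "gap_with_eigenvalues D T \<alpha> \<beta> 0"
    unfolding T_def
  proof (rule jacobi_gap_statement[of "\<bar>\<alpha>\<bar> + \<bar>\<beta>\<bar>" "d1 + d2" D a V "{\<alpha>, \<beta>}" \<alpha> m \<beta> 0 "x 2" "x 1", OF _ C dec[unfolded T_def] m])
    show "finite_dim (eigenspace D (jacobi_op (d1 + d2) D a V) m)"
      "cfun.dim (eigenspace D (jacobi_op (d1 + d2) D a V) m) = 0"
      using dim by (simp_all add: T_def)
    fix k l :: nat
    show "x 2 k \<in> D" "x 1 k \<in> D"
      by (simp_all add: xD)
    have "cell_pos 1 (2 * int k + 2) = 0" "cell_pos 1 (2 * int k + 1) = 1"
      by (simp_all add: cell_pos_def)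
    then show "m < V (x 2 k)" "V (x 1 k) < m"
      using m by (simp_all add: V_def x_def axis_site_def)
    assume "k \<noteq> l"
    then show "\<exists>j. \<bar>x 2 k j - x 2 l j\<bar> \<ge> 2" "\<exists>j. \<bar>x 1 k j - x 1 l j\<bar> \<ge> 2"
      using far by blast+
  qed auto
  moreover have "octant_periodic d1 d2 V"
    unfolding V_def[abs_def]
    using octant_periodic_cell_pos[of d1 d2 "\<lambda>p. if p 0 = 0 then \<beta> else \<alpha>" "\<lambda>i. 1"] .
  moreover have "octant_periodic d1 d2 (a i)" for i
    unfolding a_def[abs_def] using octant_periodic_cell_pos[of d1 d2 "\<lambda>p. 0" "\<lambda>i. 1"] .
  ultimately show ?thesis
    unfolding T_def by blast
qed

theorem theorem1p1:
  fixes d1 d2 :: nat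
  assumes "d1 + d2 \<ge> 2"
  shows
    "(\<forall>(V :: point \<Rightarrow> real) (a :: nat \<Rightarrow> point \<Rightarrow> real)
       (V\<omega> :: sign list \<Rightarrow> point \<Rightarrow> real) (a\<omega> :: sign list \<Rightarrow> nat \<Rightarrow> point \<Rightarrow> real).
        octant_decomposition d1 d2 V V\<omega> \<and>
        (\<forall>i<d1 + d2. octant_decomposition d1 d2 (a i) (\<lambda>\<omega>. a\<omega> \<omega> i)) \<longrightarrow>
        (\<Union>\<omega>\<in>sign_seqs d2.
            spectrum (lattice (d1 + d2)) (jacobi_op (d1 + d2) (lattice (d1 + d2)) (a\<omega> \<omega>) (V\<omega> \<omega>)))
          \<subseteq> ess_spectrum (domain d1 d2) (jacobi_op (d1 + d2) (domain d1 d2) a V))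
     \<and>
     (\<forall>(\<alpha>::real) (\<beta>::real) (N::nat). \<alpha> < \<beta> \<longrightarrow>
        (\<exists>(V :: point \<Rightarrow> real) (a :: nat \<Rightarrow> point \<Rightarrow> real).
           octant_periodic d1 d2 V \<and> (\<forall>i<d1 + d2. octant_periodic d1 d2 (a i)) \<and>
           (let D = domain d1 d2;
                H = jacobi_op (d1 + d2) D a V;
                I = complex_of_real ` {\<alpha><..<\<beta>}
            in eigenvalue_count D H I N \<and>
               spectrum D H \<inter> I = eigenvalues D H \<inter> I \<and>
               (\<exists>t\<le>\<alpha>. complex_of_real t \<in> spectrum D H) \<and>
               (\<exists>t\<ge>\<beta>. complex_of_real t \<in> spectrum D H) \<and>
               (\<exists>E. spectral_measure D H E \<and>
                    \<not> finite_dim (E {..\<alpha>} ` ell2 D) \<and>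
                    \<not> finite_dim (E {\<beta>..} ` ell2 D)))))"
proof (intro conjI allI impI)
  fix V a V\<omega> a\<omega>
  assume "octant_decomposition d1 d2 V V\<omega> \<and>
    (\<forall>i<d1 + d2. octant_decomposition d1 d2 (a i) (\<lambda>\<omega>. a\<omega> \<omega> i))"
  then show "(\<Union>\<omega>\<in>sign_seqs d2.
      spectrum (lattice (d1 + d2)) (jacobi_op (d1 + d2) (lattice (d1 + d2)) (a\<omega> \<omega>) (V\<omega> \<omega>)))
      \<subseteq> ess_spectrum (domain d1 d2) (jacobi_op (d1 + d2) (domain d1 d2) a V)"
    using assms by (intro UN_least octant_spectrum_subset_ess_spectrum) auto
next
  fix \<alpha> \<beta> :: real and N :: nat
  assume \<alpha>\<beta>: "\<alpha> < \<beta>"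
  show "\<exists>V a. octant_periodic d1 d2 V \<and> (\<forall>i<d1 + d2. octant_periodic d1 d2 (a i)) \<and>
           (let D = domain d1 d2;
                H = jacobi_op (d1 + d2) D a V;
                I = complex_of_real ` {\<alpha><..<\<beta>}
            in eigenvalue_count D H I N \<and>
               spectrum D H \<inter> I = eigenvalues D H \<inter> I \<and>
               (\<exists>t\<le>\<alpha>. complex_of_real t \<in> spectrum D H) \<and>
               (\<exists>t\<ge>\<beta>. complex_of_real t \<in> spectrum D H) \<and>
               (\<exists>E. spectral_measure D H E \<and>
                    \<not> finite_dim (E {..\<alpha>} ` ell2 D) \<and>
                    \<not> finite_dim (E {\<beta>..} ` ell2 D)))"
  proof (cases N)
    case 0
    then show ?thesis
      using empty_gap_model[of d1 d2, OF _ \<alpha>\<beta>] assms by (simp add: gap_with_eigenvalues_def Let_def)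
  next
    case (Suc n)
    interpret corner_model d1 d2 N
      using assms by unfold_locales (simp_all add: Suc)
    show ?thesis
      using gap_model[OF \<alpha>\<beta>] by (simp only: gap_with_eigenvalues_def Let_def)
  qed
qed

end
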